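(* Let $C$ be a complete integral curve of arithmetic genus $g\ge2$ over an algebraically closed field $k$, and let $C'\subset\mathbb P^{g-1}$ be its canonical model. If $C$ is Gorenstein, then $C'$ is projectively normal.
   Context: The field $k$ has arbitrary characteristic. $\omega$ is the dualizing sheaf of $C$; $C$ is Gorenstein iff $\omega$ is invertible. Canonical model: let $\nu\colon\bar C\to C$ be the normalization and $\mathcal O_{\bar C}\omega:=\nu^*\omega/\mathrm{Torsion}(\nu^*\omega)$. The $g$-dimensional space $H^0(\omega)$ generates $\omega$, so $\mathcal O_{\bar C}\omega$ is invertible and generated by $H^0(\omega)$; this defines a nondegenerate map $\bar\kappa\colon\bar C\to\mathbb P^{g-1}$, whose image is the canonical model $C'$. Projectively normal: $C'$ is projectively normal if the linear series of hypersurface sections of degree $n$ is complete for every $n\ge1$; in other words, if the natural map $\mathrm{Sym}^nH^0(\omega)\to H^0(\mathcal O_{C'}(n))$ is surjective for every $n\ge1$. *)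

theory Defs
  imports "HOL-Computational_Algebra.Polynomial"
begin

section \<open>Integral schemes as sets of local rings in the function field\<close>

text \<open>
  A separated integral scheme of finite type over \<open>k\<close> is represented by the set of its local rings,
  viewed as subrings of its function field \<open>K\<close> (Chevalley's schemes; EGA I (1960), section 8).
  Throughout, \<open>K\<close> is the universe of the type \<open>'a\<close>, and \<open>\<iota> :: 'k \<Rightarrow> 'a\<close> is the structure map of the
  \<open>k\<close>-algebra \<open>K\<close>. A point of a scheme \<open>X\<close> \emph{is} its local ring \<open>P \<in> X\<close>, so the stalk of the
  structure sheaf at \<open>P\<close> is \<open>P\<close> itself; the generic point is \<open>UNIV\<close>, and \<open>P\<close> lies in the closure of
  \<open>Q\<close> iff \<open>P \<subseteq> Q\<close>.
\<close>

definition field_embedding :: "('k::field \<Rightarrow> 'a::field) \<Rightarrow> bool" where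
  "field_embedding \<iota> \<longleftrightarrow>
     \<iota> 1 = 1 \<and> (\<forall>x y. \<iota> (x + y) = \<iota> x + \<iota> y) \<and> (\<forall>x y. \<iota> (x * y) = \<iota> x * \<iota> y)"

definition is_subring :: "'a::field set \<Rightarrow> bool" where
  "is_subring R \<longleftrightarrow> 1 \<in> R \<and> (\<forall>x\<in>R. \<forall>y\<in>R. x - y \<in> R \<and> x * y \<in> R)"

definition is_prime_ideal :: "'a::field set \<Rightarrow> 'a set \<Rightarrow> bool" where
  "is_prime_ideal A p \<longleftrightarrow>
     p \<subseteq> A \<and> 0 \<in> p \<and> (\<forall>x\<in>p. \<forall>y\<in>p. x + y \<in> p) \<and> (\<forall>a\<in>A. \<forall>x\<in>p. a * x \<in> p) \<and>
     1 \<notin> p \<and> (\<forall>x\<in>A. \<forall>y\<in>A. x * y \<in> p \<longrightarrow> x \<in> p \<or> y \<in> p)"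

definition localization_at :: "'a::field set \<Rightarrow> 'a set \<Rightarrow> 'a set" where
  "localization_at A p = {x / s | x s. x \<in> A \<and> s \<in> A - p}"

text \<open>The local rings of \<open>Spec A\<close>.\<close>

definition local_rings :: "'a::field set \<Rightarrow> 'a set set" where
  "local_rings A = {localization_at A p | p. is_prime_ideal A p}"

definition affine_domain :: "('k::field \<Rightarrow> 'a::field) \<Rightarrow> 'a set \<Rightarrow> bool" where
  "affine_domain \<iota> A \<longleftrightarrow>
     (\<exists>S. finite S \<and> A = is_subring hull (range \<iota> \<union> S)) \<and>
     (\<forall>x. \<exists>a\<in>A. \<exists>b\<in>A. b \<noteq> 0 \<and> x = a / b)"

text \<open>The non-units of \<open>R\<close>; this is the maximal ideal when \<open>R\<close> is local.\<close>

definition max_ideal :: "'a::field set \<Rightarrow> 'a set" where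
  "max_ideal R = {x \<in> R. x = 0 \<or> inverse x \<notin> R}"

definition dominates :: "'a::field set \<Rightarrow> 'a set \<Rightarrow> bool" where
  "dominates V M \<longleftrightarrow> M \<subseteq> V \<and> max_ideal V \<inter> M = max_ideal M"

definition valuation_ring :: "('k::field \<Rightarrow> 'a::field) \<Rightarrow> 'a set \<Rightarrow> bool" where
  "valuation_ring \<iota> V \<longleftrightarrow>
     is_subring V \<and> range \<iota> \<subseteq> V \<and> (\<forall>x. x \<in> V \<or> inverse x \<in> V)"

text \<open>
  A valuation ring dominates at most one point of a separated scheme and at least one point of a
  complete one (the valuative criteria).
\<close>

definition integral_scheme :: "('k::field \<Rightarrow> 'a::field) \<Rightarrow> 'a set set \<Rightarrow> bool" where
  "integral_scheme \<iota> X \<longleftrightarrow>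
     (\<exists>\<A>. finite \<A> \<and> \<A> \<noteq> {} \<and> (\<forall>A\<in>\<A>. affine_domain \<iota> A) \<and> X = (\<Union>A\<in>\<A>. local_rings A)) \<and>
     (\<forall>V M N. valuation_ring \<iota> V \<and> M \<in> X \<and> N \<in> X \<and> dominates V M \<and> dominates V N \<longrightarrow> M = N)"

definition complete_scheme :: "('k::field \<Rightarrow> 'a::field) \<Rightarrow> 'a set set \<Rightarrow> bool" where
  "complete_scheme \<iota> X \<longleftrightarrow> (\<forall>V. valuation_ring \<iota> V \<longrightarrow> (\<exists>M\<in>X. dominates V M))"

text \<open>Chains of irreducible closed subsets are chains of points under specialization.\<close>

definition one_dimensional :: "'a::field set set \<Rightarrow> bool" where
  "one_dimensional X \<longleftrightarrow>
     (\<exists>M\<in>X. M \<noteq> UNIV) \<and> (\<forall>M\<in>X. \<forall>N\<in>X. M \<subset> N \<longrightarrow> N = UNIV)"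

definition complete_integral_curve :: "('k::field \<Rightarrow> 'a::field) \<Rightarrow> 'a set set \<Rightarrow> bool" where
  "complete_integral_curve \<iota> X \<longleftrightarrow>
     field_embedding \<iota> \<and> integral_scheme \<iota> X \<and> complete_scheme \<iota> X \<and> one_dimensional X"

text \<open>The closed points of a one-dimensional \<open>X\<close>.\<close>

definition closed_points :: "'a set set \<Rightarrow> 'a set set" where
  "closed_points X = X - {UNIV}"

definition integral_closure :: "'a::field set \<Rightarrow> 'a set" where
  "integral_closure R =
     {x. \<exists>p. lead_coeff p = 1 \<and> (\<forall>i. coeff p i \<in> R) \<and> poly p x = 0}"

text \<open>The normalization, obtained point by point from the integral closures of the local rings.\<close>

definition normalization :: "'a::field set set \<Rightarrow> 'a set set" where
  "normalization X = (\<Union>P\<in>X. local_rings (integral_closure P))"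

definition normalization_map :: "'a::field set set \<Rightarrow> 'a set \<Rightarrow> 'a set" where
  "normalization_map X Q = (THE P. P \<in> X \<and> dominates Q P)"


section \<open>Torsion-free coherent sheaves on a curve and their cohomology\<close>

text \<open>\<open>K\<^sup>r\<close>: functions on \<open>nat\<close> supported on \<open>{..<r}\<close>.\<close>

definition vecs :: "nat \<Rightarrow> (nat \<Rightarrow> 'b::zero) set" where
  "vecs r = {v. \<forall>i\<ge>r. v i = 0}"

text \<open>
  A coherent torsion-free sheaf \<open>F\<close> of rank \<open>r\<close> embeds in the constant sheaf \<open>K\<^sup>r\<close>, its generic stalk.
  It is given by its stalks \<open>F P \<subseteq> K\<^sup>r\<close> at the closed points: finitely generated \<open>P\<close>-modules that span
  \<open>K\<^sup>r\<close> over \<open>K\<close> and equal \<open>P\<^sup>r\<close> at all but finitely many \<open>P\<close>.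
\<close>

definition torsion_free_coherent ::
    "'a::field set set \<Rightarrow> nat \<Rightarrow> ('a set \<Rightarrow> (nat \<Rightarrow> 'a) set) \<Rightarrow> bool" where
  "torsion_free_coherent X r F \<longleftrightarrow>
     (\<forall>P\<in>closed_points X.
        (\<exists>S. finite S \<and> S \<subseteq> vecs r \<and>
             F P = {(\<lambda>i. \<Sum>s\<in>S. c s * s i) | c. \<forall>s\<in>S. c s \<in> P}) \<and>
        (\<forall>v\<in>vecs r. \<exists>b\<in>P. b \<noteq> 0 \<and> (\<lambda>i. b * v i) \<in> F P)) \<and>
     finite {P \<in> closed_points X. F P \<noteq> {v \<in> vecs r. \<forall>i. v i \<in> P}}"

text \<open>
  \<open>H\<^sup>1(F)\<close> is computed from the flasque resolution
  \<open>0 \<rightarrow> F \<rightarrow> K\<^sup>r \<rightarrow> \<Oplus>\<^bsub>P\<^esub> K\<^sup>r / F P \<rightarrow> 0\<close>, that is, \<open>H\<^sup>1(F) = adeles X r F / H1_null X r F\<close>,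
  where \<open>H1_null X r F\<close> is the sum of the diagonal \<open>K\<^sup>r\<close> and the product of the stalks.
  The values of a family outside \<open>closed_points X\<close> play no role.
\<close>

definition adeles ::
    "'a::field set set \<Rightarrow> nat \<Rightarrow> ('a set \<Rightarrow> (nat \<Rightarrow> 'a) set) \<Rightarrow> ('a set \<Rightarrow> nat \<Rightarrow> 'a) set" where
  "adeles X r F =
     {\<xi>. (\<forall>P\<in>closed_points X. \<xi> P \<in> vecs r) \<and> finite {P \<in> closed_points X. \<xi> P \<notin> F P}}"

definition H1_null ::
    "'a::field set set \<Rightarrow> nat \<Rightarrow> ('a set \<Rightarrow> (nat \<Rightarrow> 'a) set) \<Rightarrow> ('a set \<Rightarrow> nat \<Rightarrow> 'a) set" where
  "H1_null X r F = {\<xi>. \<exists>v\<in>vecs r. \<forall>P\<in>closed_points X. (\<lambda>i. \<xi> P i - v i) \<in> F P}"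

text \<open>A \<open>k\<close>-linear form on \<open>H\<^sup>1(F)\<close>.\<close>

definition H1_form ::
    "('k::field \<Rightarrow> 'a::field) \<Rightarrow> 'a set set \<Rightarrow> nat \<Rightarrow> ('a set \<Rightarrow> (nat \<Rightarrow> 'a) set) \<Rightarrow>
     (('a set \<Rightarrow> nat \<Rightarrow> 'a) \<Rightarrow> 'k) \<Rightarrow> bool" where
  "H1_form \<iota> X r F l \<longleftrightarrow>
     (\<forall>\<xi>\<in>adeles X r F. \<forall>\<eta>\<in>adeles X r F. l (\<lambda>P i. \<xi> P i + \<eta> P i) = l \<xi> + l \<eta>) \<and>
     (\<forall>\<xi>\<in>adeles X r F. \<forall>c. l (\<lambda>P i. \<iota> c * \<xi> P i) = c * l \<xi>) \<and>
     (\<forall>\<xi>\<in>H1_null X r F. l \<xi> = 0)"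

text \<open>\<open>H\<^sup>1(F)\<close> has a basis with \<open>d\<close> elements.\<close>

definition H1_has_dim ::
    "('k::field \<Rightarrow> 'a::field) \<Rightarrow> 'a set set \<Rightarrow> nat \<Rightarrow> ('a set \<Rightarrow> (nat \<Rightarrow> 'a) set) \<Rightarrow> nat \<Rightarrow> bool" where
  "H1_has_dim \<iota> X r F d \<longleftrightarrow>
     (\<exists>B. (\<forall>j<d. B j \<in> adeles X r F) \<and>
          (\<forall>\<eta>\<in>adeles X r F. \<exists>!c. c \<in> vecs d \<and>
             (\<lambda>P i. \<eta> P i - (\<Sum>j<d. \<iota> (c j) * B j P i)) \<in> H1_null X r F))"

text \<open>
  A fractional sheaf is a torsion-free sheaf of rank one, embedded in the constant sheaf \<open>K\<close>; its
  stalks are subsets of \<open>K\<close>. We regard it as a rank one sheaf in the above sense via \<open>K \<cong> K\<^sup>1\<close>.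
\<close>

definition line :: "'a::zero \<Rightarrow> nat \<Rightarrow> 'a" where
  "line x = (\<lambda>i. if i = 0 then x else 0)"

definition rank1 :: "('a::zero set \<Rightarrow> 'a set) \<Rightarrow> 'a set \<Rightarrow> (nat \<Rightarrow> 'a) set" where
  "rank1 L P = line ` L P"

definition arithmetic_genus :: "('k::field \<Rightarrow> 'a::field) \<Rightarrow> 'a set set \<Rightarrow> nat \<Rightarrow> bool" where
  "arithmetic_genus \<iota> X g \<longleftrightarrow> H1_has_dim \<iota> X 1 (rank1 (\<lambda>P. P)) g"

definition H0 :: "'a set set \<Rightarrow> ('a set \<Rightarrow> 'a set) \<Rightarrow> 'a set" where
  "H0 X L = {x. \<forall>P\<in>closed_points X. x \<in> L P}"

text \<open>
  Sheaf homomorphisms from \<open>F \<subseteq> K\<^sup>r\<close> to \<open>L \<subseteq> K\<close> are the \<open>K\<close>-linear forms on \<open>K\<^sup>r\<close> that map every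
  stalk of \<open>F\<close> into the stalk of \<open>L\<close>; \<open>c\<close> is the coefficient vector of the form.
\<close>

definition sheaf_hom ::
    "'a::field set set \<Rightarrow> nat \<Rightarrow> ('a set \<Rightarrow> (nat \<Rightarrow> 'a) set) \<Rightarrow> ('a set \<Rightarrow> 'a set) \<Rightarrow> (nat \<Rightarrow> 'a) set" where
  "sheaf_hom X r F L =
     {c \<in> vecs r. \<forall>P\<in>closed_points X. \<forall>v\<in>F P. (\<Sum>i<r. c i * v i) \<in> L P}"

text \<open>
  \<open>\<omega>\<close> is dualizing if, for some trace \<open>t : H\<^sup>1(\<omega>) \<rightarrow> k\<close>, the map \<open>Hom(F, \<omega>) \<rightarrow> H\<^sup>1(F)\<^sup>*\<close> sending \<open>c\<close> to
  \<open>t \<circ> H\<^sup>1(c)\<close> is bijective for every coherent \<open>F\<close>. It suffices to let \<open>F\<close> be torsion-free: since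
  \<open>\<omega>\<close> is torsion-free and torsion sheaves have no \<open>H\<^sup>1\<close>, neither side changes when \<open>F\<close> is replaced by
  its quotient by torsion.
\<close>

definition dualizing_sheaf ::
    "('k::field \<Rightarrow> 'a::field) \<Rightarrow> 'a set set \<Rightarrow> ('a set \<Rightarrow> 'a set) \<Rightarrow> bool" where
  "dualizing_sheaf \<iota> X \<omega> \<longleftrightarrow>
     torsion_free_coherent X 1 (rank1 \<omega>) \<and>
     (\<exists>t. H1_form \<iota> X 1 (rank1 \<omega>) t \<and>
        (\<forall>r F. torsion_free_coherent X r F \<longrightarrow>
           (\<forall>l. H1_form \<iota> X r F l \<longrightarrow>
              (\<exists>!c. c \<in> sheaf_hom X r F \<omega> \<and>
                 (\<forall>\<xi>\<in>adeles X r F. l \<xi> = t (\<lambda>P. line (\<Sum>i<r. c i * \<xi> P i)))))))"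

text \<open>Locally free of rank one.\<close>

definition invertible_sheaf :: "'a::field set set \<Rightarrow> ('a set \<Rightarrow> 'a set) \<Rightarrow> bool" where
  "invertible_sheaf X L \<longleftrightarrow>
     (\<forall>P\<in>closed_points X. \<exists>u. u \<noteq> 0 \<and> L P = {u * x | x. x \<in> P})"

definition is_basis :: "('k::field \<Rightarrow> 'a::field) \<Rightarrow> 'a set \<Rightarrow> nat \<Rightarrow> (nat \<Rightarrow> 'a) \<Rightarrow> bool" where
  "is_basis \<iota> V d w \<longleftrightarrow>
     (\<forall>i<d. w i \<in> V) \<and> (\<forall>x\<in>V. \<exists>!c. c \<in> vecs d \<and> x = (\<Sum>i<d. \<iota> (c i) * w i))"


section \<open>Projective varieties and projective normality\<close>

text \<open>
  A closed subvariety of the projective space with homogeneous coordinates \<open>x\<^sub>0, \<dots>, x\<^bsub>N-1\<^esub>\<close> is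
  represented by the set of all homogeneous coordinate vectors of its closed points, i.e. by its
  punctured affine cone in \<open>vecs N\<close>. A form is represented by the function it induces, which
  determines it since the ground field is infinite.
\<close>

definition monomials :: "nat \<Rightarrow> nat \<Rightarrow> (nat \<Rightarrow> nat) set" where
  "monomials N d = {m \<in> vecs N. (\<Sum>i<N. m i) = d}"

lemma finite_monomials: "finite (monomials N d)"
proof (rule finite_subset)
  show "monomials N d \<subseteq> {m. \<forall>i. (i \<in> {..<N} \<longrightarrow> m i \<in> {..d}) \<and> (i \<notin> {..<N} \<longrightarrow> m i = 0)}"
    unfolding monomials_def vecs_def
    by (auto simp: member_le_sum intro!: member_le_sum)
  show "finite {m::nat \<Rightarrow> nat. \<forall>i. (i \<in> {..<N} \<longrightarrow> m i \<in> {..d}) \<and> (i \<notin> {..<N} \<longrightarrow> m i = 0)}"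
    by (rule finite_set_of_finite_funs) auto
qed

definition forms :: "nat \<Rightarrow> nat \<Rightarrow> ((nat \<Rightarrow> 'k::field) \<Rightarrow> 'k) set" where
  "forms N d = {(\<lambda>a. \<Sum>m\<in>monomials N d. c m * (\<Prod>i<N. a i ^ m i)) | c. True}"

text \<open>
  \<open>H\<^sup>0(\<O>\<^sub>Z(n))\<close> for the reduced variety \<open>Z\<close>: the functions on the punctured cone that are locally
  quotients \<open>F / G\<close> of forms with \<open>deg F = deg G + n\<close>. As the open sets \<open>G \<noteq> 0\<close> form a basis of the
  topology, one may take the domain of validity of such an expression to be the set where \<open>G \<noteq> 0\<close>
  (multiply \<open>F\<close> and \<open>G\<close> by a further form).
\<close>

definition twisted_sections ::
    "nat \<Rightarrow> (nat \<Rightarrow> 'k::field) set \<Rightarrow> nat \<Rightarrow> ((nat \<Rightarrow> 'k) \<Rightarrow> 'k) set" where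
  "twisted_sections N Z n =
     {s. \<forall>a\<in>Z. \<exists>d. \<exists>F\<in>forms N (n + d). \<exists>G\<in>forms N d.
           G a \<noteq> 0 \<and> (\<forall>b\<in>Z. G b \<noteq> 0 \<longrightarrow> s b = F b / G b)}"

text \<open>Hypersurface sections of degree \<open>n\<close> are complete for all \<open>n \<ge> 1\<close>.\<close>

definition projectively_normal :: "nat \<Rightarrow> (nat \<Rightarrow> 'k::field) set \<Rightarrow> bool" where
  "projectively_normal N Z \<longleftrightarrow>
     (\<forall>n\<ge>1. \<forall>s\<in>twisted_sections N Z n. \<exists>F\<in>forms N n. \<forall>a\<in>Z. s a = F a)"


section \<open>The canonical model\<close>

text \<open>
  The stalk at \<open>Q\<close> of \<open>\<nu>\<^sup>*L\<close> modulo torsion: the \<open>Q\<close>-submodule of \<open>K\<close> generated by the stalk of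
  \<open>L\<close> at \<open>\<nu>(Q)\<close>.
\<close>

definition pullback_mod_torsion ::
    "'a::field set set \<Rightarrow> ('a set \<Rightarrow> 'a set) \<Rightarrow> 'a set \<Rightarrow> 'a set" where
  "pullback_mod_torsion X L Q =
     {\<Sum>s\<in>S. c s * s | S c. finite S \<and> S \<subseteq> L (normalization_map X Q) \<and> (\<forall>s\<in>S. c s \<in> Q)}"

text \<open>
  The homogeneous coordinate vectors of \<open>\<kappa>(Q)\<close>, where \<open>\<kappa>\<close> is the map from the normalization to
  projective space defined by the sections \<open>w 0, \<dots>, w (g - 1)\<close>: choose a generator \<open>u\<close> of the
  invertible stalk at \<open>Q\<close> and take the residues of \<open>w i / u\<close> in the residue field, which is \<open>k\<close>.
\<close>

definition canonical_map ::
    "('k::field \<Rightarrow> 'a::field) \<Rightarrow> 'a set set \<Rightarrow> ('a set \<Rightarrow> 'a set) \<Rightarrow> nat \<Rightarrow> (nat \<Rightarrow> 'a) \<Rightarrow>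
     'a set \<Rightarrow> (nat \<Rightarrow> 'k) set" where
  "canonical_map \<iota> X \<omega> g w Q =
     {a \<in> vecs g. (\<exists>i<g. a i \<noteq> 0) \<and>
        (\<exists>u. u \<noteq> 0 \<and> pullback_mod_torsion X \<omega> Q = {u * x | x. x \<in> Q} \<and>
             (\<forall>i<g. w i / u - \<iota> (a i) \<in> max_ideal Q))}"

definition canonical_model ::
    "('k::field \<Rightarrow> 'a::field) \<Rightarrow> 'a set set \<Rightarrow> ('a set \<Rightarrow> 'a set) \<Rightarrow> nat \<Rightarrow> (nat \<Rightarrow> 'a) \<Rightarrow>
     (nat \<Rightarrow> 'k) set" where
  "canonical_model \<iota> X \<omega> g w =
     (\<Union>Q\<in>closed_points (normalization X). canonical_map \<iota> X \<omega> g w Q)"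

end

theory Submission
  imports Defs "HOL-Library.Function_Algebras"
begin

text \<open>
  Write \<open>V = H0 C \<omega>\<close>. A section of \<open>\<O>(n)\<close> on the canonical model is locally a quotient of two forms
  in the basis differentials. These quotients agree as elements of the function field, and since \<open>V\<close>
  generates \<open>\<omega>\<close> at every point (\<open>base_point_free\<close>), the resulting rational section \<open>y\<close> of the
  \<open>n\<close>-th power of \<open>\<omega>\<close> is regular on all of \<open>C\<close> (\<open>section_of_model\<close>). It remains to write \<open>y\<close> as a form of degree \<open>n\<close> in the differentials.

  This is Max Noether's theorem unless \<open>V\<close> is spanned by a geometric progression
  \<open>u, u * x, \<dots>, u * x ^ (g - 1)\<close>, in which case the model is a rational normal curve and \<open>y / u ^ n\<close> turns
  out to be a polynomial in \<open>x\<close> of degree at most \<open>n * (g - 1)\<close>, because poles would be visible at the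
  places \<open>x = c\<close> and \<open>x = \<infinity>\<close> (\<open>sections_of_progression\<close>).

  Noether's theorem (\<open>sections_are_products\<close>) is proved by duality and induction on \<open>n\<close>. A linear form
  on \<open>H\<^sup>0(\<omega>\<^sup>n)\<close> that kills \<open>V * H\<^sup>0(\<omega>\<^bsup>n-1\<^esup>)\<close> is given by a class \<open>\<xi>\<close> in \<open>H\<^sup>1(\<omega>\<^bsup>1-n\<^esup>)\<close> with \<open>v * \<xi> = 0\<close>
  in \<open>H\<^sup>1(\<omega>\<^bsup>2-n\<^esup>)\<close> for every \<open>v\<close> in \<open>V\<close>. Equivalently, \<open>\<xi>\<close> is an extension of \<open>\<omega>\<close> by \<open>\<omega>\<^bsup>2-n\<^esup>\<close> to which
  every \<open>v\<close> lifts, that is, there are rational functions \<open>F v\<close>, linear in \<open>v\<close>, such that \<open>v * \<xi> - F v\<close> is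
  regular. One chooses a rational function \<open>\<phi>\<close> and considers the subspace \<open>A\<close> of those \<open>v\<close> for which
  \<open>F v - \<phi> * v\<close> vanishes (is constant, if \<open>n = 2\<close>), and the space \<open>B\<close> of all \<open>F v - \<phi> * v\<close> (and the
  constants, if \<open>n = 2\<close>). The products of elements of \<open>A\<close> and \<open>B\<close> lie in \<open>H\<^sup>0(\<omega>\<^bsup>3-n\<^esup>)\<close>, and
  \<open>dim A + dim B\<close> is \<open>g\<close>, or \<open>g + 1\<close> if \<open>n = 2\<close>. On the other hand, Hopf's inequality (\<open>dim_product\<close>) says
  that a space containing all products has dimension at least \<open>dim A + dim B - 1\<close>. For \<open>n > 2\<close> this forces
  \<open>B = 0\<close>, and then \<open>\<xi>\<close> is zero as \<open>V\<close> generates \<open>\<omega>\<close>. For \<open>n = 2\<close>, choosing \<open>\<phi>\<close> such that some lift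
  vanishes at a point excludes \<open>dim A = 1\<close>, the case \<open>dim B = 1\<close> leads to \<open>\<xi> = 0\<close> as before, and otherwise
  equality holds in Hopf's inequality. By an analogue of Vosper's theorem (\<open>product_equality\<close>), \<open>A\<close>, \<open>B\<close>
  and \<open>V\<close> are then geometric progressions with the same ratio.

  Both facts on products of subspaces are proved by splitting off elements of least value with respect to
  a place with values in the ground field. Such places exist in abundance (\<open>place_extension\<close>); they also
  give the integral closures of the local rings and, through the valuative criteria, points of \<open>C\<close> and
  of its normalization. That all closed points have residue field \<open>k\<close> is \<open>zariski_lemma\<close>.
\<close>

section \<open>Finite-dimensional subspaces\<close>

text \<open>A locale of its own, since notions defined in \<open>vector_space\<close> would also be interpreted, under the same
  names, for real vector spaces.\<close>

locale linear_space = vector_space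
begin

text \<open>In contrast to \<open>dim\<close>, whose value is 0 in infinite dimension, this includes finite-dimensionality.\<close>

definition has_dim :: "'b set \<Rightarrow> nat \<Rightarrow> bool" where
  "has_dim U n \<longleftrightarrow> (\<exists>B. finite B \<and> card B = n \<and> \<not> dependent B \<and> span B = U)"

lemma has_dim_subspace: "has_dim U n \<Longrightarrow> subspace U"
  by (auto simp: has_dim_def)

lemma has_dim_unique: "has_dim U n \<Longrightarrow> has_dim U m \<Longrightarrow> n = m"
  unfolding has_dim_def by (metis dim_eq_card)

lemma has_dim_subset:
  assumes "has_dim U n" "subspace W" "W \<subseteq> U"
  obtains m where "has_dim W m" "m \<le> n" "m = n \<Longrightarrow> W = U"
proof -
  obtain B where B: "finite B" "card B = n" "\<not> dependent B" "span B = U"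
    using assms(1) by (auto simp: has_dim_def)
  obtain D where D: "D \<subseteq> W" "\<not> dependent D" "W \<subseteq> span D"
    using maximal_independent_subset[of W] by blast
  have fin: "finite D" "card D \<le> n"
    using independent_span_bound[OF B(1) D(2)] D(1) assms(3) B(4) B(2) by auto
  have spanD: "span D = W" by (rule span_subspace[OF D(1) D(3) assms(2)])
  have "W = U" if "card D = n"
  proof (rule ccontr)
    assume "W \<noteq> U"
    then obtain x where x: "x \<in> U" "x \<notin> span D" using assms(3) spanD by blast
    have "\<not> dependent (insert x D)" using independent_insertI[OF x(2) D(2)] .
    moreover have "insert x D \<subseteq> span B" using x D(1) assms(3) B(4) by auto
    ultimately have "card (insert x D) \<le> n" using independent_span_bound[OF B(1)] B(2) by blast
    moreover have "x \<notin> D" using x(2) span_base by blast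
    ultimately show False using fin that by simp
  qed
  with fin D spanD show thesis using that unfolding has_dim_def by blast
qed

lemma has_dim_mono:
  assumes "has_dim U n" "has_dim W m" "W \<subseteq> U"
  shows "m \<le> n"
  using has_dim_subset[OF assms(1) has_dim_subspace[OF assms(2)] assms(3)] has_dim_unique[OF assms(2)]
  by blast

lemma has_dim_insert:
  assumes "has_dim W n" "u \<notin> W"
  shows "has_dim (span (insert u W)) (Suc n)"
proof -
  obtain B where B: "finite B" "card B = n" "\<not> dependent B" "span B = W"
    using assms(1) by (auto simp: has_dim_def)
  have "u \<notin> B" using B(4) assms(2) span_base by blast
  moreover have "\<not> dependent (insert u B)" using independent_insertI B assms(2) by blast
  moreover have "span (insert u B) = span (insert u W)"
    using B(4) by (metis span_insert span_span)
  ultimately show ?thesis using B(1,2) unfolding has_dim_def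
    by (intro exI[of _ "insert u B"]) auto
qed

lemma has_dim_codim_one:
  assumes "has_dim U (Suc n)" "subspace W" "W \<subseteq> U" "u \<in> U" "u \<notin> W"
    and "\<And>x. x \<in> U \<Longrightarrow> \<exists>c. x - scale c u \<in> W"
  shows "has_dim W n"
proof -
  obtain m where m: "has_dim W m" using has_dim_subset[OF assms(1-3)] by blast
  have "span (insert u W) = U"
  proof (rule span_subspace)
    show "U \<subseteq> span (insert u W)"
      using assms(6) by (auto simp: span_insert intro: span_base)
  qed (use assms has_dim_subspace in auto)
  with has_dim_insert[OF m assms(5)] assms(1) have "Suc m = Suc n" using has_dim_unique by metis
  with m show ?thesis by simp
qed

lemma has_dim_psubset:
  assumes "has_dim U n" "subspace W" "W \<subseteq> U" "u \<in> U" "u \<notin> W"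
  obtains m where "has_dim W m" "m < n"
  using has_dim_subset[OF assms(1-3)] assms(4,5) le_neq_implies_less by metis

lemma has_dim_0: "has_dim {0} 0"
  unfolding has_dim_def by (intro exI[of _ "{}"]) (simp add: independent_empty)

lemma has_dim_1: "x \<noteq> 0 \<Longrightarrow> has_dim (span {x}) 1"
  unfolding has_dim_def by (intro exI[of _ "{x}"]) auto

lemma has_dim_zeroD: "has_dim U 0 \<Longrightarrow> U = {0}"
  by (auto simp: has_dim_def)

lemma has_dim_nonzero:
  assumes "has_dim U n" "n > 0"
  obtains x where "x \<in> U" "x \<noteq> 0"
proof -
  have "U \<noteq> {0}" using assms has_dim_0 has_dim_unique by blast
  moreover have "0 \<in> U" using has_dim_subspace[OF assms(1)] subspace_0 by blast
  ultimately show thesis using that by blast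
qed

lemma has_dim_oneD:
  assumes "has_dim U 1"
  obtains x where "x \<noteq> 0" "x \<in> U" "\<And>y. y \<in> U \<Longrightarrow> \<exists>c. y = scale c x"
proof -
  obtain B where B: "finite B" "card B = 1" "\<not> dependent B" "span B = U"
    using assms(1) by (auto simp: has_dim_def)
  then obtain x where x: "B = {x}" using card_1_singletonE by blast
  moreover have "x \<noteq> 0" using B x by auto
  ultimately show thesis using that[of x] B span_base[of x B] by (auto simp: span_singleton)
qed

lemma has_dim_not_multiple:
  assumes "has_dim U n" "n \<ge> 2" "x \<in> U"
  obtains y where "y \<in> U" "y \<notin> span {x}"
proof -
  have "\<not> U \<subseteq> span {x}"
  proof
    assume "U \<subseteq> span {x}"
    obtain B where B: "finite B" "card B = n" "\<not> dependent B" "span B = U"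
      using assms(1) by (auto simp: has_dim_def)
    have "B \<subseteq> span {x}" using B \<open>U \<subseteq> span {x}\<close> span_base by blast
    then show False using independent_span_bound[of "{x}" B] B assms(2) by simp
  qed
  then show thesis using that by blast
qed

text \<open>By induction on the family: on the kernel of \<open>f j\<close> the other forms suffice, and a single vector outside
  of this kernel determines the coefficient of \<open>f j\<close>.\<close>

lemma linear_form_in_span:
  fixes l :: "'b \<Rightarrow> 'a"
  assumes "finite I" "subspace S"
    and "\<And>x y. x \<in> S \<Longrightarrow> y \<in> S \<Longrightarrow> l (x + y) = l x + l y"
    and "\<And>c x. x \<in> S \<Longrightarrow> l (scale c x) = c * l x"
    and "\<And>i x y. i \<in> I \<Longrightarrow> x \<in> S \<Longrightarrow> y \<in> S \<Longrightarrow> f i (x + y) = f i x + f i y"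
    and "\<And>i c x. i \<in> I \<Longrightarrow> x \<in> S \<Longrightarrow> f i (scale c x) = c * f i x"
    and "\<And>x. x \<in> S \<Longrightarrow> (\<And>i. i \<in> I \<Longrightarrow> f i x = 0) \<Longrightarrow> l x = 0"
  shows "\<exists>c. \<forall>x\<in>S. l x = (\<Sum>i\<in>I. c i * f i x)"
  using assms
proof (induction I arbitrary: S rule: finite_induct)
  case empty
  then show ?case by simp
next
  case (insert j I)
  let ?S = "{x\<in>S. f j x = 0}"
  have sub: "subspace ?S"
  proof (rule subspaceI)
    have "f j (scale 0 0) = 0 * f j 0" using insert.prems(5) subspace_0[OF insert.prems(1)] by blast
    then show "0 \<in> ?S" using subspace_0[OF insert.prems(1)] by simp
  qed (use insert.prems in \<open>auto intro: subspace_add subspace_scale\<close>)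
  have "\<exists>c. \<forall>x\<in>?S. l x = (\<Sum>i\<in>I. c i * f i x)"
  proof (rule insert.IH[OF sub])
    fix x assume "x \<in> ?S" "\<And>i. i \<in> I \<Longrightarrow> f i x = 0"
    then show "l x = 0" using insert.prems(6)[of x] by blast
  qed (use insert.prems in blast)+
  then obtain c where c: "\<And>x. x \<in> S \<Longrightarrow> f j x = 0 \<Longrightarrow> l x = (\<Sum>i\<in>I. c i * f i x)" by auto
  show ?case
  proof (cases "\<exists>s\<in>S. f j s \<noteq> 0")
    case False
    have "l x = (\<Sum>i\<in>insert j I. c i * f i x)" if "x \<in> S" for x
      using c[OF that] False that insert.hyps by auto
    then show ?thesis by blast
  next
    case True
    then obtain s where s: "s \<in> S" "f j s \<noteq> 0" by blast
    define d where "d = c(j := (l s - (\<Sum>i\<in>I. c i * f i s)) / f j s)"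
    have "l x = (\<Sum>i\<in>insert j I. d i * f i x)" if x: "x \<in> S" for x
    proof -
      define r where "r = f j x / f j s"
      define y where "y = x + scale (- r) s"
      have y: "y \<in> S" unfolding y_def using x s insert.prems(1) subspace_add subspace_scale by blast
      have sS: "scale (- r) s \<in> S" using s(1) insert.prems(1) subspace_scale by blast
      have fy: "f i y = f i x - r * f i s" if "i \<in> insert j I" for i
        unfolding y_def insert.prems(4)[OF that x sS] insert.prems(5)[OF that s(1)] by simp
      have "f j y = 0" using fy[of j] s(2) by (simp add: r_def)
      then have "l y = (\<Sum>i\<in>I. c i * f i y)" using c y by blast
      moreover have "l y = l x - r * l s"
        unfolding y_def insert.prems(2)[OF x sS] insert.prems(3)[OF s(1)] by simp
      moreover have "(\<Sum>i\<in>I. c i * f i y) = (\<Sum>i\<in>I. c i * f i x) - r * (\<Sum>i\<in>I. c i * f i s)"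
        by (simp add: fy right_diff_distrib sum_subtractf sum_distrib_left mult.left_commute)
      ultimately have "l x = (\<Sum>i\<in>I. c i * f i x) + r * (l s - (\<Sum>i\<in>I. c i * f i s))"
        by (simp add: algebra_simps)
      also have "r * (l s - (\<Sum>i\<in>I. c i * f i s)) = d j * f j x"
        using s(2) by (simp add: d_def r_def)
      also have "(\<Sum>i\<in>I. c i * f i x) = (\<Sum>i\<in>I. d i * f i x)"
        using insert.hyps by (intro sum.cong) (auto simp: d_def)
      finally show ?thesis using insert.hyps by (simp add: add.commute)
    qed
    then show ?thesis by blast
  qed
qed

lemma separating_form:
  assumes "subspace N" "x \<notin> N"
  obtains l where "Vector_Spaces.linear scale (*) l" "\<And>y. y \<in> N \<Longrightarrow> l y = 0" "l x = (1::'a)"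
proof -
  interpret vp: vector_space_pair scale "(*) :: 'a \<Rightarrow> 'a \<Rightarrow> 'a"
    by unfold_locales (auto simp: algebra_simps)
  obtain B where B: "B \<subseteq> N" "\<not> dependent B" "N \<subseteq> span B"
    using maximal_independent_subset[of N] by blast
  have span: "span B = N" by (rule span_subspace[OF B(1,3) assms(1)])
  then have "\<not> dependent (insert x B)" using independent_insertI B(2) assms(2) by blast
  then obtain l where l: "Vector_Spaces.linear scale (*) l"
      "\<And>y. y \<in> insert x B \<Longrightarrow> l y = (if y = x then 1 else 0)"
    using vp.linear_independent_extend[of "insert x B" "\<lambda>y. if y = x then 1 else 0"] by blast
  have "x \<notin> B" using span assms(2) span_base by blast
  then have "\<forall>y\<in>B. l y = 0" using l(2) by auto
  then have "l y = 0" if "y \<in> N" for y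
    using vp.linear_eq_0_on_span[OF l(1), of B y] span that by auto
  with l show thesis using that by auto
qed

lemma rank_nullity:
  assumes "has_dim U n" "Vector_Spaces.linear scale scale f"
  obtains a b where "has_dim {u\<in>U. f u = 0} a" "has_dim (f ` U) b" "a + b = n"
proof -
  interpret f: Vector_Spaces.linear scale scale f by fact
  have subU: "subspace U" using assms(1) by (rule has_dim_subspace)
  have subK: "subspace {u\<in>U. f u = 0}"
    using subspace_inter[OF subU f.subspace_kernel] by (simp add: Int_def)
  obtain B where B: "B \<subseteq> {u\<in>U. f u = 0}" "\<not> dependent B" "{u\<in>U. f u = 0} \<subseteq> span B"
    using maximal_independent_subset by blast
  have spanB: "span B = {u\<in>U. f u = 0}" by (rule span_subspace[OF B(1,3) subK])
  obtain D where D: "B \<subseteq> D" "D \<subseteq> U" "\<not> dependent D" "U \<subseteq> span D"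
    using maximal_independent_subset_extend[of B U] B by blast
  have spanD: "span D = U" by (rule span_subspace[OF D(2,4) subU])
  have finD: "finite D" "card D = n"
  proof -
    obtain E where E: "finite E" "card E = n" "\<not> dependent E" "span E = U"
      using assms(1) by (auto simp: has_dim_def)
    show "finite D" using independent_span_bound[OF E(1) D(3)] E D by auto
    then show "card D = n" using assms(1) D(3) spanD has_dim_unique unfolding has_dim_def by blast
  qed
  have indep: "\<not> dependent (D - B)" using D(3) independent_mono by blast
  have span_Int_indep: "x = 0" if xB: "x \<in> span B" and xD: "x \<in> span (D - B)" for x
  proof -
    have fB: "finite B" using finD(1) D(1) finite_subset by blast
    obtain r where r: "x = (\<Sum>v\<in>B. scale (r v) v)"
      using xB unfolding span_finite[OF fB] by blast
    obtain q where q: "x = (\<Sum>v\<in>D - B. scale (q v) v)"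
      using xD finD(1) span_finite[of "D - B"] by blast
    define h where "h v = (if v \<in> B then r v else - q v)" for v
    have "(\<Sum>v\<in>D. scale (h v) v) = (\<Sum>v\<in>D - B. scale (h v) v) + (\<Sum>v\<in>B. scale (h v) v)"
      using sum.subset_diff[OF D(1) finD(1)] .
    also have "(\<Sum>v\<in>D - B. scale (h v) v) = - x"
      unfolding q sum_negf[symmetric] by (intro sum.cong) (auto simp: h_def)
    also have "(\<Sum>v\<in>B. scale (h v) v) = x" unfolding r by (intro sum.cong) (auto simp: h_def)
    finally have "(\<Sum>v\<in>D. scale (h v) v) = 0" by simp
    then have "h v = 0" if "v \<in> D" for v
      using independentD[OF D(3) finD(1) subset_refl] that by blast
    then have "r v = 0" if "v \<in> B" for v using that D(1) by (force simp: h_def)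
    then show "x = 0" using r by simp
  qed
  have inj: "inj_on f (span (D - B))"
  proof (subst f.inj_on_iff_eq_0, simp, safe)
    fix x assume x: "x \<in> span (D - B)" "f x = 0"
    have "x \<in> span B" using x span_mono[of "D - B" D] spanB spanD by blast
    then show "x = 0" using x(1) span_Int_indep by blast
  qed
  have img: "f ` U = span (f ` (D - B))"
  proof (rule antisym)
    show "f ` U \<subseteq> span (f ` (D - B))"
    proof
      fix y assume "y \<in> f ` U"
      then obtain x where x: "x \<in> span D" "y = f x" using spanD by blast
      have "f ` D \<subseteq> insert 0 (f ` (D - B))" using B(1) by auto
      then have "span (f ` D) \<subseteq> span (f ` (D - B))" using span_mono span_insert_0 by metis
      then show "y \<in> span (f ` (D - B))" using x by (auto simp: f.span_image)
    qed
    show "span (f ` (D - B)) \<subseteq> f ` U"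
      unfolding f.span_image using span_mono[of "D - B" D] spanD by auto
  qed
  have "\<not> dependent (f ` (D - B))"
    using f.independent_injective_image[OF indep inj] .
  moreover have "card (f ` (D - B)) = card (D - B)"
    using inj by (intro card_image) (rule inj_on_subset[OF _ span_superset])
  ultimately have "has_dim (f ` U) (card (D - B))" using img finD unfolding has_dim_def
    by (intro exI[of _ "f ` (D - B)"]) auto
  moreover have "has_dim {u\<in>U. f u = 0} (card B)"
    using spanB B(2) D(1) finD finite_subset unfolding has_dim_def by blast
  moreover have "card B + card (D - B) = n"
    using card_Diff_subset[of B D] card_mono[OF finD(1) D(1)] D(1) finD finite_subset by force
  ultimately show thesis using that by blast
qed

end

section \<open>Subrings and places of an extension of an algebraically closed field\<close>

subsection \<open>Polynomials with coefficients in a subset\<close>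

definition coeffs_in :: "'a::comm_ring_1 set \<Rightarrow> 'a poly \<Rightarrow> bool" where
  "coeffs_in R p \<longleftrightarrow> (\<forall>i. coeff p i \<in> R)"

definition adjunction :: "'a::field set \<Rightarrow> 'a \<Rightarrow> 'a set" where
  "adjunction R x = {poly p x | p. coeffs_in R p}"

lemma subring_closed:
  assumes "is_subring R"
  shows "0 \<in> R" "1 \<in> R" "x \<in> R \<Longrightarrow> y \<in> R \<Longrightarrow> x - y \<in> R" "x \<in> R \<Longrightarrow> y \<in> R \<Longrightarrow> x * y \<in> R"
    "x \<in> R \<Longrightarrow> - x \<in> R" "x \<in> R \<Longrightarrow> y \<in> R \<Longrightarrow> x + y \<in> R"
proof -
  show *: "1 \<in> R" "\<And>x y. x \<in> R \<Longrightarrow> y \<in> R \<Longrightarrow> x - y \<in> R" "\<And>x y. x \<in> R \<Longrightarrow> y \<in> R \<Longrightarrow> x * y \<in> R"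
    using assms by (auto simp: is_subring_def)
  show 0: "0 \<in> R" using *(2)[OF *(1) *(1)] by simp
  show minus: "\<And>x. x \<in> R \<Longrightarrow> - x \<in> R" using *(2)[OF 0] by force
  show "\<And>x y. x \<in> R \<Longrightarrow> y \<in> R \<Longrightarrow> x + y \<in> R" using *(2) minus by (metis diff_minus_eq_add)
qed

lemma subring_sum: "is_subring R \<Longrightarrow> (\<And>i. i \<in> A \<Longrightarrow> f i \<in> R) \<Longrightarrow> sum f A \<in> R"
  by (induction A rule: infinite_finite_induct) (auto intro: subring_closed)

lemma subring_prod: "is_subring R \<Longrightarrow> (\<And>i. i \<in> A \<Longrightarrow> f i \<in> R) \<Longrightarrow> prod f A \<in> R"
  by (induction A rule: infinite_finite_induct) (auto intro: subring_closed)

lemma subring_power: "is_subring R \<Longrightarrow> x \<in> R \<Longrightarrow> x ^ n \<in> R"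
  by (induction n) (auto intro: subring_closed)

lemma coeffs_in_pCons [simp]: "coeffs_in R (pCons a p) \<longleftrightarrow> a \<in> R \<and> coeffs_in R p"
  unfolding coeffs_in_def by (metis coeff_pCons_0 coeff_pCons_Suc not0_implies_Suc)

lemma poly_reversed:
  fixes x :: "'a::field"
  assumes "degree q \<le> n" "x \<noteq> 0"
  shows "x ^ n * poly q (inverse x) = (\<Sum>i\<le>n. coeff q i * x ^ (n - i))"
proof -
  have "poly q (inverse x) = (\<Sum>i\<le>n. coeff q i * inverse x ^ i)"
    unfolding poly_altdef using assms(1) by (intro sum.mono_neutral_left) (auto simp: coeff_eq_0)
  then show ?thesis
    unfolding sum_distrib_left using assms(2)
    by (auto simp: sum_distrib_left power_diff field_simps intro!: sum.cong)
qed

text \<open>Multiplication by a power of \<open>x\<close> turns a relation between powers of \<open>inverse x\<close> into an equation that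
  expresses \<open>x ^ n\<close> through lower powers of \<open>x\<close>.\<close>

lemma power_from_inverse_relation:
  fixes x :: "'a::field"
  assumes "degree q \<le> n" "x \<noteq> 0" "poly q (inverse x) = 1" "1 - coeff q 0 \<noteq> 0"
  shows "x ^ n = (\<Sum>i=1..n. inverse (1 - coeff q 0) * coeff q i * x ^ (n - i))"
proof -
  have "x ^ n = coeff q 0 * x ^ n + (\<Sum>i=1..n. coeff q i * x ^ (n - i))"
    using poly_reversed[OF assms(1,2)] assms(3) by (simp add: atMost_atLeast0 sum.atLeast_Suc_atMost)
  then have "(1 - coeff q 0) * x ^ n = (\<Sum>i=1..n. coeff q i * x ^ (n - i))"
    by (simp add: algebra_simps)
  then have "x ^ n = inverse (1 - coeff q 0) * (\<Sum>i=1..n. coeff q i * x ^ (n - i))"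
    using assms(4) by (simp add: field_simps)
  then show ?thesis by (simp add: sum_distrib_left mult.assoc)
qed

lemma coeffs_in_0: "0 \<in> R \<Longrightarrow> coeffs_in R 0"
  by (simp add: coeffs_in_def)

lemma coeffs_in_mono: "coeffs_in R p \<Longrightarrow> R \<subseteq> S \<Longrightarrow> coeffs_in S p"
  by (auto simp: coeffs_in_def)

lemma poly_in_subring: "is_subring R \<Longrightarrow> coeffs_in R p \<Longrightarrow> x \<in> R \<Longrightarrow> poly p x \<in> R"
  unfolding poly_altdef coeffs_in_def by (intro subring_sum) (auto intro: subring_closed subring_power)

lemma coeffs_in_closed:
  assumes "is_subring R"
  shows "coeffs_in R 0" "coeffs_in R 1"
    "coeffs_in R p \<Longrightarrow> coeffs_in R q \<Longrightarrow> coeffs_in R (p - q)"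
    "coeffs_in R p \<Longrightarrow> coeffs_in R q \<Longrightarrow> coeffs_in R (p + q)"
    "coeffs_in R p \<Longrightarrow> coeffs_in R q \<Longrightarrow> coeffs_in R (p * q)"
    "x \<in> R \<Longrightarrow> coeffs_in R p \<Longrightarrow> coeffs_in R (smult x p)"
    "x \<in> R \<Longrightarrow> coeffs_in R (monom x n)"
    "coeffs_in R p \<Longrightarrow> coeffs_in R (- p)"
  using assms unfolding coeffs_in_def
  by (auto simp: coeff_mult subring_closed intro!: subring_sum)

lemma adjunction_subring:
  assumes "is_subring R" shows "is_subring (adjunction R x)"
proof -
  have "1 \<in> adjunction R x" unfolding adjunction_def
    using coeffs_in_closed(2)[OF assms] poly_1 by (metis (mono_tags, lifting) mem_Collect_eq)
  moreover have "a - b \<in> adjunction R x \<and> a * b \<in> adjunction R x"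
    if ab: "a \<in> adjunction R x" "b \<in> adjunction R x" for a b
  proof -
    obtain p q where "a = poly p x" "b = poly q x" "coeffs_in R p" "coeffs_in R q"
      using ab by (auto simp: adjunction_def)
    then have "a - b = poly (p - q) x" "a * b = poly (p * q) x" "coeffs_in R (p - q)" "coeffs_in R (p * q)"
      using coeffs_in_closed[OF assms] by auto
    then show ?thesis unfolding adjunction_def by blast
  qed
  ultimately show ?thesis unfolding is_subring_def by blast
qed

lemma subset_adjunction: "is_subring R \<Longrightarrow> R \<subseteq> adjunction R x"
  unfolding adjunction_def
  by (auto intro!: exI[of _ "[:_:]"] simp: subring_closed coeffs_in_0)

lemma mem_adjunction: "is_subring R \<Longrightarrow> x \<in> adjunction R x"
  unfolding adjunction_def
  by (auto intro!: exI[of _ "[:0,1:]"] simp: subring_closed coeffs_in_0)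

lemma adjunction_least: "is_subring S \<Longrightarrow> R \<subseteq> S \<Longrightarrow> x \<in> S \<Longrightarrow> adjunction R x \<subseteq> S"
  unfolding adjunction_def using poly_in_subring coeffs_in_mono by blast

lemma max_ideal_mult:
  assumes "is_subring R" "r \<in> R" "x \<in> max_ideal R"
  shows "r * x \<in> max_ideal R"
proof -
  have "r * x \<in> R" using assms by (auto simp: max_ideal_def subring_closed)
  moreover have "inverse (r * x) \<notin> R" if "r * x \<noteq> 0"
  proof
    assume "inverse (r * x) \<in> R"
    then have "r * inverse (r * x) \<in> R" using assms by (auto simp: subring_closed)
    moreover have "r * inverse (r * x) = inverse x" using that by (simp add: field_simps)
    ultimately have "inverse x \<in> R" by metis
    then show False using that assms(3) by (auto simp: max_ideal_def)
  qed
  ultimately show ?thesis by (auto simp: max_ideal_def)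
qed

lemma max_ideal_subset: "max_ideal R \<subseteq> R"
  by (auto simp: max_ideal_def)

subsection \<open>Local subrings\<close>

locale alg_closed_base =
  fixes \<iota> :: "'k::alg_closed_field \<Rightarrow> 'a::field"
  assumes embedding: "field_embedding \<iota>"
begin

lemma iota_1 [simp]: "\<iota> 1 = 1" and iota_add: "\<iota> (x + y) = \<iota> x + \<iota> y"
  and iota_mult: "\<iota> (x * y) = \<iota> x * \<iota> y"
  using embedding by (auto simp: field_embedding_def)

lemma iota_0 [simp]: "\<iota> 0 = 0"
proof -
  have "\<iota> 0 + \<iota> 0 = \<iota> 0 + 0" using iota_add[of 0 0] by (simp only: add_0_right)
  then show ?thesis by (simp only: add_left_cancel)
qed

lemma iota_minus: "\<iota> (- x) = - \<iota> x"
  using iota_add[of x "- x"] by (simp add: eq_neg_iff_add_eq_0 add.commute)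

lemma iota_diff: "\<iota> (x - y) = \<iota> x - \<iota> y"
  using iota_add[of x "- y"] by (simp add: iota_minus)

lemma iota_inverse: "\<iota> (inverse x) = inverse (\<iota> x)"
proof (cases "x = 0")
  case False
  then have "\<iota> x * \<iota> (inverse x) = 1" by (simp flip: iota_mult)
  then show ?thesis by (metis inverse_unique)
qed simp

lemma iota_divide: "\<iota> (x / y) = \<iota> x / \<iota> y"
  by (simp add: divide_inverse iota_mult iota_inverse)

lemma iota_power: "\<iota> (x ^ n) = \<iota> x ^ n"
  by (induction n) (auto simp: iota_mult)

lemma iota_sum: "\<iota> (sum f A) = (\<Sum>x\<in>A. \<iota> (f x))"
  by (induction A rule: infinite_finite_induct) (auto simp: iota_add)

lemma iota_eq_0_iff [simp]: "\<iota> x = 0 \<longleftrightarrow> x = 0"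
proof
  assume "\<iota> x = 0"
  then show "x = 0" using iota_mult[of x "inverse x"] by (cases "x = 0") auto
qed simp

lemma iota_eq_iff [simp]: "\<iota> x = \<iota> y \<longleftrightarrow> x = y"
  using iota_eq_0_iff[of "x - y"] unfolding iota_diff right_minus_eq by simp

sublocale linear_space "\<lambda>c x. \<iota> c * x"
  by unfold_locales (auto simp: algebra_simps iota_add iota_mult)

lemma subspace_closed:
  assumes "subspace U"
  shows "0 \<in> U" "x \<in> U \<Longrightarrow> y \<in> U \<Longrightarrow> x + y \<in> U" "x \<in> U \<Longrightarrow> \<iota> c * x \<in> U"
    "x \<in> U \<Longrightarrow> y \<in> U \<Longrightarrow> x - y \<in> U" "x \<in> U \<Longrightarrow> - x \<in> U"
  by (fact subspace_0[OF assms] subspace_add[OF assms] subspace_scale[OF assms] subspace_diff[OF assms]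
      subspace_neg[OF assms])+

abbreviation ev :: "'k poly \<Rightarrow> 'a \<Rightarrow> 'a" where
  "ev h x \<equiv> poly (map_poly \<iota> h) x"

lemma map_poly_iota:
  "map_poly \<iota> (p + q) = map_poly \<iota> p + map_poly \<iota> q"
  "map_poly \<iota> (p - q) = map_poly \<iota> p - map_poly \<iota> q"
  "map_poly \<iota> (p * q) = map_poly \<iota> p * map_poly \<iota> q"
  by (rule poly_eqI; simp add: coeff_map_poly iota_add iota_diff iota_mult coeff_mult iota_sum)+

lemma ev_pCons [simp]: "ev (pCons c p) x = \<iota> c + x * ev p x"
  by (simp add: map_poly_pCons)

lemma ev_iota: "ev p (\<iota> c) = \<iota> (poly p c)"
  by (induction p) (auto simp: iota_add iota_mult)

lemma ev_add: "ev (p + q) x = ev p x + ev q x"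
  and ev_diff: "ev (p - q) x = ev p x - ev q x"
  and ev_mult: "ev (p * q) x = ev p x * ev q x"
  by (simp_all add: map_poly_iota)

lemma coeffs_in_range_iota:
  "coeffs_in (range \<iota>) p \<longleftrightarrow> (\<exists>h. p = map_poly \<iota> h)"
proof
  assume "coeffs_in (range \<iota>) p"
  then have "map_poly \<iota> (map_poly (inv \<iota>) p) = p"
  proof (intro poly_eqI)
    fix n
    have "inv \<iota> 0 = 0" using inv_f_f[of \<iota> 0] by (simp add: inj_def)
    moreover have "coeff p n \<in> range \<iota>" using \<open>coeffs_in (range \<iota>) p\<close> by (simp add: coeffs_in_def)
    ultimately show "coeff (map_poly \<iota> (map_poly (inv \<iota>) p)) n = coeff p n"
      by (simp add: coeff_map_poly f_inv_into_f)
  qed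
  then show "\<exists>h. p = map_poly \<iota> h" by metis
qed (auto simp: coeffs_in_def coeff_map_poly)

lemma range_iota_subring: "is_subring (range \<iota>)"
proof -
  have "1 \<in> range \<iota>" using iota_1 by (metis rangeI)
  then show ?thesis
    unfolding is_subring_def by (auto simp flip: iota_diff iota_mult)
qed

lemma algebraic_in_range:
  assumes "ev h x = 0" "h \<noteq> 0"
  shows "x \<in> range \<iota>"
  using assms
proof (induction "degree h" arbitrary: h)
  case 0
  then obtain c where "h = [:c:]" by (metis degree_eq_zeroE)
  then show ?case using 0 by (simp add: map_poly_pCons)
next
  case (Suc n)
  then obtain c where "poly h c = 0" using alg_closed_imp_poly_has_root[of h] by auto
  then obtain q where q: "h = [:- c, 1:] * q" by (meson dvdE poly_eq_0_iff_dvd)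
  have "q \<noteq> 0" using q Suc by auto
  have deg: "degree q = n" using Suc(2) q \<open>q \<noteq> 0\<close> by (simp add: degree_mult_eq del: mult_pCons_left)
  have "(x - \<iota> c) * ev q x = 0"
    using Suc(3) unfolding q ev_mult by (simp add: iota_minus)
  then consider "x = \<iota> c" | "ev q x = 0" by auto
  then show ?case using Suc(1)[OF deg[symmetric]] \<open>q \<noteq> 0\<close> by cases auto
qed

text \<open>The local ring \<open>UNIV\<close> of the generic point is included; its maximal ideal is \<open>{0}\<close>.\<close>

definition local_subring :: "'a set \<Rightarrow> bool" where
  "local_subring R \<longleftrightarrow> is_subring R \<and> range \<iota> \<subseteq> R \<and>
     (\<forall>x\<in>max_ideal R. \<forall>y\<in>max_ideal R. x + y \<in> max_ideal R)"

text \<open>The residue field is the ground field.\<close>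

definition rational :: "'a set \<Rightarrow> bool" where
  "rational R \<longleftrightarrow> local_subring R \<and> (\<forall>x\<in>R. \<exists>c. x - \<iota> c \<in> max_ideal R)"

lemma local_subringD:
  assumes "local_subring R"
  shows "is_subring R" "\<iota> c \<in> R" "x \<in> max_ideal R \<Longrightarrow> y \<in> max_ideal R \<Longrightarrow> x + y \<in> max_ideal R"
    "r \<in> R \<Longrightarrow> x \<in> max_ideal R \<Longrightarrow> r * x \<in> max_ideal R"
    "0 \<in> max_ideal R" "1 \<notin> max_ideal R"
    "x \<in> max_ideal R \<Longrightarrow> y \<in> max_ideal R \<Longrightarrow> x - y \<in> max_ideal R"
    "subspace R" "subspace (max_ideal R)"
proof -
  show R: "is_subring R" "\<And>c. \<iota> c \<in> R"
    and add: "\<And>x y. x \<in> max_ideal R \<Longrightarrow> y \<in> max_ideal R \<Longrightarrow> x + y \<in> max_ideal R"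
    using assms by (auto simp: local_subring_def)
  show mult: "\<And>r x. r \<in> R \<Longrightarrow> x \<in> max_ideal R \<Longrightarrow> r * x \<in> max_ideal R"
    using max_ideal_mult R(1) by blast
  show zero: "0 \<in> max_ideal R" "1 \<notin> max_ideal R"
    using R by (auto simp: max_ideal_def subring_closed)
  have "- 1 \<in> R" using R by (auto simp: subring_closed)
  then show "x - y \<in> max_ideal R" if "x \<in> max_ideal R" "y \<in> max_ideal R"
    using add[OF that(1) mult[OF _ that(2)], of "- 1"] by simp
  show "subspace R" "subspace (max_ideal R)"
    unfolding subspace_def using R add mult zero by (auto simp: subring_closed)
qed

lemma unit_inverse: "x \<in> R \<Longrightarrow> x \<notin> max_ideal R \<Longrightarrow> inverse x \<in> R \<and> x \<noteq> 0"
  by (auto simp: max_ideal_def)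

lemma iota_notin_max_ideal: "local_subring R \<Longrightarrow> c \<noteq> 0 \<Longrightarrow> \<iota> c \<notin> max_ideal R"
  using local_subringD[of R] by (auto simp: max_ideal_def simp flip: iota_inverse)

lemma rational_local: "rational R \<Longrightarrow> local_subring R"
  by (simp add: rational_def)

lemma rational_neq_UNIV:
  assumes "rational R" "x \<notin> range \<iota>"
  shows "R \<noteq> UNIV"
proof
  assume "R = UNIV"
  then obtain c where "x - \<iota> c \<in> max_ideal (UNIV :: 'a set)" using assms(1) unfolding rational_def by blast
  then show False using assms(2) by (auto simp: max_ideal_def)
qed

text \<open>The valuation rings of places with values in the ground field, that is, of homomorphisms from \<open>V\<close> to \<open>k\<close>
  that cannot be extended to a larger subring of \<open>K\<close>.\<close>

definition place :: "'a set \<Rightarrow> bool" where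
  "place V \<longleftrightarrow> valuation_ring \<iota> V \<and> rational V"

subsection \<open>Extension of places\<close>

text \<open>A place is determined by its maximal ideal \<open>I\<close>, because \<open>V = k + I\<close>. Hence it can be found as a maximal
  element among the non-unital subalgebras without 1, rather than among pairs of a subring and a
  homomorphism to \<open>k\<close>.\<close>

definition nonunital_algebra :: "'a set \<Rightarrow> bool" where
  "nonunital_algebra I \<longleftrightarrow> subspace I \<and> (\<forall>x\<in>I. \<forall>y\<in>I. x * y \<in> I) \<and> 1 \<notin> I"

definition unitization :: "'a set \<Rightarrow> 'a set" where
  "unitization I = {\<iota> c + x | c x. x \<in> I}"

lemma unitization_subring:
  assumes "nonunital_algebra I"
  shows "is_subring (unitization I)" "range \<iota> \<subseteq> unitization I" "I \<subseteq> unitization I"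
    "r \<in> unitization I \<Longrightarrow> x \<in> I \<Longrightarrow> r * x \<in> I"
proof -
  have I: "subspace I" "\<And>x y. x \<in> I \<Longrightarrow> y \<in> I \<Longrightarrow> x * y \<in> I" "1 \<notin> I"
    using assms by (simp_all add: nonunital_algebra_def)
  note cl = subspace_closed[OF I(1)]
  show mult: "r * x \<in> I" if "r \<in> unitization I" "x \<in> I" for r x
    using that cl(2,3) I(2) by (auto simp: unitization_def algebra_simps)
  show range: "range \<iota> \<subseteq> unitization I" using cl(1) by (auto simp: unitization_def) (metis add.right_neutral)
  show incl: "I \<subseteq> unitization I" by (auto simp: unitization_def) (metis add_0 iota_0)
  have "a - b \<in> unitization I \<and> a * b \<in> unitization I"
    if ab: "a \<in> unitization I" "b \<in> unitization I" for a b
  proof -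
    obtain c x where a: "a = \<iota> c + x" "x \<in> I" using ab(1) by (auto simp: unitization_def)
    obtain d y where b: "b = \<iota> d + y" "y \<in> I" using ab(2) by (auto simp: unitization_def)
    have "a - b = \<iota> (c - d) + (x - y)" by (simp add: a(1) b(1) iota_diff)
    moreover have "a * b = \<iota> (c * d) + (\<iota> c * y + b * x)"
    proof -
      have "a * b = \<iota> c * b + b * x" unfolding a(1) by (simp add: distrib_left mult.commute)
      also have "\<iota> c * b = \<iota> (c * d) + \<iota> c * y" unfolding b(1) iota_mult by (simp add: distrib_left)
      finally show ?thesis by (simp add: add.assoc)
    qed
    moreover have "x - y \<in> I" using a(2) b(2) cl(4) by blast
    moreover have "\<iota> c * y + b * x \<in> I" using cl(2)[OF cl(3)[OF b(2)] mult[OF ab(2) a(2)]] .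
    ultimately show ?thesis unfolding unitization_def by blast
  qed
  moreover have "1 \<in> unitization I" using range iota_1 by (metis rangeI subsetD)
  ultimately show "is_subring (unitization I)" unfolding is_subring_def by blast
qed

text \<open>The ideal generated by \<open>I\<close> and \<open>x - \<iota> c\<close> in the ring obtained from the unitization by
  adjoining \<open>x\<close>.\<close>

definition adjoin_at :: "'a set \<Rightarrow> 'a \<Rightarrow> 'k \<Rightarrow> 'a set" where
  "adjoin_at I x c = {poly p x | p. coeffs_in (unitization I) p \<and> poly p (\<iota> c) \<in> I}"

lemma adjoin_at:
  assumes "nonunital_algebra I"
  shows "I \<subseteq> adjoin_at I x c" "x - \<iota> c \<in> adjoin_at I x c"
    "1 \<notin> adjoin_at I x c \<Longrightarrow> nonunital_algebra (adjoin_at I x c)"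
proof -
  note U = unitization_subring[OF assms]
  have I: "subspace I" "\<And>x y. x \<in> I \<Longrightarrow> y \<in> I \<Longrightarrow> x * y \<in> I" "1 \<notin> I"
    using assms by (simp_all add: nonunital_algebra_def)
  note cl = subspace_closed[OF I(1)]
  note co = coeffs_in_closed[OF U(1)]
  have mem: "poly p x \<in> adjoin_at I x c" if "coeffs_in (unitization I) p" "poly p (\<iota> c) \<in> I" for p
    using that by (auto simp: adjoin_at_def)
  show "I \<subseteq> adjoin_at I x c"
  proof
    fix y assume "y \<in> I"
    then show "y \<in> adjoin_at I x c" using mem[of "[:y:]"] U(3) co(1) by auto
  qed
  have "- \<iota> c \<in> unitization I" using U(2) by (auto simp flip: iota_minus)
  then show "x - \<iota> c \<in> adjoin_at I x c" using mem[of "[:- \<iota> c, 1:]"] co(2) cl(1) by (simp add: one_pCons)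
  show "nonunital_algebra (adjoin_at I x c)" if "1 \<notin> adjoin_at I x c"
    unfolding nonunital_algebra_def
  proof (intro conjI ballI)
    show "subspace (adjoin_at I x c)"
    proof (rule subspaceI)
      show "0 \<in> adjoin_at I x c" using mem[of 0] co(1) cl(1) by simp
      fix a assume "a \<in> adjoin_at I x c"
      then obtain p where p: "a = poly p x" "coeffs_in (unitization I) p" "poly p (\<iota> c) \<in> I"
        by (auto simp: adjoin_at_def)
      show "\<iota> d * a \<in> adjoin_at I x c" for d
        using mem[of "smult (\<iota> d) p"] p U(2) co(6) cl(3) by auto
      fix b assume "b \<in> adjoin_at I x c"
      then obtain q where q: "b = poly q x" "coeffs_in (unitization I) q" "poly q (\<iota> c) \<in> I"
        by (auto simp: adjoin_at_def)
      show "a + b \<in> adjoin_at I x c"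
        using mem[of "p + q"] p q co(4) cl(2) by auto
    qed
    fix a b assume "a \<in> adjoin_at I x c" "b \<in> adjoin_at I x c"
    then obtain p q where p: "a = poly p x" "coeffs_in (unitization I) p" "poly p (\<iota> c) \<in> I"
      and q: "b = poly q x" "coeffs_in (unitization I) q" "poly q (\<iota> c) \<in> I"
      by (auto simp: adjoin_at_def)
    show "a * b \<in> adjoin_at I x c" using mem[of "p * q"] p q co(5) I(2) by auto
  qed (use that in auto)
qed

lemma maximal_nonunital_algebra:
  assumes "nonunital_algebra I"
  obtains M where "nonunital_algebra M" "I \<subseteq> M" "\<And>J. nonunital_algebra J \<Longrightarrow> M \<subseteq> J \<Longrightarrow> J = M"
proof -
  let ?A = "{J. nonunital_algebra J \<and> I \<subseteq> J}"
  have "\<exists>M\<in>?A. \<forall>X\<in>?A. M \<subseteq> X \<longrightarrow> X = M"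
  proof (rule subset_Zorn_nonempty)
    show "?A \<noteq> {}" using assms by blast
    fix \<C> assume C: "\<C> \<noteq> {}" "subset.chain ?A \<C>"
    have mem: "\<And>J. J \<in> \<C> \<Longrightarrow> nonunital_algebra J \<and> I \<subseteq> J" using C(2) by (auto simp: subset.chain_def)
    have two: "\<exists>J\<in>\<C>. x \<in> J \<and> y \<in> J" if "x \<in> \<Union>\<C>" "y \<in> \<Union>\<C>" for x y
      using that C(2) unfolding subset.chain_def by blast
    have nu: "nonunital_algebra (\<Union>\<C>)"
      unfolding nonunital_algebra_def
    proof (intro conjI ballI)
      show "subspace (\<Union>\<C>)"
      proof (rule subspaceI)
        show "0 \<in> \<Union>\<C>" using mem C(1) subspace_0 unfolding nonunital_algebra_def by blast
        show "x + y \<in> \<Union>\<C>" if "x \<in> \<Union>\<C>" "y \<in> \<Union>\<C>" for x y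
          using two[OF that] mem subspace_add unfolding nonunital_algebra_def by blast
        show "\<iota> c * x \<in> \<Union>\<C>" if "x \<in> \<Union>\<C>" for x c
          using two[OF that that] mem subspace_scale unfolding nonunital_algebra_def by blast
      qed
      show "x * y \<in> \<Union>\<C>" if "x \<in> \<Union>\<C>" "y \<in> \<Union>\<C>" for x y
        using two[OF that] mem unfolding nonunital_algebra_def by blast
      show "1 \<notin> \<Union>\<C>" using mem unfolding nonunital_algebra_def by blast
    qed
    obtain J where J: "J \<in> \<C>" using C(1) by blast
    have "I \<subseteq> J" using mem[OF J] by (rule conjunct2)
    then have "I \<subseteq> \<Union>\<C>" using Union_upper[OF J] by (rule subset_trans)
    with nu show "\<Union>\<C> \<in> ?A" by (intro CollectI conjI)
  qed
  then obtain M where M: "M \<in> ?A" and max: "\<forall>X\<in>?A. M \<subseteq> X \<longrightarrow> X = M" by (rule bexE)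
  from M have "nonunital_algebra M" and "I \<subseteq> M" by simp_all
  moreover have "J = M" if "nonunital_algebra J" "M \<subseteq> J" for J
    using max that \<open>I \<subseteq> M\<close> by simp
  ultimately show thesis by (rule that)
qed

text \<open>For a maximal non-unital subalgebra \<open>I\<close>, the ring \<open>k + I\<close> is first shown to be local. If neither \<open>x\<close>
  nor its inverse belongs to it, then 1 is a combination of powers of \<open>x\<close>, and also of powers of
  \<open>inverse x\<close>, with coefficients in \<open>I\<close>; two shortest such combinations contradict each other.\<close>

context
  fixes I :: "'a set"
  assumes I: "nonunital_algebra I"
    and maximal: "\<And>J. nonunital_algebra J \<Longrightarrow> I \<subseteq> J \<Longrightarrow> J = I"
begin

private lemma sub: "subspace I" and one: "1 \<notin> I"
  using I by (simp_all add: nonunital_algebra_def)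

private lemmas cl = subspace_closed[OF sub]
private lemmas U = unitization_subring[OF I]

private lemma adjoin_cases:
  obtains "x - \<iota> c \<in> I" | p where "coeffs_in (unitization I) p" "poly p (\<iota> c) \<in> I" "poly p x = 1"
proof (cases "1 \<in> adjoin_at I x c")
  case True
  then show thesis using that(2) unfolding adjoin_at_def by force
next
  case False
  then show thesis using maximal adjoin_at[OF I, of x c] that(1) by blast
qed

private lemma one_plus_power: "i \<in> I \<Longrightarrow> (1 + i) ^ n - 1 \<in> I"
proof (induction n)
  case (Suc n)
  have "(1 + i) ^ Suc n - 1 = (1 + i) * ((1 + i) ^ n - 1) + i" by (simp add: algebra_simps)
  moreover have "1 + i \<in> unitization I" using Suc(2) U(1,3) by (auto simp: subring_closed)
  ultimately show ?case using Suc U(4) cl(2) by metis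
qed (simp add: cl(1))

text \<open>If \<open>1 / (1 + i)\<close> could not be adjoined with residue 1, then some \<open>p\<close> would have value 1 at it and a value
  in \<open>I\<close> at 1; but both values agree modulo \<open>I\<close> after clearing denominators, as \<open>1 + i\<close> is congruent to 1.\<close>

private lemma one_plus_unit:
  assumes i: "i \<in> I" shows "1 / (1 + i) \<in> unitization I"
proof -
  have nz: "1 + i \<noteq> 0" using i one cl(5) by (metis add_eq_0_iff minus_minus)
  have U1: "1 + i \<in> unitization I" using i U(1,3) by (auto simp: subring_closed)
  have *: "(1 + i) ^ n * poly p (1 / (1 + i)) - poly p 1 \<in> I"
    if "coeffs_in (unitization I) p" "degree p \<le> n" for p n
    using that
  proof (induction p arbitrary: n)
    case (pCons a q)
    have a: "a \<in> unitization I" using pCons.prems by simp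
    have *: "a * ((1 + i) ^ n - 1) \<in> I" using a one_plus_power[OF i] U(4) by blast
    show ?case
    proof (cases n)
      case 0
      then have "q = 0" using pCons.prems by (simp split: if_splits)
      then show ?thesis using * 0 by simp
    next
      case (Suc m)
      have "(1 + i) ^ m * poly q (1 / (1 + i)) - poly q 1 \<in> I"
        using pCons.IH pCons.prems Suc by (auto split: if_splits)
      moreover have "(1 + i) ^ n * poly (pCons a q) (1 / (1 + i)) - poly (pCons a q) 1
          = a * ((1 + i) ^ n - 1) + ((1 + i) ^ m * poly q (1 / (1 + i)) - poly q 1)"
      proof -
        have "(1 + i) ^ n * (1 / (1 + i)) = (1 + i) ^ m" using nz Suc by simp
        then have "(1 + i) ^ n * (1 / (1 + i) * poly q (1 / (1 + i))) = (1 + i) ^ m * poly q (1 / (1 + i))"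
          by (metis mult.assoc)
        then show ?thesis by (simp add: algebra_simps)
      qed
      ultimately show ?thesis using * cl(2) by metis
    qed
  qed (simp add: cl(1))
  show ?thesis
  proof (rule adjoin_cases[of "1 / (1 + i)" 1])
    assume "1 / (1 + i) - \<iota> 1 \<in> I"
    then have "(1 / (1 + i) - 1) + 1 \<in> unitization I" using U(3) subring_closed(2,6)[OF U(1)] by (metis iota_1 subsetD)
    then show ?thesis by simp
  next
    fix p assume p: "coeffs_in (unitization I) p" "poly p (\<iota> 1) \<in> I" "poly p (1 / (1 + i)) = 1"
    have "(1 + i) ^ degree p - poly p 1 \<in> I" using *[OF p(1) order_refl] p(3) by simp
    then have "(1 + i) ^ degree p \<in> I" using p(2) cl(2) by (metis diff_add_cancel iota_1)
    then have "1 \<in> I" using one_plus_power[OF i, of "degree p"] cl(4) by force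
    then show ?thesis using one by simp
  qed
qed

private lemma unit: 
  assumes "u \<in> unitization I" "u \<notin> I" shows "u \<noteq> 0" "inverse u \<in> unitization I"
proof -
  obtain c i where u: "u = \<iota> c + i" "i \<in> I" using assms(1) by (auto simp: unitization_def)
  have c: "c \<noteq> 0" using u assms(2) by auto
  show "u \<noteq> 0" using assms(2) cl(1) by blast
  define j where "j = \<iota> (inverse c) * i"
  have j: "j \<in> I" "u = \<iota> c * (1 + j)" using u c cl(3)[of i "inverse c"] by (auto simp: j_def iota_inverse field_simps simp del: inverse_eq_divide)
  have "inverse u = \<iota> (inverse c) * (1 / (1 + j))" by (simp add: j iota_inverse divide_inverse)
  then show "inverse u \<in> unitization I" using one_plus_unit[OF j(1)] U(2) subring_closed(4)[OF U(1)] by (metis rangeI subsetD)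
qed

text \<open>If 1 is not in the extension of \<open>I\<close> to \<open>(k + I)[x]\<close>, then \<open>x\<close> can be adjoined to \<open>k + I\<close> with a
  suitable residue \<open>c\<close>, against maximality.\<close>

private lemma one_in_extension:
  assumes "x \<notin> unitization I"
  obtains p where "coeffs_in I p" "poly p x = 1"
proof -
  define H where "H = {h. \<exists>p. coeffs_in I p \<and> ev h x = poly p x}"
  have inI: "coeffs_in I (p + q)" "coeffs_in I (- p)" if "coeffs_in I p" "coeffs_in I q" for p q
    using that cl by (auto simp: coeffs_in_def)
  have H_add: "h + k \<in> H" if "h \<in> H" "k \<in> H" for h k
    using that inI unfolding H_def by (auto simp: ev_add) (metis poly_add)
  have H_mult: "q * h \<in> H" if hH: "h \<in> H" for h q
  proof -
    obtain p where p: "coeffs_in I p" "ev h x = poly p x" using hH by (auto simp: H_def)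
    have "coeffs_in I (map_poly \<iota> q * p)"
      using p(1) cl unfolding coeffs_in_def coeff_mult
      by (auto intro!: subspace_sum[OF sub] simp: coeff_map_poly)
    moreover have "ev (q * h) x = poly (map_poly \<iota> q * p) x" by (simp add: ev_mult p)
    ultimately show ?thesis unfolding H_def by blast
  qed
  show thesis
  proof (cases "1 \<in> H")
    case True
    then show thesis using that unfolding H_def by force
  next
    case False
    \<comment> \<open>\<open>H\<close> is a proper ideal of a principal ideal domain, so its elements have a common root.\<close>
    have "\<exists>c. \<forall>h\<in>H. poly h c = 0"
    proof (cases "H \<subseteq> {0}")
      case nontrivial: False
      then obtain h where h: "h \<in> H" "h \<noteq> 0" "\<And>k. k \<in> H \<Longrightarrow> k \<noteq> 0 \<Longrightarrow> degree h \<le> degree k"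
        using ex_has_least_nat[of "\<lambda>h. h \<in> H \<and> h \<noteq> 0" _ degree] by blast
      have "degree h > 0"
      proof (rule ccontr)
        assume "\<not> degree h > 0"
        then obtain a where a: "h = [:a:]" using degree_eq_zeroE by auto
        then have "[:inverse a:] * h = 1" using h(2) by (simp add: one_pCons)
        then show False using H_mult[OF h(1)] False by metis
      qed
      then obtain c where c: "poly h c = 0" using alg_closed_imp_poly_has_root by blast
      have "poly k c = 0" if "k \<in> H" for k
      proof -
        have "k mod h = k + (- (k div h)) * h" by (simp add: minus_div_mult_eq_mod [symmetric])
        then have "k mod h \<in> H" using H_add[OF that H_mult[OF h(1)]] by metis
        then have "k mod h = 0" using h(3) degree_mod_less[OF h(2), of k] by fastforce
        then show ?thesis using c by (metis dvd_def mod_0_imp_dvd mult_zero_left poly_mult)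
      qed
      then show ?thesis by blast
    qed (metis poly_0 singletonD subsetD)
    then obtain c where c: "\<And>h. h \<in> H \<Longrightarrow> poly h c = 0" by blast
    show thesis
    proof (rule adjoin_cases[of x c])
      assume "x - \<iota> c \<in> I"
      then have "\<iota> c + (x - \<iota> c) \<in> unitization I" unfolding unitization_def by blast
      then show thesis using assms by simp
    next
      fix p assume p: "coeffs_in (unitization I) p" "poly p (\<iota> c) \<in> I" "poly p x = 1"
      define r where "r y = (THE d. y - \<iota> d \<in> I)" for y
      have unique: "d = e" if "y - \<iota> d \<in> I" "y - \<iota> e \<in> I" for y d e
      proof (rule ccontr)
        assume "d \<noteq> e"
        have "\<iota> (inverse (e - d)) * ((y - \<iota> d) - (y - \<iota> e)) \<in> I" using that cl by blast
        also have "\<iota> (inverse (e - d)) * ((y - \<iota> d) - (y - \<iota> e)) = \<iota> (inverse (e - d) * (e - d))"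
          by (simp add: iota_mult iota_diff)
        finally show False using one \<open>d \<noteq> e\<close> by simp
      qed
      have r_eq: "r y = d" if "y - \<iota> d \<in> I" for y d
        unfolding r_def using unique[OF that] that by blast
      have r0: "r 0 = 0" using r_eq[of 0 0] cl(1) by simp
      have r: "y - \<iota> (r y) \<in> I" if y: "y \<in> unitization I" for y
      proof -
        obtain d i where d: "y = \<iota> d + i" "i \<in> I" using y by (auto simp: unitization_def)
        then have "y - \<iota> d \<in> I" by simp
        then show ?thesis using r_eq by metis
      qed
      \<comment> \<open>Reduce the coefficients of \<open>p\<close> modulo \<open>I\<close>.\<close>
      define p0 where "p0 = map_poly r p"
      define p1 where "p1 = p - map_poly \<iota> p0"
      have p1: "coeffs_in I p1"
        using p(1) r r0 by (auto simp: coeffs_in_def p1_def p0_def coeff_map_poly)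
      have eq: "p = map_poly \<iota> p0 + p1" by (simp add: p1_def)
      have "ev (p0 - 1) x = poly (- p1) x" using p(3) unfolding eq ev_diff by (simp add: algebra_simps)
      then have "p0 - 1 \<in> H" using inI(2)[OF p1 p1] unfolding H_def by blast
      then have "poly p0 c = 1" using c[of "p0 - 1"] by simp
      then have "1 + poly p1 (\<iota> c) \<in> I" using p(2) unfolding eq poly_add ev_iota by simp
      moreover have "poly p1 (\<iota> c) \<in> I" unfolding poly_altdef
        using p1 cl(3) by (intro subspace_sum[OF sub]) (auto simp: coeffs_in_def mult.commute simp flip: iota_power)
      ultimately have "1 \<in> I" using cl(4) by force
      then show thesis using one by simp
    qed
  qed
qed

text \<open>The relation for \<open>inverse x\<close> expresses \<open>x ^ n\<close>, and thereby the leading term of the relation for \<open>x\<close>,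
  through lower powers with coefficients in \<open>I\<close>.\<close>

private lemma shorten:
  assumes p: "coeffs_in I p" "poly p x = 1" "degree p \<le> n"
    and q: "coeffs_in I q" "poly q (inverse x) = 1" "degree q \<le> n"
    and "x \<noteq> 0"
  obtains p' where "n > 0" "coeffs_in I p'" "poly p' x = 1" "degree p' \<le> n - 1"
proof -
  have n: "n > 0"
  proof (rule ccontr)
    assume "\<not> n > 0"
    then obtain a where "p = [:a:]" using p(3) degree_eq_zeroE by auto
    then show False using p one by simp
  qed
  define v where "v = inverse (1 - coeff q 0)"
  have q0: "1 - coeff q 0 \<in> unitization I" "1 - coeff q 0 \<notin> I"
  proof -
    have "coeff q 0 \<in> I" using q(1) by (simp add: coeffs_in_def)
    then show "1 - coeff q 0 \<in> unitization I" "1 - coeff q 0 \<notin> I"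
      using U(1,3) one cl(2)[of "1 - coeff q 0" "coeff q 0"] by (auto simp: subring_closed)
  qed
  note v = unit[OF q0, folded v_def]
  have "1 - coeff q 0 \<noteq> 0" using v(1) by simp
  then have xn: "x ^ n = (\<Sum>j=1..n. v * coeff q j * x ^ (n - j))"
    unfolding v_def by (rule power_from_inverse_relation[OF q(3) \<open>x \<noteq> 0\<close> q(2)])
  define b where "b = coeff p n"
  define r where "r = (\<Sum>j=1..n. monom (b * (v * coeff q j)) (n - j))"
  define p' where "p' = (p - monom b n) + r"
  have b: "b \<in> I" using p(1) by (simp add: b_def coeffs_in_def)
  have "poly r x = b * x ^ n"
    unfolding r_def poly_sum xn by (simp add: poly_monom sum_distrib_left mult.assoc)
  then have "poly p' x = 1" unfolding p'_def by (simp add: poly_monom p(2))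
  moreover have "degree p' \<le> n - 1"
  proof -
    have "degree r \<le> n - 1" unfolding r_def
      by (intro degree_sum_le) (auto intro: order.trans[OF degree_monom_le])
    moreover have "degree (p - monom b n) \<le> n - 1"
    proof (rule degree_le, safe)
      fix i assume "n - 1 < i"
      then consider "i = n" | "i > n" by linarith
      then show "coeff (p - monom b n) i = 0" using p(3) by cases (auto simp: b_def coeff_eq_0)
    qed
    ultimately show ?thesis unfolding p'_def by (rule degree_add_le[rotated])
  qed
  moreover have "coeffs_in I p'"
  proof -
    have "coeff q j \<in> I" for j using q(1) by (simp add: coeffs_in_def)
    then have "b * (v * coeff q j) \<in> I" for j using b U(3,4) v(2) by blast
    then have "coeff r i \<in> I" for i unfolding r_def coeff_sum
      by (intro subspace_sum[OF sub]) (auto simp: cl(1))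
    then show ?thesis using p(1) b cl unfolding coeffs_in_def p'_def by simp
  qed
  ultimately show thesis using that n by blast
qed

private lemma both_sides_absurd:
  assumes "coeffs_in I p" "poly p x = 1" "coeffs_in I q" "poly q (inverse x) = 1" "x \<noteq> 0"
  shows False
  using assms
proof (induction "degree p + degree q" arbitrary: p q rule: less_induct)
  case less
  show ?case
  proof (cases "degree q \<le> degree p")
    case True
    obtain p' where "degree p > 0" "coeffs_in I p'" "poly p' x = 1" "degree p' \<le> degree p - 1"
      using shorten[OF less(2,3) order_refl less(4,5) True less(6)] by blast
    moreover from this have "degree p' + degree q < degree p + degree q" by linarith
    ultimately show False using less(1)[of p' q] less(4-6) by blast
  next
    case False
    have "poly p (inverse (inverse x)) = 1" "degree p \<le> degree q" "inverse x \<noteq> 0"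
      using less(3,6) False by auto
    then obtain q' where "degree q > 0" "coeffs_in I q'" "poly q' (inverse x) = 1" "degree q' \<le> degree q - 1"
      using shorten[OF less(4,5) order_refl less(2)] by blast
    moreover from this have "degree p + degree q' < degree p + degree q" by linarith
    ultimately show False using less(1)[of p q'] less(2,3,6) by blast
  qed
qed

lemma place_unitization: "place (unitization I)" "max_ideal (unitization I) = I"
proof -
  show max: "max_ideal (unitization I) = I"
  proof (rule antisym)
    show "max_ideal (unitization I) \<subseteq> I" using unit by (auto simp: max_ideal_def cl(1))
    show "I \<subseteq> max_ideal (unitization I)"
    proof
      fix x assume x: "x \<in> I"
      then have "inverse x \<notin> unitization I" if "x \<noteq> 0" using U(4)[of "inverse x" x] that one by auto
      then show "x \<in> max_ideal (unitization I)" using x U(3) by (auto simp: max_ideal_def)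
    qed
  qed
  have "x \<in> unitization I \<or> inverse x \<in> unitization I" for x
  proof (rule ccontr)
    assume *: "\<not> ?thesis"
    then have "x \<noteq> 0" using subring_closed(1)[OF U(1)] by blast
    moreover obtain p where "coeffs_in I p" "poly p x = 1" using one_in_extension[of x] * by blast
    moreover obtain q where "coeffs_in I q" "poly q (inverse x) = 1"
      using one_in_extension[of "inverse x"] * by blast
    ultimately show False using both_sides_absurd by blast
  qed
  then have "valuation_ring \<iota> (unitization I)" using U(1,2) unfolding valuation_ring_def by blast
  moreover have "rational (unitization I)"
    unfolding rational_def local_subring_def max using U(1,2) cl(2)
    by (auto, auto simp: unitization_def) (metis add_diff_cancel_left')
  ultimately show "place (unitization I)" by (simp add: place_def)
qed

end

text \<open>Chevalley's extension theorem, with control of the residue field.\<close>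

theorem place_extension:
  assumes "nonunital_algebra I"
  obtains V where "place V" "I \<subseteq> max_ideal V"
proof -
  obtain M where M: "nonunital_algebra M" "I \<subseteq> M" "\<And>J. nonunital_algebra J \<Longrightarrow> M \<subseteq> J \<Longrightarrow> J = M"
    using maximal_nonunital_algebra[OF assms] by blast
  show thesis
    using that[of "unitization M"] place_unitization[OF M(1,3)] M(2) by blast
qed

end

section \<open>Products of subspaces\<close>

context alg_closed_base
begin

abbreviation klinear :: "('a \<Rightarrow> 'a) \<Rightarrow> bool" where
  "klinear \<equiv> Vector_Spaces.linear (\<lambda>c x. \<iota> c * x) (\<lambda>c x. \<iota> c * x)"

lemma linearI:
  assumes "\<And>x y. f (x + y) = f x + f y" "\<And>c x. f (\<iota> c * x) = \<iota> c * f x"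
  shows "klinear f"
  using assms vector_space_axioms by (simp add: Vector_Spaces.linear_iff)

lemma has_dim_scale:
  assumes "has_dim U n" "x \<noteq> 0"
  shows "has_dim ((\<lambda>y. x * y) ` U) n"
proof -
  have lin: "klinear (\<lambda>y. x * y)"
    by (rule linearI) (auto simp: algebra_simps)
  obtain a b where ab: "has_dim {u\<in>U. x * u = 0} a" "has_dim ((\<lambda>y. x * y) ` U) b" "a + b = n"
    using rank_nullity[OF assms(1) lin] by blast
  have "{u\<in>U. x * u = 0} = {0}"
    using assms(2) subspace_0[OF has_dim_subspace[OF assms(1)]] by auto
  then have "a = 0" using ab(1) has_dim_0 has_dim_unique by metis
  with ab show ?thesis by simp
qed

lemma subspace_quotient:
  assumes "subspace M" shows "subspace {z. z / d \<in> M}"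
  by (rule subspaceI) (auto simp: add_divide_distrib subspace_closed[OF assms]
        simp flip: times_divide_eq_right)

subsection \<open>The dimension of a product\<close>

lemma place_local: "place V \<Longrightarrow> local_subring V"
  by (simp add: place_def rational_def)

lemma place_cases: "place V \<Longrightarrow> x \<in> V \<or> inverse x \<in> V"
  by (auto simp: place_def valuation_ring_def)

text \<open>Here \<open>y / u \<in> V\<close> says that the value of \<open>u\<close> is at most that of \<open>y\<close>. Values are totally ordered, so one
  takes a basis element of least value.\<close>

lemma leading_element:
  assumes V: "place V" and U: "has_dim U n" "n > 0"
  obtains u where "u \<in> U" "u \<noteq> 0" "\<And>y. y \<in> U \<Longrightarrow> y / u \<in> V"
proof -
  note V' = local_subringD[OF place_local[OF V]]
  obtain B where B: "finite B" "card B = n" "\<not> dependent B" "span B = U"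
    using U(1) by (auto simp: has_dim_def)
  have ne: "B \<noteq> {}" using B(2) U(2) by auto
  have "0 \<notin> B" using B(3) dependent_zero by blast
  with B(1) ne have "\<exists>u\<in>B. \<forall>y\<in>B. y / u \<in> V"
  proof (induction B rule: finite_ne_induct)
    case (singleton x)
    then show ?case using subring_closed(2)[OF V'(1)] by simp
  next
    case (insert x F)
    then obtain u where u: "u \<in> F" "\<And>y. y \<in> F \<Longrightarrow> y / u \<in> V" by auto
    have nz: "u \<noteq> 0" "x \<noteq> 0" using insert.prems u(1) by auto
    consider "x / u \<in> V" | "u / x \<in> V" using place_cases[OF V, of "x / u"] by auto
    then show ?case
    proof cases
      case 1
      then show ?thesis using u by blast
    next
      case 2
      have "y / x \<in> V" if "y \<in> F" for y
        using subring_closed(4)[OF V'(1) u(2)[OF that] 2] nz by simp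
      then show ?thesis using nz subring_closed(2)[OF V'(1)] by auto
    qed
  qed
  then obtain u where u: "u \<in> B" "\<And>y. y \<in> B \<Longrightarrow> y / u \<in> V" by blast
  have "span B \<subseteq> {z. z / u \<in> V}"
    using u(2) by (intro span_minimal subspace_quotient V'(8)) auto
  then show thesis using that[of u] u(1) B(4) \<open>0 \<notin> B\<close> span_base by blast
qed

text \<open>Elements of least value are unique up to a constant and elements of larger value, because the residue
  field is \<open>k\<close>.\<close>

lemma remove_leading_element:
  assumes V: "place V" and U: "has_dim U (Suc n)"
    and u: "u \<in> U" "u \<noteq> 0" "\<And>y. y \<in> U \<Longrightarrow> y / u \<in> V"
  shows "has_dim {y\<in>U. y / u \<in> max_ideal V} n"
proof (rule has_dim_codim_one[OF U])
  note V' = local_subringD[OF place_local[OF V]]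
  show "subspace {y\<in>U. y / u \<in> max_ideal V}"
    using subspace_inter[OF has_dim_subspace[OF U] subspace_quotient[OF V'(9)]] by (simp add: Int_def)
  show "u \<notin> {y\<in>U. y / u \<in> max_ideal V}" using u(2) V'(6) by simp
  show "\<exists>c. y - \<iota> c * u \<in> {y\<in>U. y / u \<in> max_ideal V}" if y: "y \<in> U" for y
  proof -
    obtain c where "y / u - \<iota> c \<in> max_ideal V"
      using u(3)[OF y] V unfolding place_def rational_def by blast
    then have "(y - \<iota> c * u) / u \<in> max_ideal V" using u(2) by (simp add: diff_divide_distrib)
    then show ?thesis using y u(1) subspace_closed[OF has_dim_subspace[OF U]] by blast
  qed
qed (use u in auto)

lemma remove_leading_product:
  assumes V: "place V" and C: "has_dim C c" and d: "d \<in> C" "d \<noteq> 0"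
  obtains m where "has_dim {z\<in>C. z / d \<in> max_ideal V} m" "m < c"
proof (rule has_dim_psubset[OF C _ _ d(1)])
  note V' = local_subringD[OF place_local[OF V]]
  show "subspace {z\<in>C. z / d \<in> max_ideal V}"
    using subspace_inter[OF has_dim_subspace[OF C] subspace_quotient[OF V'(9)]] by (simp add: Int_def)
  show "d \<notin> {z\<in>C. z / d \<in> max_ideal V}" using d(2) V'(6) by simp
qed (use that in auto)

text \<open>Let \<open>u\<close> and \<open>v\<close> be of least value in \<open>A\<close> and \<open>B\<close>. If one passes to the elements of larger value in \<open>A\<close>,
  then the products have larger value than \<open>u * v\<close>, so that \<open>C\<close> can be diminished as well.\<close>

lemma remove_leading:
  assumes V: "place V" and A: "has_dim A (Suc a)" and B: "has_dim B b" "b \<ge> 1" and C: "has_dim C c"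
    and prod: "\<And>x y. x \<in> A \<Longrightarrow> y \<in> B \<Longrightarrow> x * y \<in> C"
  obtains A' C' m where "has_dim A' a" "has_dim C' m" "m < c" "\<And>x y. x \<in> A' \<Longrightarrow> y \<in> B \<Longrightarrow> x * y \<in> C'"
proof -
  obtain u where u: "u \<in> A" "u \<noteq> 0" "\<And>y. y \<in> A \<Longrightarrow> y / u \<in> V" using leading_element[OF V A] by auto
  obtain v where v: "v \<in> B" "v \<noteq> 0" "\<And>y. y \<in> B \<Longrightarrow> y / v \<in> V"
    using leading_element[OF V B(1)] B(2) by auto
  have uv: "u * v \<in> C" "u * v \<noteq> 0" using prod u v by auto
  obtain m where m: "has_dim {z\<in>C. z / (u * v) \<in> max_ideal V} m" "m < c"
    using remove_leading_product[OF V C uv] .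
  show thesis
  proof (rule that[OF remove_leading_element[OF V A u] m])
    fix x y assume x: "x \<in> {y\<in>A. y / u \<in> max_ideal V}" and y: "y \<in> B"
    have "y / v * (x / u) \<in> max_ideal V"
      by (rule local_subringD(4)[OF place_local[OF V] v(3)[OF y]]) (use x in blast)
    then show "x * y \<in> {z\<in>C. z / (u * v) \<in> max_ideal V}"
      using x y prod by (simp add: mult.commute)
  qed
qed

lemma nonunital_zero: "nonunital_algebra {0}"
  by (simp add: nonunital_algebra_def subspace_single_0)

text \<open>Hopf's inequality for the multiplication of a field. By \<open>remove_leading\<close> one may shrink \<open>A\<close> to a line.\<close>

theorem dim_product:
  assumes "has_dim A a" "a \<ge> 1" "has_dim B b" "b \<ge> 1" "has_dim C c"
    and "\<And>x y. x \<in> A \<Longrightarrow> y \<in> B \<Longrightarrow> x * y \<in> C"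
  shows "a + b \<le> c + 1"
proof -
  obtain V where V: "place V" using place_extension[OF nonunital_zero] by blast
  show ?thesis using assms(2,1,5,6)
  proof (induction a arbitrary: A C c rule: nat_induct_at_least)
    case base
    obtain x where x: "x \<in> A" "x \<noteq> 0" using has_dim_nonzero[OF base(1)] by auto
    have "(\<lambda>y. x * y) ` B \<subseteq> C" using base(3)[OF x(1)] by auto
    then have "b \<le> c" using has_dim_mono[OF base(2) has_dim_scale[OF assms(3) x(2)]] by simp
    then show ?case by simp
  next
    case (Suc a)
    obtain A' C' m where m: "has_dim A' a" "has_dim C' m" "m < c" "\<And>x y. x \<in> A' \<Longrightarrow> y \<in> B \<Longrightarrow> x * y \<in> C'"
      using remove_leading[OF V Suc.prems(1) assms(3,4) Suc.prems(2,3)] by blast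
    have "a + b \<le> m + 1" by (rule Suc.IH[OF m(1,2,4)])
    then show ?case using m(3) by simp
  qed
qed

subsection \<open>The case of equality\<close>

definition progression :: "'a \<Rightarrow> 'a \<Rightarrow> nat \<Rightarrow> 'a set" where
  "progression u x n = {u * ev h x | h. h = 0 \<or> degree h < n}"

lemma progression_subspace: "subspace (progression u x n)"
proof (rule subspaceI)
  show "0 \<in> progression u x n" unfolding progression_def by (auto intro!: exI[of _ 0])
next
  fix y z assume "y \<in> progression u x n" "z \<in> progression u x n"
  then obtain g h where gh: "y = u * ev g x" "z = u * ev h x" "g = 0 \<or> degree g < n" "h = 0 \<or> degree h < n"
    unfolding progression_def by blast
  have "g + h = 0 \<or> degree (g + h) < n" using gh(3,4) by (auto intro: degree_add_less)
  moreover have "y + z = u * ev (g + h) x" using gh by (simp add: ev_add distrib_left)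
  ultimately show "y + z \<in> progression u x n" unfolding progression_def by blast
next
  fix c z assume "z \<in> progression u x n"
  then obtain h where h: "z = u * ev h x" "h = 0 \<or> degree h < n" unfolding progression_def by blast
  have "smult c h = 0 \<or> degree (smult c h) < n" using h(2) by auto
  moreover have "\<iota> c * z = u * ev (smult c h) x" using h ev_mult[of "[:c:]" h x] by simp
  ultimately show "\<iota> c * z \<in> progression u x n" unfolding progression_def by blast
qed

lemma mem_progression: "j < n \<Longrightarrow> u * x ^ j \<in> progression u x n"
  unfolding progression_def
  by (rule CollectI, rule exI[of _ "monom 1 j"]) (simp add: map_poly_monom poly_monom degree_monom_eq)

lemma progression_least:
  assumes "subspace U" "\<And>j. j < n \<Longrightarrow> u * x ^ j \<in> U"
  shows "progression u x n \<subseteq> U"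
proof
  fix z assume "z \<in> progression u x n"
  then obtain h where h: "z = u * ev h x" "h = 0 \<or> degree h < n" unfolding progression_def by blast
  show "z \<in> U"
  proof (cases "h = 0")
    case True
    then show ?thesis using h(1) subspace_closed(1)[OF assms(1)] by simp
  next
    case False
    have "degree (map_poly \<iota> h) = degree h" by (rule degree_map_poly) simp
    then have "ev h x = (\<Sum>i\<le>degree h. \<iota> (coeff h i) * x ^ i)"
      unfolding poly_altdef by (simp add: coeff_map_poly)
    then have z: "z = (\<Sum>i\<le>degree h. \<iota> (coeff h i) * (u * x ^ i))"
      using h(1) by (simp add: sum_distrib_left mult.left_commute)
    have "\<iota> (coeff h i) * (u * x ^ i) \<in> U" if "i \<le> degree h" for i
      using assms(2)[of i] subspace_closed(3)[OF assms(1)] that h(2) False by simp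
    then show ?thesis unfolding z by (intro subspace_sum[OF assms(1)]) simp
  qed
qed

lemma has_dim_progression:
  assumes "u \<noteq> 0" "x \<notin> range \<iota>"
  shows "has_dim (progression u x n) n"
proof (induction n)
  case 0
  have "progression u x 0 = {0}" by (auto simp: progression_def intro!: exI[of _ 0])
  then show ?case using has_dim_0 by simp
next
  case (Suc n)
  have "u * x ^ n \<notin> progression u x n"
  proof
    assume "u * x ^ n \<in> progression u x n"
    then obtain h where h: "x ^ n = ev h x" "h = 0 \<or> degree h < n"
      using assms(1) unfolding progression_def by auto
    have "ev (monom 1 n - h) x = 0" using h(1) by (simp add: ev_diff map_poly_monom poly_monom)
    moreover have "monom 1 n - h \<noteq> 0"
      using h(2) by (auto simp: monom_eq_0_iff) (metis degree_monom_eq eq_iff_diff_eq_0 nat_neq_iff one_neq_zero)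
    ultimately show False using algebraic_in_range assms(2) by blast
  qed
  then have "has_dim (span (insert (u * x ^ n) (progression u x n))) (Suc n)"
    using has_dim_insert[OF Suc] by blast
  moreover have "span (insert (u * x ^ n) (progression u x n)) = progression u x (Suc n)"
  proof (rule span_subspace[OF _ _ progression_subspace])
    have "progression u x n \<subseteq> progression u x (Suc n)" by (auto simp: progression_def)
    then show "insert (u * x ^ n) (progression u x n) \<subseteq> progression u x (Suc n)"
      using mem_progression[of n "Suc n" u x] by auto
    show "progression u x (Suc n) \<subseteq> span (insert (u * x ^ n) (progression u x n))"
      by (rule progression_least[OF subspace_span])
        (metis insertI1 insertI2 less_Suc_eq mem_progression span_base)
  qed
  ultimately show ?case by simp
qed

lemma codim_le_one_preimage:
  assumes U: "has_dim U m" and f: "klinear f"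
    and B: "has_dim B b" and D: "has_dim D d" "d \<le> b + 1" "B \<subseteq> D" "f ` U \<subseteq> D"
  obtains n where "has_dim {u\<in>U. f u \<in> B} n" "m \<le> n + 1"
proof (cases "{u\<in>U. f u \<in> B} = U")
  case True
  then show thesis using U that by force
next
  case False
  interpret f: Vector_Spaces.linear "\<lambda>c x. \<iota> c * x" "\<lambda>c x. \<iota> c * x" f by fact
  obtain u where u: "u \<in> U" "f u \<notin> B" using False by blast
  note U' = subspace_closed[OF has_dim_subspace[OF U]]
  have "m \<noteq> 0"
  proof
    assume "m = 0"
    then have "u = 0" using U u has_dim_zeroD by blast
    then show False using u(2) subspace_closed(1)[OF has_dim_subspace[OF B]] f.zero by simp
  qed
  then obtain n where n: "m = Suc n" using not0_implies_Suc by blast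
  have big: "has_dim (span (insert (f u) B)) (Suc b)" using has_dim_insert[OF B u(2)] .
  have le: "span (insert (f u) B) \<subseteq> D"
    using D u(1) by (intro span_minimal has_dim_subspace[OF D(1)]) auto
  have eq: "span (insert (f u) B) = D"
  proof -
    have "Suc b \<le> d" using has_dim_mono[OF D(1) big le] .
    then have "d = Suc b" using D(2) by simp
    then show ?thesis using has_dim_subset[OF D(1) has_dim_subspace[OF big] le] has_dim_unique[OF big] by metis
  qed
  have "has_dim {u\<in>U. f u \<in> B} n"
  proof (rule has_dim_codim_one[OF U[unfolded n]])
    show "subspace {u\<in>U. f u \<in> B}"
      using subspace_inter[OF has_dim_subspace[OF U] f.subspace_linear_preimage[OF has_dim_subspace[OF B]]]
      by (simp add: Int_def)
    show "\<exists>c. y - \<iota> c * u \<in> {u\<in>U. f u \<in> B}" if y: "y \<in> U" for y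
    proof -
      have "f y \<in> span (insert (f u) B)" using y D(4) eq by blast
      then obtain c where "f y - \<iota> c * f u \<in> span B" by (auto simp: span_insert)
      then have "f (y - \<iota> c * u) \<in> B"
        using has_dim_subspace[OF B] span_eq_iff[THEN iffD2, of B] by (simp only: f.diff f.scale)
      then show ?thesis using y u(1) U' by blast
    qed
  qed (use u in auto)
  then show thesis using that n by simp
qed

text \<open>Since \<open>B\<close> has codimension at most one in \<open>D\<close>, each of the conditions \<open>x ^ i * y \<in> B\<close> lowers the dimension by
  at most one. So \<open>b - 1\<close> of them can be satisfied by a nonzero \<open>y\<close>, which then is the first term of the
  progression.\<close>

lemma pencil_progression:
  assumes B: "has_dim B b" "b \<ge> 1" and D: "has_dim D d" "d \<le> b + 1"
    and sub: "B \<subseteq> D" "\<And>y. y \<in> B \<Longrightarrow> x * y \<in> D" and x: "x \<notin> range \<iota>"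
  obtains u where "u \<noteq> 0" "B = progression u x b"
proof -
  have "\<exists>m. has_dim {y\<in>B. \<forall>i\<le>j. x ^ i * y \<in> B} m \<and> b \<le> m + j" for j
  proof (induction j)
    case 0
    have "{y\<in>B. \<forall>i\<le>0. x ^ i * y \<in> B} = B" by auto
    then show ?case using B(1) by auto
  next
    case (Suc j)
    let ?U = "{y\<in>B. \<forall>i\<le>j. x ^ i * y \<in> B}"
    obtain m where m: "has_dim ?U m" "b \<le> m + j" using Suc by blast
    have lin: "klinear (\<lambda>y. x ^ Suc j * y)"
      by (rule linearI) (auto simp: algebra_simps)
    have "(\<lambda>y. x ^ Suc j * y) ` ?U \<subseteq> D" using sub(2) by (auto simp: mult.assoc)
    then obtain n where n: "has_dim {u\<in>?U. x ^ Suc j * u \<in> B} n" "m \<le> n + 1"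
      using codim_le_one_preimage[OF m(1) lin B(1) D sub(1)] by blast
    have "{u\<in>?U. x ^ Suc j * u \<in> B} = {y\<in>B. \<forall>i\<le>Suc j. x ^ i * y \<in> B}"
      by (auto simp: le_Suc_eq)
    then show ?case using n m(2) by (intro exI[of _ n]) auto
  qed
  from this[of "b - 1"] obtain m where m: "has_dim {y\<in>B. \<forall>i\<le>b - 1. x ^ i * y \<in> B} m" "m > 0"
    using B(2) by auto
  obtain u where u: "u \<noteq> 0" "\<And>i. i \<le> b - 1 \<Longrightarrow> x ^ i * u \<in> B" using has_dim_nonzero[OF m] by auto
  have sub: "progression u x b \<subseteq> B"
    using u(2) by (intro progression_least has_dim_subspace[OF B(1)]) (auto simp: mult.commute)
  have "progression u x b = B"
    using has_dim_subset[OF B(1) progression_subspace sub] has_dim_unique[OF has_dim_progression[OF u(1) x]]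
    by metis
  then show thesis using that u(1) by blast
qed

lemma quotient_notin_range:
  assumes "v \<notin> span {u}" "u \<noteq> 0" shows "v / u \<notin> range \<iota>"
proof
  assume "v / u \<in> range \<iota>"
  then obtain c where "v = \<iota> c * u" using assms(2) by (auto simp: field_simps)
  then show False using assms(1) by (auto simp: span_singleton)
qed

lemma inverse_notin_range:
  assumes "x \<notin> range \<iota>" shows "inverse x \<notin> range \<iota>"
proof
  assume "inverse x \<in> range \<iota>"
  then obtain c where "inverse x = \<iota> c" by blast
  then have "x = \<iota> (inverse c)" by (metis inverse_inverse_eq iota_inverse)
  then show False using assms by blast
qed

text \<open>Equality in Hopf's inequality persists under \<open>remove_leading\<close>, and \<open>A\<close> may be shrunk to a pencil
  with basis \<open>u, u * x\<close>.\<close>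

lemma descend_to_pencil:
  assumes "has_dim A a" "a \<ge> 2" "has_dim B b" "b \<ge> 1" "has_dim C c" "c + 1 \<le> a + b"
    and "\<And>x y. x \<in> A \<Longrightarrow> y \<in> B \<Longrightarrow> x * y \<in> C"
  obtains u x D d where "u \<noteq> 0" "x \<notin> range \<iota>" "has_dim D d" "d \<le> b + 1"
    "\<And>y. y \<in> B \<Longrightarrow> u * y \<in> D" "\<And>y. y \<in> B \<Longrightarrow> u * x * y \<in> D"
proof -
  obtain V where V: "place V" using place_extension[OF nonunital_zero] by blast
  have "\<exists>u x D d. u \<noteq> 0 \<and> x \<notin> range \<iota> \<and> has_dim D d \<and> d \<le> b + 1 \<and>
      (\<forall>y\<in>B. u * y \<in> D \<and> u * x * y \<in> D)"
    using assms(2,1,5,6,7)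
  proof (induction a arbitrary: A C c rule: nat_induct_at_least)
    case base
    obtain u where u: "u \<in> A" "u \<noteq> 0" using has_dim_nonzero[OF base(1)] by auto
    obtain v where v: "v \<in> A" "v \<notin> span {u}" using has_dim_not_multiple[OF base(1) _ u(1)] by auto
    have "v / u \<notin> range \<iota>" by (rule quotient_notin_range[OF v(2) u(2)])
    moreover have "u * y \<in> C \<and> u * (v / u) * y \<in> C" if "y \<in> B" for y
      using base(4) u v(1) that by auto
    ultimately show ?case using base(2,3) u(2) by (intro exI[of _ u] exI[of _ "v / u"] exI[of _ C] exI[of _ c]) auto
  next
    case (Suc a)
    obtain A' C' m where m: "has_dim A' a" "has_dim C' m" "m < c" "\<And>x y. x \<in> A' \<Longrightarrow> y \<in> B \<Longrightarrow> x * y \<in> C'"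
      using remove_leading[OF V Suc.prems(1) assms(3,4) Suc.prems(2,4)] by blast
    show ?case by (rule Suc.IH[OF m(1,2) _ m(4)]) (use m(3) Suc.prems(3) in simp)
  qed
  then show thesis using that by blast
qed

text \<open>Extend the evaluation at \<open>c\<close> from polynomials in \<open>x\<close> to a place.\<close>

lemma place_at:
  assumes "x \<notin> range \<iota>"
  obtains V where "place V" "x - \<iota> c \<in> max_ideal V"
proof -
  have unit: "unitization {0} = range \<iota>" by (auto simp: unitization_def)
  have "1 \<notin> adjoin_at {0} x c"
  proof
    assume "1 \<in> adjoin_at {0} x c"
    then obtain h where h: "1 = ev h x" "ev h (\<iota> c) = 0"
      unfolding adjoin_at_def unit coeffs_in_range_iota by auto
    have "h \<noteq> 1" using h(2) by auto
    moreover have "ev (h - 1) x = 0" using h(1) by (simp add: ev_diff)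
    ultimately show False using algebraic_in_range[of "h - 1" x] assms by simp
  qed
  note * = adjoin_at[OF nonunital_zero, of x c]
  obtain V where "place V" "adjoin_at {0} x c \<subseteq> max_ideal V"
    using place_extension[OF *(3)] \<open>1 \<notin> adjoin_at {0} x c\<close> by blast
  then show thesis using that *(2) by blast
qed

text \<open>At a place where \<open>x\<close> is infinite, higher powers of \<open>x\<close> have smaller value. So, when leading elements are
  removed, the progression \<open>1, x, \<dots>, x ^ (b - 1)\<close> loses its last term, and after \<open>b - 2\<close> steps only the pencil
  \<open>1, x\<close> is left.\<close>

lemma descend_progression:
  assumes V: "place V" "inverse x \<in> max_ideal V" "x \<noteq> 0" and A: "has_dim A a" "a \<ge> 1"
    and "b \<ge> 2" "has_dim C c" "c + 1 \<le> a + b" "\<And>j y. j < b \<Longrightarrow> y \<in> A \<Longrightarrow> x ^ j * y \<in> C"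
  shows "\<exists>D d. has_dim D d \<and> d \<le> a + 1 \<and> A \<subseteq> D \<and> (\<forall>y\<in>A. x * y \<in> D)"
  using assms(6-9)
proof (induction b arbitrary: C c rule: nat_induct_at_least)
  case base
  have "A \<subseteq> C" "\<forall>y\<in>A. x * y \<in> C" using base(3)[of 0] base(3)[of 1] by auto
  then show ?case using base(1,2) by (intro exI[of _ C] exI[of _ c]) auto
next
  case (Suc b)
  note V' = local_subringD[OF place_local[OF V(1)]]
  obtain u where u: "u \<in> A" "u \<noteq> 0" "\<And>y. y \<in> A \<Longrightarrow> y / u \<in> V"
    using leading_element[OF V(1) A(1)] A(2) by auto
  define d where "d = x ^ b * u"
  have d: "d \<in> C" "d \<noteq> 0" using Suc.prems(3)[of b u] u V(3) by (auto simp: d_def)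
  obtain m where m: "has_dim {z\<in>C. z / d \<in> max_ideal V} m" "m < c"
    using remove_leading_product[OF V(1) Suc.prems(1) d] .
  show ?case
  proof (rule Suc.IH[OF m(1)])
    show "m + 1 \<le> a + b" using m(2) Suc.prems(2) by simp
    fix j y assume j: "j < b" and y: "y \<in> A"
    have inv: "inverse x \<in> V" using V(2) max_ideal_subset by blast
    obtain i where i: "b = j + Suc i" using j less_imp_Suc_add by auto
    have "x ^ j * y / d = (y / u * inverse x ^ i) * inverse x"
      using V(3) u(2) by (simp add: d_def i power_add field_simps)
    moreover have "y / u * inverse x ^ i \<in> V"
      using u(3)[OF y] subring_power[OF V'(1) inv] subring_closed(4)[OF V'(1)] by blast
    ultimately have "x ^ j * y / d \<in> max_ideal V" using V'(4) V(2) by metis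
    then show "x ^ j * y \<in> {z\<in>C. z / d \<in> max_ideal V}" using Suc.prems(3)[of j y] j y by simp
  qed
qed

text \<open>An analogue of Vosper's theorem. Shrinking \<open>A\<close> to a pencil \<open>u, u * x\<close> shows that \<open>B\<close> is a progression with
  ratio \<open>x\<close>. Shrinking \<open>B\<close> to a pencil with the same ratio shows that \<open>A\<close> is one, too. Then so is \<open>C\<close>, by
  counting dimensions.\<close>

theorem product_equality:
  assumes A: "has_dim A a" "a \<ge> 2" and B: "has_dim B b" "b \<ge> 2"
    and C: "has_dim C c" "c + 1 \<le> a + b"
    and prod: "\<And>x y. x \<in> A \<Longrightarrow> y \<in> B \<Longrightarrow> x * y \<in> C"
  obtains u x where "u \<noteq> 0" "x \<notin> range \<iota>" "C = progression u x c"
proof -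
  obtain u x D d where u: "u \<noteq> 0" "x \<notin> range \<iota>" and D: "has_dim D d" "d \<le> b + 1"
    "\<And>y. y \<in> B \<Longrightarrow> u * y \<in> D" "\<And>y. y \<in> B \<Longrightarrow> u * x * y \<in> D"
    using descend_to_pencil[OF A B(1) _ C prod] B(2) by (metis One_nat_def Suc_leD numeral_2_eq_2)
  have x0: "x \<noteq> 0" using u(2) iota_0 by (metis rangeI)
  have uD: "has_dim ((\<lambda>y. inverse u * y) ` D) d" using has_dim_scale[OF D(1)] u(1) by simp
  have *: "z \<in> (\<lambda>y. inverse u * y) ` D" if "u * z \<in> D" for z
    by (rule image_eqI[OF _ that]) (simp add: u(1))
  obtain \<beta> where \<beta>: "\<beta> \<noteq> 0" "B = progression \<beta> x b"
  proof (rule pencil_progression[OF B(1) _ uD D(2)])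
    show "1 \<le> b" using B(2) by simp
    show "B \<subseteq> (\<lambda>y. inverse u * y) ` D" using * D(3) by blast
    show "x * y \<in> (\<lambda>y. inverse u * y) ` D" if "y \<in> B" for y
      using * D(4)[OF that] by (simp add: mult.assoc)
  qed (use u in auto)
  have "inverse x \<notin> range \<iota>" by (rule inverse_notin_range[OF u(2)])
  then obtain V where V: "place V" "inverse x \<in> max_ideal V" using place_at[of "inverse x" 0] by auto
  have \<beta>C: "has_dim ((\<lambda>y. inverse \<beta> * y) ` C) c" using has_dim_scale[OF C(1)] \<beta>(1) by simp
  have "x ^ j * y \<in> (\<lambda>y. inverse \<beta> * y) ` C" if "j < b" "y \<in> A" for j y
  proof (rule image_eqI)
    show "y * (\<beta> * x ^ j) \<in> C" using prod[OF that(2)] mem_progression[OF that(1)] \<beta>(2) by blast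
  qed (simp add: \<beta>(1))
  then obtain E e where E: "has_dim E e" "e \<le> a + 1" "A \<subseteq> E" "\<forall>y\<in>A. x * y \<in> E"
    using descend_progression[OF V x0 A(1) _ B(2) \<beta>C C(2)] A(2) by auto
  obtain \<alpha> where \<alpha>: "\<alpha> \<noteq> 0" "A = progression \<alpha> x a"
    using pencil_progression[OF A(1) _ E(1-3) _ u(2)] E(4) A(2) by auto
  have sub: "progression (\<alpha> * \<beta>) x (a + b - 1) \<subseteq> C"
  proof (rule progression_least[OF has_dim_subspace[OF C(1)]])
    fix j assume j: "j < a + b - 1"
    define i where "i = min j (a - 1)"
    have ij: "i < a" "j - i < b" "i + (j - i) = j" using j A(2) B(2) by (auto simp: i_def)
    have "(\<alpha> * x ^ i) * (\<beta> * x ^ (j - i)) \<in> C"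
      using prod mem_progression ij(1,2) \<alpha>(2) \<beta>(2) by blast
    moreover have "(\<alpha> * x ^ i) * (\<beta> * x ^ (j - i)) = \<alpha> * \<beta> * x ^ j"
      using ij(3) by (metis (no_types, lifting) mult.assoc mult.left_commute power_add)
    ultimately show "\<alpha> * \<beta> * x ^ j \<in> C" by simp
  qed
  have nz: "\<alpha> * \<beta> \<noteq> 0" using \<alpha> \<beta> by simp
  have dim: "has_dim (progression (\<alpha> * \<beta>) x (a + b - 1)) (a + b - 1)"
    using has_dim_progression[OF nz u(2)] .
  have "a + b - 1 \<le> c" using has_dim_mono[OF C(1) dim sub] .
  then have c: "c = a + b - 1" using C(2) by simp
  have "progression (\<alpha> * \<beta>) x c = C"
    using has_dim_subset[OF C(1) progression_subspace sub[folded c]] has_dim_unique[OF dim[folded c]] by metis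
  then show thesis using that[OF nz u(2)] by simp
qed

end

section \<open>Zariski's lemma\<close>

definition is_ideal :: "'a::field set \<Rightarrow> 'a set \<Rightarrow> bool" where
  "is_ideal R J \<longleftrightarrow> J \<subseteq> R \<and> 0 \<in> J \<and> (\<forall>x\<in>J. \<forall>y\<in>J. x + y \<in> J) \<and> (\<forall>a\<in>R. \<forall>x\<in>J. a * x \<in> J)"

lemma is_idealD:
  assumes "is_subring R" "is_ideal R J"
  shows "x \<in> J \<Longrightarrow> x \<in> R" "0 \<in> J" "x \<in> J \<Longrightarrow> y \<in> J \<Longrightarrow> x + y \<in> J" "a \<in> R \<Longrightarrow> x \<in> J \<Longrightarrow> a * x \<in> J"
    "x \<in> J \<Longrightarrow> - x \<in> J" "x \<in> J \<Longrightarrow> y \<in> J \<Longrightarrow> x - y \<in> J"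
proof -
  show *: "\<And>x. x \<in> J \<Longrightarrow> x \<in> R" "0 \<in> J" "\<And>x y. x \<in> J \<Longrightarrow> y \<in> J \<Longrightarrow> x + y \<in> J"
    "\<And>a x. a \<in> R \<Longrightarrow> x \<in> J \<Longrightarrow> a * x \<in> J"
    using assms(2) by (auto simp: is_ideal_def)
  have "- 1 \<in> R" using subring_closed(2,5)[OF assms(1)] by blast
  then show neg: "\<And>x. x \<in> J \<Longrightarrow> - x \<in> J" using *(4) by fastforce
  show "\<And>x y. x \<in> J \<Longrightarrow> y \<in> J \<Longrightarrow> x - y \<in> J" using *(3) neg by (metis diff_conv_add_uminus)
qed

text \<open>That \<open>R / J\<close> is a field, in terms of elements of \<open>R\<close>.\<close>

definition maximal_ideal :: "'a::field set \<Rightarrow> 'a set \<Rightarrow> bool" where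
  "maximal_ideal R J \<longleftrightarrow> is_ideal R J \<and> 1 \<notin> J \<and> (\<forall>x\<in>R - J. \<exists>y\<in>R. 1 - x * y \<in> J)"

lemma prime_idealD:
  assumes "is_prime_ideal R J"
  shows "is_ideal R J" "1 \<notin> J" "x \<in> R \<Longrightarrow> y \<in> R \<Longrightarrow> x * y \<in> J \<Longrightarrow> x \<in> J \<or> y \<in> J"
  using assms by (auto simp: is_prime_ideal_def is_ideal_def)

lemma maximal_is_prime:
  assumes R: "is_subring R" and J: "maximal_ideal R J"
  shows "is_prime_ideal R J"
proof -
  have I: "is_ideal R J" "1 \<notin> J" using J by (auto simp: maximal_ideal_def)
  note I' = is_idealD[OF R I(1)]
  have "y \<in> J" if x: "x \<in> R" "y \<in> R" "x * y \<in> J" "x \<notin> J" for x y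
  proof -
    obtain z where z: "z \<in> R" "1 - x * z \<in> J" using J x(1,4) by (auto simp: maximal_ideal_def)
    have "y * (1 - x * z) + z * (x * y) \<in> J"
      using I'(3)[OF I'(4)[OF x(2) z(2)] I'(4)[OF z(1) x(3)]] .
    then show ?thesis by (simp add: algebra_simps)
  qed
  then show ?thesis using I unfolding is_prime_ideal_def is_ideal_def by blast
qed

lemma maximal_ideal_exists:
  assumes R: "is_subring R" and I: "is_ideal R I" "1 \<notin> I"
  obtains J where "maximal_ideal R J" "I \<subseteq> J"
proof -
  let ?A = "{J. is_ideal R J \<and> 1 \<notin> J \<and> I \<subseteq> J}"
  have "\<exists>M\<in>?A. \<forall>X\<in>?A. M \<subseteq> X \<longrightarrow> X = M"
  proof (rule subset_Zorn_nonempty)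
    show "?A \<noteq> {}" using I by blast
    fix \<C> assume C: "\<C> \<noteq> {}" "subset.chain ?A \<C>"
    have mem: "is_ideal R J" "1 \<notin> J" "I \<subseteq> J" if "J \<in> \<C>" for J
      using C(2) that by (auto simp: subset.chain_def)
    have two: "\<exists>J\<in>\<C>. x \<in> J \<and> y \<in> J" if "x \<in> \<Union>\<C>" "y \<in> \<Union>\<C>" for x y
      using that C(2) unfolding subset.chain_def by blast
    obtain J0 where J0: "J0 \<in> \<C>" using C(1) by blast
    have "x \<in> R" if "x \<in> \<Union>\<C>" for x using that mem(1) is_idealD(1)[OF R] by blast
    moreover have "0 \<in> \<Union>\<C>" using J0 is_idealD(2)[OF R mem(1)[OF J0]] by blast
    moreover have "x + y \<in> \<Union>\<C>" if "x \<in> \<Union>\<C>" "y \<in> \<Union>\<C>" for x y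
      using two[OF that] is_idealD(3)[OF R mem(1)] by blast
    moreover have "a * x \<in> \<Union>\<C>" if "a \<in> R" "x \<in> \<Union>\<C>" for a x
      using that is_idealD(4)[OF R mem(1)] by blast
    ultimately have "is_ideal R (\<Union>\<C>)" unfolding is_ideal_def by (intro conjI ballI subsetI) simp_all
    moreover have "1 \<notin> \<Union>\<C>" using mem(2) by blast
    moreover have "I \<subseteq> \<Union>\<C>" using mem(3)[OF J0] Union_upper[OF J0] by (rule subset_trans)
    ultimately show "\<Union>\<C> \<in> ?A" by (intro CollectI conjI)
  qed
  then obtain M where M: "M \<in> ?A" and max: "\<forall>X\<in>?A. M \<subseteq> X \<longrightarrow> X = M" by (rule bexE)
  from M have M': "is_ideal R M" "1 \<notin> M" "I \<subseteq> M" by simp_all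
  note cl = is_idealD[OF R M'(1)]
  have "\<exists>y\<in>R. 1 - x * y \<in> M" if x: "x \<in> R - M" for x
  proof -
    define N where "N = {z + x * y | z y. z \<in> M \<and> y \<in> R}"
    have N: "z + x * y \<in> N" if "z \<in> M" "y \<in> R" for z y using that by (auto simp: N_def)
    have "M \<subseteq> N" using N[OF _ subring_closed(1)[OF R]] by auto
    moreover have xN: "x \<in> N" using N[OF cl(2) subring_closed(2)[OF R]] by simp
    moreover have "is_ideal R N"
      unfolding is_ideal_def
    proof (intro conjI ballI subsetI)
      show "a \<in> R" if "a \<in> N" for a
        using that x cl(1) subring_closed[OF R] by (auto simp: N_def)
      show "0 \<in> N" using \<open>M \<subseteq> N\<close> cl(2) by blast
      show "a + b \<in> N" if ab: "a \<in> N" "b \<in> N" for a b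
      proof -
        obtain z y z' y' where "a = z + x * y" "b = z' + x * y'" "z \<in> M" "z' \<in> M" "y \<in> R" "y' \<in> R"
          using ab by (auto simp: N_def)
        then show ?thesis using N[of "z + z'" "y + y'"] cl(3) subring_closed(6)[OF R]
          by (simp add: algebra_simps)
      qed
      show "a * b \<in> N" if ab: "a \<in> R" "b \<in> N" for a b
      proof -
        obtain z y where "b = z + x * y" "z \<in> M" "y \<in> R" using ab by (auto simp: N_def)
        then show ?thesis using N[of "a * z" "a * y"] cl(4) ab(1) subring_closed(4)[OF R]
          by (simp add: algebra_simps)
      qed
    qed
    ultimately have "1 \<in> N" using max M'(3) x by auto
    then obtain z y where zy: "1 = z + x * y" "z \<in> M" "y \<in> R" by (auto simp: N_def)
    then have "1 - x * y = z" by (metis add_diff_cancel_right')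
    then show ?thesis using zy(2,3) by blast
  qed
  then have "maximal_ideal R M" using M' by (auto simp: maximal_ideal_def)
  then show thesis using that M'(3) by blast
qed

text \<open>That the image of \<open>T\<close> modulo a prime ideal \<open>J\<close> becomes a field when a single element \<open>t\<close> is inverted
  (Kaplansky's G-domains). Congruences modulo \<open>J\<close> replace the quotient ring, which would not be a type.\<close>

definition almost_field :: "'a::field set \<Rightarrow> 'a set \<Rightarrow> bool" where
  "almost_field J T \<longleftrightarrow> (\<exists>t\<in>T - J. \<forall>x\<in>T - J. \<exists>y\<in>T. \<exists>n. t ^ n - x * y \<in> J)"

lemma degree_lessI:
  assumes "degree p \<le> n" "coeff p n = 0" "n > 0"
  shows "degree p < n"
  using assms by (metis degree_0 leading_coeff_0_iff le_neq_implies_less)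

lemma pseudo_division_in:
  fixes g :: "'a::field poly"
  assumes T: "is_subring T" and g: "coeffs_in T g" "degree g > 0" and q: "coeffs_in T q"
  obtains e d r where "smult (lead_coeff g ^ e) q = g * d + r" "degree r < degree g"
    "coeffs_in T d" "coeffs_in T r"
proof -
  note cl = coeffs_in_closed[OF T]
  have "\<exists>e d r. smult (lead_coeff g ^ e) q = g * d + r \<and> degree r < degree g \<and>
    coeffs_in T d \<and> coeffs_in T r"
    using q
  proof (induction "degree q" arbitrary: q rule: less_induct)
    case less
    show ?case
    proof (cases "degree q < degree g")
      case True
      then show ?thesis using less(2) cl(1) by (intro exI[of _ 0] exI[of _ 0] exI[of _ q]) simp
    next
      case False
      define m where "m = monom (lead_coeff q) (degree q - degree g)"
      define q2 where "q2 = smult (lead_coeff g) q - g * m"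
      have m: "coeffs_in T m" unfolding m_def using less(2) cl(7) by (simp add: coeffs_in_def)
      have q2: "coeffs_in T q2" unfolding q2_def
        by (intro cl(3) cl(5) cl(6) less(2) g(1) m) (use g(1) in \<open>simp add: coeffs_in_def\<close>)
      have "degree (g * m) \<le> degree q"
        using degree_mult_le[of g m] degree_monom_le[of "lead_coeff q" "degree q - degree g"] False
        unfolding m_def by linarith
      then have "degree q2 \<le> degree q" unfolding q2_def
        by (meson degree_diff_le degree_smult_le)
      moreover have "coeff q2 (degree q) = 0"
      proof -
        have "q \<noteq> 0" using False g(2) by auto
        then have m': "degree m = degree q - degree g" "lead_coeff m = lead_coeff q"
          unfolding m_def by (auto simp: degree_monom_eq)
        have "coeff (g * m) (degree q) = lead_coeff g * lead_coeff q"
          using coeff_mult_degree_sum[of g m] m' False by simp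
        then show ?thesis unfolding q2_def by simp
      qed
      ultimately have "degree q2 < degree q" using degree_lessI False g(2) by (metis not_le order_less_le_trans)
      from less(1)[OF this q2] obtain e d r where
        IH: "smult (lead_coeff g ^ e) q2 = g * d + r" "degree r < degree g" "coeffs_in T d" "coeffs_in T r"
        by blast
      have "smult (lead_coeff g ^ Suc e) q = smult (lead_coeff g ^ e) (q2 + g * m)"
        by (simp add: q2_def mult.commute)
      also have "\<dots> = g * (d + smult (lead_coeff g ^ e) m) + r"
        using IH(1) by (simp add: smult_add_right algebra_simps)
      finally have "smult (lead_coeff g ^ Suc e) q = g * (d + smult (lead_coeff g ^ e) m) + r" .
      moreover have "coeffs_in T (d + smult (lead_coeff g ^ e) m)"
        by (intro cl(4) cl(6) IH(3) m subring_power[OF T]) (use g(1) in \<open>simp add: coeffs_in_def\<close>)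
      ultimately show ?thesis using IH by blast
    qed
  qed
  then show thesis using that by blast
qed

context
  fixes R J T :: "'a::field set" and s :: 'a
  assumes R: "is_subring R" and J: "is_prime_ideal R J"
    and T: "is_subring T" "T \<subseteq> R" and s: "s \<in> R"
begin

private lemmas J' = is_idealD[OF R prime_idealD(1)[OF J]]
private lemmas one = prime_idealD(2)[OF J]
private lemmas prime = prime_idealD(3)[OF J]

private lemma prime_power: "x \<in> R \<Longrightarrow> x ^ n \<in> J \<Longrightarrow> x \<in> J"
  using one by (induction n) (auto dest: prime[OF _ subring_power[OF R]])

private lemma cong_trans: "a - b \<in> J \<Longrightarrow> b - c \<in> J \<Longrightarrow> a - c \<in> J"
  using J'(3)[of "a - b" "b - c"] by simp

private lemma cong_mult: "r \<in> R \<Longrightarrow> a - b \<in> J \<Longrightarrow> r * a - r * b \<in> J"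
  using J'(4)[of r "a - b"] by (simp add: right_diff_distrib)

private lemma cong_sym: "a - b \<in> J \<Longrightarrow> b - a \<in> J"
  using J'(5)[of "a - b"] by simp

private lemma cong_power:
  assumes "a \<in> R" "b \<in> R" "a - b \<in> J" shows "a ^ n - b ^ n \<in> J"
proof (induction n)
  case (Suc n)
  have "a * a ^ n - a * b ^ n \<in> J" using cong_mult[OF assms(1) Suc] .
  moreover have "b ^ n * a - b ^ n * b \<in> J" using cong_mult[OF subring_power[OF R assms(2)] assms(3)] .
  ultimately show ?case using cong_trans by (simp add: mult.commute)
qed (simp add: J'(2))

private lemma in_R: "coeffs_in T p \<Longrightarrow> poly p s \<in> R"
  using poly_in_subring[OF R coeffs_in_mono[OF _ T(2)] s] by blast

private lemma poly_in_J: "coeffs_in J p \<Longrightarrow> poly p s \<in> J"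
  by (induction p) (auto simp: J'(2) intro!: J'(3) J'(4)[OF s])

text \<open>Terms with coefficients in \<open>J\<close> at the top of a polynomial may be dropped.\<close>

private lemma trim:
  assumes p: "coeffs_in T p" "\<not> coeffs_in J p"
  obtains q where "coeffs_in T q" "lead_coeff q \<notin> J" "degree q \<le> degree p" "poly p s - poly q s \<in> J"
proof -
  have fin: "finite {i. coeff p i \<notin> J}"
    by (rule finite_subset[of _ "{..degree p}"]) (auto simp: coeff_eq_0 J'(2) not_less[symmetric])
  have ne: "{i. coeff p i \<notin> J} \<noteq> {}" using p(2) by (auto simp: coeffs_in_def)
  define n where "n = Max {i. coeff p i \<notin> J}"
  have n: "coeff p n \<notin> J" using Max_in[OF fin ne] by (simp add: n_def)
  have n': "coeff p i \<in> J" if "i > n" for i using Max_ge[OF fin, of i] that by (fastforce simp: n_def)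
  define q where "q = poly_cutoff (Suc n) p"
  have cq: "coeff q i = (if i \<le> n then coeff p i else 0)" for i
    by (simp add: q_def coeff_poly_cutoff less_Suc_eq_le)
  have dq: "degree q = n"
  proof (rule antisym)
    show "degree q \<le> n" by (rule degree_le) (simp add: cq)
    show "n \<le> degree q" using n J'(2) by (intro le_degree) (auto simp: cq)
  qed
  have "coeffs_in T q" using p(1) subring_closed(1)[OF T(1)] by (auto simp: coeffs_in_def cq)
  moreover have "lead_coeff q \<notin> J" using n by (simp add: dq cq)
  moreover have "degree q \<le> degree p" unfolding dq using n J'(2) by (intro le_degree) auto
  moreover have "poly p s - poly q s \<in> J"
  proof -
    have "coeffs_in J (p - q)" using n' by (auto simp: coeffs_in_def cq J'(2))
    then show ?thesis using poly_in_J by fastforce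
  qed
  ultimately show thesis using that by blast
qed

private lemma adj: "is_subring (adjunction T s)" "T \<subseteq> adjunction T s" "s \<in> adjunction T s"
  "adjunction T s \<subseteq> R"
  using adjunction_subring[OF T(1)] subset_adjunction[OF T(1)] mem_adjunction[OF T(1)]
    adjunction_least[OF R T(2) s] by auto

text \<open>A polynomial ring over a domain does not become a field by inverting one element \<open>t\<close>: with \<open>u = s * t\<close>,
  the polynomial \<open>1 + u\<close> would divide a power of \<open>t\<close>, hence a power of \<open>u\<close>. But \<open>u\<close> is congruent to \<open>- 1\<close>
  modulo \<open>1 + u\<close>, so \<open>1 + u\<close> would divide 1, although its degree is positive.\<close>

lemma almost_field_algebraic:
  assumes "almost_field J (adjunction T s)"
  obtains f where "coeffs_in T f" "lead_coeff f \<notin> J" "poly f s \<in> J"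
proof (rule ccontr)
  assume none: "\<not> thesis"
  note found = that
  have no: "lead_coeff f \<in> J" if f: "coeffs_in T f" "poly f s \<in> J" for f
    using none found f by blast
  have all: "coeffs_in J f" if f: "coeffs_in T f" "poly f s \<in> J" for f
  proof (rule ccontr)
    assume "\<not> coeffs_in J f"
    then obtain q where q: "coeffs_in T q" "lead_coeff q \<notin> J" "poly f s - poly q s \<in> J"
      using trim[OF f(1)] by blast
    have "poly q s \<in> J" using J'(6)[OF f(2) q(3)] by simp
    then show False using no q by blast
  qed
  note cl = coeffs_in_closed[OF T(1)]
  note A = adj(1) note A' = subring_closed[OF adj(1)]
  obtain t where t: "t \<in> adjunction T s" "t \<notin> J"
    and inv: "\<And>x. x \<in> adjunction T s \<Longrightarrow> x \<notin> J \<Longrightarrow> \<exists>y\<in>adjunction T s. \<exists>n. t ^ n - x * y \<in> J"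
    using assms unfolding almost_field_def by blast
  obtain f0 where f0: "t = poly f0 s" "coeffs_in T f0" using t(1) by (auto simp: adjunction_def)
  have "\<not> coeffs_in J f0" using t(2) f0(1) poly_in_J by blast
  then obtain f where f: "coeffs_in T f" "lead_coeff f \<notin> J" "t - poly f s \<in> J"
    using trim[OF f0(2)] f0(1) by blast
  define u where "u = s * poly f s"
  have fA: "poly f s \<in> adjunction T s" using f(1) by (auto simp: adjunction_def)
  have uA: "u \<in> adjunction T s" unfolding u_def using A'(4) adj(3) fA by blast
  have x_poly: "1 + u = poly (pCons 1 f) s" by (simp add: u_def)
  have coT: "coeffs_in T (pCons 1 f)" using f(1) subring_closed(2)[OF T(1)] by simp
  have "1 + u \<notin> J"
  proof
    assume "1 + u \<in> J"
    then have "coeffs_in J (pCons 1 f)" using all[OF coT] x_poly by simp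
    then show False using one by simp
  qed
  then obtain y n where y: "y \<in> adjunction T s" "t ^ n - (1 + u) * y \<in> J"
    using inv[of "1 + u"] A'(2,6) uA by blast
  have "\<exists>k\<in>adjunction T s. u ^ n - (- 1) ^ n = (1 + u) * k" for n
  proof (induction n)
    case (Suc n)
    then obtain k where k: "k \<in> adjunction T s" "u ^ n - (- 1) ^ n = (1 + u) * k" by blast
    have "u ^ Suc n - (- 1) ^ Suc n = u * (u ^ n - (- 1) ^ n) + (1 + u) * (- 1) ^ n"
      by (simp add: algebra_simps)
    also have "\<dots> = (1 + u) * (u * k + (- 1) ^ n)" unfolding k(2) by (simp add: algebra_simps)
    finally have "u ^ Suc n - (- 1) ^ Suc n = (1 + u) * (u * k + (- 1) ^ n)" .
    moreover have "u * k + (- 1) ^ n \<in> adjunction T s"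
      by (intro A'(6) A'(4) subring_power[OF A] A'(5) A'(2) uA k(1))
    ultimately show ?case by blast
  qed (use A'(1) in auto)
  then obtain k where k: "k \<in> adjunction T s" "u ^ n - (- 1) ^ n = (1 + u) * k" by blast
  define z where "z = (- 1) ^ n * (s ^ n * y - k)"
  have AR: "\<And>a. a \<in> adjunction T s \<Longrightarrow> a \<in> R" using adj(4) by blast
  have zA: "z \<in> adjunction T s" unfolding z_def
    by (intro A'(3) A'(4) subring_power[OF A] A'(5) A'(2) adj(3) y(1) k(1))
  have "s ^ n * poly f s ^ n - s ^ n * t ^ n \<in> J"
    using cong_mult[OF subring_power[OF R s] cong_power[OF AR[OF fA] AR[OF t(1)] cong_sym[OF f(3)]]] .
  moreover have "s ^ n * t ^ n - s ^ n * ((1 + u) * y) \<in> J"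
    using cong_mult[OF subring_power[OF R s] y(2)] .
  ultimately have "u ^ n - s ^ n * ((1 + u) * y) \<in> J"
    using cong_trans unfolding u_def power_mult_distrib by blast
  moreover have "(- 1) ^ n \<in> R" by (intro subring_power[OF R] subring_closed(2,5)[OF R])
  ultimately have "(- 1) ^ n * (u ^ n - s ^ n * ((1 + u) * y)) \<in> J" using J'(4) by blast
  also have "u ^ n = (- 1) ^ n + (1 + u) * k" using k(2) by (simp add: algebra_simps)
  also have "(- 1) ^ n * ((- 1) ^ n + (1 + u) * k - s ^ n * ((1 + u) * y)) = 1 - (1 + u) * z"
    unfolding z_def by (simp add: algebra_simps flip: power_mult_distrib)
  finally have z: "1 - (1 + u) * z \<in> J" .
  obtain q0 where q0: "z = poly q0 s" "coeffs_in T q0" using zA by (auto simp: adjunction_def)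
  have uR: "1 + u \<in> R" using AR[OF A'(6)[OF A'(2) uA]] .
  have "\<not> coeffs_in J q0"
  proof
    assume "coeffs_in J q0"
    then have "(1 + u) * z \<in> J" using poly_in_J q0(1) uR J'(4) by blast
    then show False using J'(3)[OF z] one by fastforce
  qed
  then obtain q where q: "coeffs_in T q" "lead_coeff q \<notin> J" "z - poly q s \<in> J"
    using trim[OF q0(2)] q0(1) by blast
  have "1 - (1 + u) * poly q s \<in> J"
    using cong_trans[OF z cong_mult[OF uR q(3)]] by simp
  then have "poly (1 - pCons 1 f * q) s \<in> J" unfolding x_poly poly_diff poly_mult poly_1 .
  then have "coeffs_in J (1 - pCons 1 f * q)"
    using all cl(3)[OF cl(2) cl(5)[OF coT q(1)]] by blast
  then have *: "coeff (1 - pCons 1 f * q) (degree (pCons 1 f) + degree q) \<in> J"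
    unfolding coeffs_in_def by (rule spec)
  have "f \<noteq> 0" using f(2) J'(2) by auto
  then have "degree (pCons 1 f) + degree q > 0" by simp
  then have "coeff (1 - pCons 1 f * q) (degree (pCons 1 f) + degree q)
      = - (lead_coeff (pCons 1 f) * lead_coeff q)"
    unfolding coeff_diff coeff_mult_degree_sum by (simp add: coeff_1)
  also have "lead_coeff (pCons 1 f) = lead_coeff f" using \<open>f \<noteq> 0\<close> by simp
  finally have "lead_coeff f * lead_coeff q \<in> J" using * J'(5) by fastforce
  moreover have "lead_coeff f \<in> R" "lead_coeff q \<in> R" using f(1) q(1) T(2) by (auto simp: coeffs_in_def)
  ultimately show False using prime f(2) q(2) by blast
qed

text \<open>Let \<open>f\<close> be a relation of least degree for \<open>s\<close> over \<open>T\<close> modulo \<open>J\<close>, with leading coefficient \<open>\<alpha>\<close>, so that the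
  powers of \<open>s\<close> below \<open>degree f\<close> are independent modulo \<open>J\<close>. There is a multiple \<open>b\<close> of \<open>t\<close> that lies in \<open>T\<close>
  and not in \<open>J\<close>. If \<open>x\<close> in \<open>T\<close> divides a power of \<open>t\<close>, and hence of \<open>b\<close>, in \<open>T[s]\<close>, then it divides this power
  times a power of \<open>\<alpha>\<close> in \<open>T\<close>: write the cofactor, multiplied by a power of \<open>\<alpha>\<close>, in lower powers of \<open>s\<close>
  and compare the constant terms. Thus \<open>\<alpha> * b\<close> is the element to be inverted.\<close>

lemma almost_field_descend:
  assumes G: "almost_field J (adjunction T s)"
  shows "almost_field J T"
proof -
  note cl = coeffs_in_closed[OF T(1)]
  note A = adj(1) note A' = subring_closed[OF adj(1)]
  have AR: "\<And>a. a \<in> adjunction T s \<Longrightarrow> a \<in> R" using adj(4) by blast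
  have coT: "\<And>p i. coeffs_in T p \<Longrightarrow> coeff p i \<in> T" by (simp add: coeffs_in_def)
  have coR: "\<And>p i. coeffs_in T p \<Longrightarrow> coeff p i \<in> R" using T(2) by (auto simp: coeffs_in_def)
  have coJ: "\<And>p i. coeffs_in J p \<Longrightarrow> coeff p i \<in> J" by (simp add: coeffs_in_def)
  have pA: "\<And>p. coeffs_in T p \<Longrightarrow> poly p s \<in> adjunction T s" by (auto simp: adjunction_def)
  obtain t where t: "t \<in> adjunction T s" "t \<notin> J"
    and inv: "\<And>x. x \<in> adjunction T s \<Longrightarrow> x \<notin> J \<Longrightarrow> \<exists>y\<in>adjunction T s. \<exists>n. t ^ n - x * y \<in> J"
    using G unfolding almost_field_def by blast
  let ?P = "\<lambda>f. coeffs_in T f \<and> lead_coeff f \<notin> J \<and> poly f s \<in> J"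
  have "\<exists>f. ?P f" using almost_field_algebraic[OF G] by blast
  then obtain f where f: "coeffs_in T f" "lead_coeff f \<notin> J" "poly f s \<in> J"
    and least: "\<And>g. ?P g \<Longrightarrow> degree f \<le> degree g"
    using ex_has_least_nat[of ?P _ degree] by blast
  have deg: "degree f > 0"
  proof (rule ccontr)
    assume "\<not> degree f > 0"
    then obtain a where "f = [:a:]" using degree_eq_zeroE by auto
    then show False using f(2,3) by simp
  qed
  have small: "coeffs_in J r" if r: "coeffs_in T r" "degree r < degree f" "poly r s \<in> J" for r
  proof (rule ccontr)
    assume "\<not> coeffs_in J r"
    then obtain q where q: "coeffs_in T q" "lead_coeff q \<notin> J" "degree q \<le> degree r" "poly r s - poly q s \<in> J"
      using trim[OF r(1)] by blast
    have "poly q s \<in> J" using J'(6)[OF r(3) q(4)] by simp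
    then show False using least[of q] q r(2) by linarith
  qed
  define \<alpha> where "\<alpha> = lead_coeff f"
  have \<alpha>: "\<alpha> \<in> T" "\<alpha> \<in> R" "\<alpha> \<notin> J" using f coT coR by (auto simp: \<alpha>_def)
  have reduce: "\<exists>e r. coeffs_in T r \<and> degree r < degree f \<and> \<alpha> ^ e * y - poly r s \<in> J"
    if y: "y \<in> adjunction T s" for y
  proof -
    obtain q where q: "y = poly q s" "coeffs_in T q" using y by (auto simp: adjunction_def)
    obtain e d r where d: "smult (\<alpha> ^ e) q = f * d + r" "degree r < degree f" "coeffs_in T d" "coeffs_in T r"
      using pseudo_division_in[OF T(1) f(1) deg q(2)] unfolding \<alpha>_def by blast
    have "\<alpha> ^ e * y = poly (f * d + r) s" unfolding d(1)[symmetric] q(1) by simp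
    then have "\<alpha> ^ e * y - poly r s = poly d s * poly f s" by (simp add: mult.commute)
    then have "\<alpha> ^ e * y - poly r s \<in> J" using J'(4)[OF in_R[OF d(3)] f(3)] by simp
    then show ?thesis using d by blast
  qed
  \<comment> \<open>A nonzero constant among the multiples of \<open>t\<close> modulo \<open>J\<close>: take a multiple of least degree.\<close>
  let ?Q = "\<lambda>r. coeffs_in T r \<and> lead_coeff r \<notin> J \<and> degree r < degree f \<and>
    (\<exists>w\<in>adjunction T s. poly r s - t * w \<in> J)"
  have "\<exists>r. ?Q r"
  proof -
    obtain e r where r: "coeffs_in T r" "degree r < degree f" "\<alpha> ^ e * t - poly r s \<in> J"
      using reduce[OF t(1)] by blast
    have "\<not> coeffs_in J r"
    proof
      assume "coeffs_in J r"
      then have "\<alpha> ^ e * t \<in> J" using J'(3)[OF r(3) poly_in_J[of r]] by simp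
      then show False using prime[OF subring_power[OF R \<alpha>(2)] AR[OF t(1)]] prime_power[OF \<alpha>(2)] \<alpha>(3) t(2) by blast
    qed
    then obtain q where q: "coeffs_in T q" "lead_coeff q \<notin> J" "degree q \<le> degree r" "poly r s - poly q s \<in> J"
      using trim[OF r(1)] by blast
    have "poly q s - t * \<alpha> ^ e \<in> J" using cong_sym[OF cong_trans[OF r(3) q(4)]] by (simp add: mult.commute)
    moreover have "\<alpha> ^ e \<in> adjunction T s" using subring_power[OF T(1) \<alpha>(1)] adj(2) by blast
    ultimately show ?thesis using q r(2) by (metis order.strict_trans1)
  qed
  then obtain r w where r: "coeffs_in T r" "lead_coeff r \<notin> J" "degree r < degree f"
      and w: "w \<in> adjunction T s" "poly r s - t * w \<in> J"
      and least_r: "\<And>g. ?Q g \<Longrightarrow> degree r \<le> degree g"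
    using ex_has_least_nat[of ?Q _ degree] by blast
  have "degree r = 0"
  proof (rule ccontr)
    assume "degree r \<noteq> 0"
    then obtain e d r' where d: "smult (lead_coeff r ^ e) f = r * d + r'" "degree r' < degree r"
        "coeffs_in T d" "coeffs_in T r'"
      using pseudo_division_in[OF T(1) r(1) _ f(1)] by blast
    define \<beta> where "\<beta> = lead_coeff r ^ e"
    note d = d[folded \<beta>_def]
    have \<beta>: "\<beta> \<in> R" "\<beta> \<notin> J" unfolding \<beta>_def
      using subring_power[OF R coR[OF r(1)]] prime_power[OF coR[OF r(1)]] r(2) by blast+
    have eq: "\<beta> * poly f s = poly r s * poly d s + poly r' s"
      using arg_cong[OF d(1), of "\<lambda>p. poly p s"] by simp
    have r'J: "coeffs_in J r'"
    proof (rule ccontr)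
      assume "\<not> coeffs_in J r'"
      then obtain q where q: "coeffs_in T q" "lead_coeff q \<notin> J" "degree q \<le> degree r'" "poly r' s - poly q s \<in> J"
        using trim[OF d(4)] by blast
      have "poly r' s - t * (- (w * poly d s)) = \<beta> * poly f s - poly d s * (poly r s - t * w)"
        using eq by (simp add: algebra_simps)
      also have "\<dots> \<in> J" using J'(6)[OF J'(4)[OF \<beta>(1) f(3)] J'(4)[OF in_R[OF d(3)] w(2)]] .
      finally have "poly q s - t * (- (w * poly d s)) \<in> J" using cong_trans[OF cong_sym[OF q(4)]] by blast
      moreover have "- (w * poly d s) \<in> adjunction T s" by (intro A'(5) A'(4) w(1) pA[OF d(3)])
      ultimately have "\<exists>w\<in>adjunction T s. poly q s - t * w \<in> J" by blast
      then have "?Q q" using q(1-3) d(2) r(3) by simp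
      then show False using least_r[of q] q(3) d(2) by linarith
    qed
    have "poly r s * poly d s = \<beta> * poly f s - poly r' s" using eq by simp
    also have "\<dots> \<in> J" using J'(6)[OF J'(4)[OF \<beta>(1) f(3)] poly_in_J[OF r'J]] .
    finally consider "poly r s \<in> J" | "poly d s \<in> J" using prime in_R[OF r(1)] in_R[OF d(3)] by blast
    then show False
    proof cases
      case 1
      then show ?thesis using small[OF r(1,3)] coJ r(2) by blast
    next
      case 2
      have \<beta>0: "\<beta> \<noteq> 0" using \<beta>(2) J'(2) by metis
      have rd: "r * d = smult \<beta> f - r'" using d(1) by simp
      have deg_rd: "degree (r * d) = degree f" "lead_coeff (r * d) = \<beta> * \<alpha>"
      proof -
        have lt: "degree r' < degree (smult \<beta> f)" using d(2) r(3) \<beta>0 by simp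
        have "degree (smult \<beta> f + - r') = degree (smult \<beta> f)"
          by (rule degree_add_eq_left) (use lt in simp)
        then show 1: "degree (r * d) = degree f" unfolding rd using \<beta>0 by simp
        show "lead_coeff (r * d) = \<beta> * \<alpha>" unfolding 1 unfolding rd
          using lt \<beta>0 by (simp add: coeff_eq_0 \<alpha>_def)
      qed
      have lc: "lead_coeff r * lead_coeff d \<notin> J"
        using deg_rd(2) prime[OF \<beta>(1) \<alpha>(2)] \<beta>(2) \<alpha>(3) by (auto simp: lead_coeff_mult)
      have nz: "r \<noteq> 0" "d \<noteq> 0" using lc J'(2) by auto
      have "degree r + degree d = degree f" using deg_rd(1) nz by (simp add: degree_mult_eq)
      then have "degree d < degree f" using \<open>degree r \<noteq> 0\<close> by simp
      then have "lead_coeff d \<in> J" using small[OF d(3) _ 2] coJ by blast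
      then show ?thesis using lc J'(4)[OF coR[OF r(1)]] by blast
    qed
  qed
  then obtain b where "r = [:b:]" using degree_eq_zeroE by blast
  then have b: "b \<in> T" "b \<notin> J" "b - t * w \<in> J" using r(1,2) w(2) by auto
  have bR: "b \<in> R" using b(1) T(2) by blast
  have twR: "t * w \<in> R" using AR[OF A'(4)[OF t(1) w(1)]] .
  have "\<exists>y\<in>T. \<exists>n. (\<alpha> * b) ^ n - x * y \<in> J" if x: "x \<in> T - J" for x
  proof -
    have xR: "x \<in> R" using x T(2) by blast
    have xA: "x \<in> adjunction T s" "x \<notin> J" using x adj(2) by auto
    from inv[OF this] obtain y n where y: "y \<in> adjunction T s" "t ^ n - x * y \<in> J" by blast
    define z where "z = w ^ n * y"
    have zA: "z \<in> adjunction T s" unfolding z_def using A'(4) subring_power[OF A w(1)] y(1) by blast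
    have "b ^ n - (t * w) ^ n \<in> J" using cong_power[OF bR twR b(3)] .
    moreover have "w ^ n * t ^ n - w ^ n * (x * y) \<in> J"
      using cong_mult[OF subring_power[OF R AR[OF w(1)]] y(2)] .
    ultimately have bz: "b ^ n - x * z \<in> J" unfolding z_def power_mult_distrib
      using cong_trans by (metis mult.commute mult.left_commute)
    obtain e r where r: "coeffs_in T r" "degree r < degree f" "\<alpha> ^ e * z - poly r s \<in> J"
      using reduce[OF zA] by blast
    define h where "h = [:\<alpha> ^ e * b ^ n:] - smult x r"
    have powT: "\<alpha> ^ e * b ^ n \<in> T" for e n
      using subring_closed(4)[OF T(1)] subring_power[OF T(1)] \<alpha>(1) b(1) by blast
    have "coeffs_in T h" unfolding h_def
      using powT x r(1) cl(1,3,6) by simp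
    moreover have "degree h < degree f"
    proof -
      have "degree (smult x r) \<le> degree r" by (rule degree_smult_le)
      then show ?thesis unfolding h_def using r(2) deg by (intro degree_diff_less) auto
    qed
    moreover have "poly h s \<in> J"
    proof -
      have "\<alpha> ^ e * b ^ n - \<alpha> ^ e * (x * z) \<in> J" using cong_mult[OF subring_power[OF R \<alpha>(2)] bz] .
      moreover have "x * (\<alpha> ^ e * z) - x * poly r s \<in> J" using cong_mult[OF xR r(3)] .
      ultimately show ?thesis unfolding h_def using cong_trans by (simp add: mult.left_commute)
    qed
    ultimately have "coeff h 0 \<in> J" using small coJ by blast
    then have h0: "\<alpha> ^ e * b ^ n - x * coeff r 0 \<in> J" by (simp add: h_def)
    have "\<alpha> ^ n * b ^ e * (\<alpha> ^ e * b ^ n - x * coeff r 0) \<in> J"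
      using J'(4)[OF _ h0] powT[of n e] T(2) by blast
    also have "\<alpha> ^ n * b ^ e * (\<alpha> ^ e * b ^ n - x * coeff r 0)
        = (\<alpha> * b) ^ (e + n) - x * (\<alpha> ^ n * b ^ e * coeff r 0)"
      by (simp add: power_mult_distrib power_add algebra_simps)
    finally show ?thesis using powT[of n e] coT[OF r(1)] subring_closed(4)[OF T(1)] by blast
  qed
  moreover have "\<alpha> * b \<in> T - J" using subring_closed(4)[OF T(1)] \<alpha> b prime[OF \<alpha>(2) bR] by blast
  ultimately show ?thesis unfolding almost_field_def by blast
qed

end

lemma hull_subring: "is_subring (is_subring hull X)"
proof (rule hull_in)
  show "is_subring (\<Inter>T)" if "Ball T is_subring" for T :: "'a set set"
    using that unfolding is_subring_def by blast
qed

lemma hull_insert_subring: "is_subring hull (insert s X) = adjunction (is_subring hull X) s"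
proof (rule hull_unique)
  have "X \<subseteq> is_subring hull X" by (rule hull_subset)
  then show "insert s X \<subseteq> adjunction (is_subring hull X) s"
    using subset_adjunction[OF hull_subring] mem_adjunction[OF hull_subring] by blast
  show "is_subring (adjunction (is_subring hull X) s)" by (rule adjunction_subring[OF hull_subring])
  show "adjunction (is_subring hull X) s \<subseteq> S" if "insert s X \<subseteq> S" "is_subring S" for S
    using that by (intro adjunction_least hull_minimal) auto
qed

lemma almost_field_descend_finite:
  assumes R: "is_subring R" "is_prime_ideal R J" and "finite S" "X \<union> S \<subseteq> R"
    and "almost_field J (is_subring hull (X \<union> S))"
  shows "almost_field J (is_subring hull X)"
  using assms(3-5)
proof (induction S rule: finite_induct)
  case (insert s S)
  have "is_subring hull (X \<union> S) \<subseteq> R" using insert.prems(1) R(1) by (intro hull_minimal) auto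
  moreover have "X \<union> insert s S = insert s (X \<union> S)" by simp
  ultimately have "almost_field J (is_subring hull (X \<union> S))"
    using almost_field_descend[OF R hull_subring, of "X \<union> S" s] insert.prems hull_insert_subring[of s "X \<union> S"] by simp
  then show ?case using insert by simp
qed simp

context alg_closed_base
begin

text \<open>The field \<open>R / J\<close> is finitely generated over the ring generated by \<open>z\<close>. Hence the latter is almost a field, so
  \<open>z\<close> is algebraic over \<open>k\<close> modulo \<open>J\<close>.\<close>

theorem zariski_lemma:
  assumes R: "R = is_subring hull (range \<iota> \<union> S)" "finite S" and J: "maximal_ideal R J" and z: "z \<in> R"
  shows "\<exists>c. z - \<iota> c \<in> J"
proof -
  have subR: "is_subring R" using R(1) hull_subring by simp
  have prime: "is_prime_ideal R J" using maximal_is_prime[OF subR J] .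
  have gens: "range \<iota> \<union> S \<subseteq> R" unfolding R(1) by (rule hull_subset)
  have field: "almost_field J R"
    unfolding almost_field_def
  proof (rule bexI[of _ 1], rule ballI)
    show "1 \<in> R - J" using subring_closed(2)[OF subR] prime_idealD(2)[OF prime] by blast
    show "\<exists>y\<in>R. \<exists>n. 1 ^ n - x * y \<in> J" if "x \<in> R - J" for x
      using J that by (auto simp: maximal_ideal_def)
  qed
  have hz: "is_subring hull (insert z (range \<iota>)) = adjunction (range \<iota>) z"
    using hull_insert_subring[of z "range \<iota>"] range_iota_subring by (simp add: hull_same)
  have "is_subring hull (insert z (range \<iota>) \<union> S) = R"
  proof (rule hull_unique)
    show "R \<subseteq> T" if "insert z (range \<iota>) \<union> S \<subseteq> T" "is_subring T" for T
      unfolding R(1) using that by (intro hull_minimal) auto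
  qed (use gens z subR in auto)
  then have "almost_field J (is_subring hull (insert z (range \<iota>)))"
    using almost_field_descend_finite[OF subR prime R(2), of "insert z (range \<iota>)"] field gens z by auto
  then obtain f where f: "coeffs_in (range \<iota>) f" "lead_coeff f \<notin> J" "poly f z \<in> J"
    using almost_field_algebraic[OF subR prime range_iota_subring _ z] gens unfolding hz by blast
  then obtain h where h: "f = map_poly \<iota> h" using coeffs_in_range_iota by blast
  note J' = is_idealD[OF subR prime_idealD(1)[OF prime]]
  have "h \<noteq> 0" using f(2) h J'(2) by auto
  then show ?thesis using f(3) unfolding h
  proof (induction "degree h" arbitrary: h)
    case 0
    then obtain c where c: "h = [:c:]" by (metis degree_eq_zeroE)
    then have "\<iota> c \<in> J" "c \<noteq> 0" using 0 by (auto simp: map_poly_pCons)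
    moreover have "\<iota> (inverse c) \<in> R" using gens by blast
    ultimately have "\<iota> (inverse c) * \<iota> c \<in> J" using J'(4) by blast
    then have "1 \<in> J" using \<open>c \<noteq> 0\<close> by (simp flip: iota_mult)
    then show ?case using prime_idealD(2)[OF prime] by blast
  next
    case (Suc n)
    then obtain c where "poly h c = 0" using alg_closed_imp_poly_has_root[of h] by auto
    then obtain q where q: "h = [:- c, 1:] * q" by (meson dvdE poly_eq_0_iff_dvd)
    have "q \<noteq> 0" using q Suc by auto
    have deg: "degree q = n" using Suc(2) q \<open>q \<noteq> 0\<close> by (simp add: degree_mult_eq del: mult_pCons_left)
    have "(z - \<iota> c) * ev q z \<in> J"
      using Suc(4) unfolding q ev_mult by (simp add: iota_minus)
    moreover have "z - \<iota> c \<in> R" using subring_closed(3)[OF subR z] gens by blast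
    moreover have "ev q z \<in> R"
      using gens by (intro poly_in_subring[OF subR _ z]) (auto simp: coeffs_in_def coeff_map_poly)
    ultimately consider "z - \<iota> c \<in> J" | "ev q z \<in> J" using prime_idealD(3)[OF prime] by blast
    then show ?case using Suc(1)[OF deg[symmetric]] \<open>q \<noteq> 0\<close> by cases auto
  qed
qed

end

section \<open>The points of a complete curve\<close>

context alg_closed_base
begin

lemma localization:
  assumes A: "is_subring A" "range \<iota> \<subseteq> A" and p: "is_prime_ideal A p"
  shows "A \<subseteq> localization_at A p" "local_subring (localization_at A p)"
    "max_ideal (localization_at A p) = {x / s | x s. x \<in> p \<and> s \<in> A - p}"
    "max_ideal (localization_at A p) \<inter> A = p"
proof -
  note A' = subring_closed[OF A(1)] and p' = is_idealD[OF A(1) prime_idealD(1)[OF p]]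
    and one = prime_idealD(2)[OF p] and prime = prime_idealD(3)[OF p]
  have s0: "s \<noteq> 0" if "s \<in> A - p" for s using that p'(2) by auto
  have st: "s * t \<in> A - p" if "s \<in> A - p" "t \<in> A - p" for s t
    using that A'(4) prime by blast
  have mem: "a / s \<in> localization_at A p" if "a \<in> A" "s \<in> A - p" for a s
    using that by (auto simp: localization_at_def)
  have memE: "\<exists>a s. x = a / s \<and> a \<in> A \<and> s \<in> A - p" if "x \<in> localization_at A p" for x
    using that by (auto simp: localization_at_def)
  show incl: "A \<subseteq> localization_at A p" using mem[of _ 1] A'(2) one by auto
  have sub: "is_subring (localization_at A p)"
    unfolding is_subring_def
  proof (intro conjI ballI)
    show "1 \<in> localization_at A p" using incl A'(2) by blast
    fix x y assume "x \<in> localization_at A p" "y \<in> localization_at A p"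
    then obtain a s b t where x: "x = a / s" "a \<in> A" "s \<in> A - p" and y: "y = b / t" "b \<in> A" "t \<in> A - p"
      using memE by blast
    have "x - y = (a * t - b * s) / (s * t)" using x y s0 by (simp add: diff_frac_eq)
    moreover have "a * t - b * s \<in> A" using x y A'(3,4) by simp
    ultimately show "x - y \<in> localization_at A p" using mem[OF _ st[OF x(3) y(3)]] by metis
    have "x * y = (a * b) / (s * t)" using x y by simp
    then show "x * y \<in> localization_at A p" using mem[OF A'(4)[OF x(2) y(2)] st[OF x(3) y(3)]] by simp
  qed
  show max: "max_ideal (localization_at A p) = {x / s | x s. x \<in> p \<and> s \<in> A - p}"
  proof (intro antisym subsetI)
    fix x assume x: "x \<in> max_ideal (localization_at A p)"
    then obtain a s where as: "x = a / s" "a \<in> A" "s \<in> A - p" using memE max_ideal_subset by blast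
    have "a \<in> p"
    proof (rule ccontr)
      assume "a \<notin> p"
      then have "a \<noteq> 0" "s / a \<in> localization_at A p" using p'(2) as mem by auto
      then show False using x as s0 by (auto simp: max_ideal_def)
    qed
    then show "x \<in> {x / s | x s. x \<in> p \<and> s \<in> A - p}" using as by blast
  next
    fix x assume "x \<in> {x / s | x s. x \<in> p \<and> s \<in> A - p}"
    then obtain a s where as: "x = a / s" "a \<in> p" "s \<in> A - p" by blast
    have "inverse x \<notin> localization_at A p" if "x \<noteq> 0"
    proof
      assume "inverse x \<in> localization_at A p"
      then obtain b t where bt: "inverse x = b / t" "b \<in> A" "t \<in> A - p" using memE by blast
      have "a \<noteq> 0" using that as(1) by auto
      have "s / a = b / t" using bt(1) as(1) by (simp add: inverse_divide)
      then have "s * t = b * a" using \<open>a \<noteq> 0\<close> s0[OF bt(3)] by (simp add: frac_eq_eq)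
      then have "s * t \<in> p" using p'(4)[OF bt(2) as(2)] by simp
      then show False using st[OF as(3) bt(3)] by blast
    qed
    moreover have "x \<in> localization_at A p" using as mem p'(1) by blast
    ultimately show "x \<in> max_ideal (localization_at A p)" by (auto simp: max_ideal_def)
  qed
  show "max_ideal (localization_at A p) \<inter> A = p"
  proof (intro antisym subsetI)
    fix x assume x: "x \<in> max_ideal (localization_at A p) \<inter> A"
    then obtain a s where as: "x = a / s" "a \<in> p" "s \<in> A - p" unfolding max by blast
    then have "x * s \<in> p" using s0 by simp
    then show "x \<in> p" using prime[of x s] x as by blast
  next
    fix x assume x: "x \<in> p"
    have "x = x / 1" by simp
    then have "x \<in> max_ideal (localization_at A p)" unfolding max using x A'(2) one by blast
    then show "x \<in> max_ideal (localization_at A p) \<inter> A" using p'(1)[OF x] by blast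
  qed
  have "x + y \<in> max_ideal (localization_at A p)"
    if xy: "x \<in> max_ideal (localization_at A p)" "y \<in> max_ideal (localization_at A p)" for x y
  proof -
    obtain a s b t where x: "x = a / s" "a \<in> p" "s \<in> A - p" and y: "y = b / t" "b \<in> p" "t \<in> A - p"
      using xy unfolding max by blast
    have "x + y = (a * t + b * s) / (s * t)" using x y s0 by (simp add: add_frac_eq)
    moreover have "t * a + s * b \<in> p" using x y p'(3,4) by blast
    ultimately show ?thesis unfolding max using st[OF x(3) y(3)] by (auto simp: mult.commute)
  qed
  then show "local_subring (localization_at A p)"
    using sub incl A(2) by (auto simp: local_subring_def)
qed

lemma dominates_trans:
  assumes "dominates V Q" "dominates Q P" shows "dominates V P"
  using assms unfolding dominates_def by blast

lemma place_dominates: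
  assumes P: "rational P" and V: "place V" "max_ideal P \<subseteq> max_ideal V"
  shows "dominates V P"
proof -
  note V' = local_subringD[OF place_local[OF V(1)]]
  have "P \<subseteq> V"
  proof
    fix x assume "x \<in> P"
    then obtain c where "x - \<iota> c \<in> max_ideal P" using P by (auto simp: rational_def)
    then have "x - \<iota> c \<in> V" using V(2) max_ideal_subset by blast
    then have "(x - \<iota> c) + \<iota> c \<in> V" using subring_closed(6)[OF V'(1)] V'(2) by blast
    then show "x \<in> V" by simp
  qed
  moreover have "x \<in> max_ideal P" if "x \<in> max_ideal V" "x \<in> P" for x
    using that \<open>P \<subseteq> V\<close> by (auto simp: max_ideal_def)
  ultimately show ?thesis using V(2) max_ideal_subset unfolding dominates_def by blast
qed

lemma max_ideal_nonunital:
  assumes "rational P"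
  shows "nonunital_algebra (max_ideal P)" "unitization (max_ideal P) = P"
proof -
  note P' = local_subringD[OF rational_local[OF assms]]
  show "nonunital_algebra (max_ideal P)"
    unfolding nonunital_algebra_def using P'(4,6,9) max_ideal_subset by blast
  show "unitization (max_ideal P) = P"
  proof (intro antisym subsetI)
    fix x assume "x \<in> unitization (max_ideal P)"
    then show "x \<in> P" using P'(2) subring_closed(6)[OF P'(1)] max_ideal_subset
      unfolding unitization_def by blast
  next
    fix x assume "x \<in> P"
    then obtain c where "x - \<iota> c \<in> max_ideal P" using assms by (auto simp: rational_def)
    moreover have "x = \<iota> c + (x - \<iota> c)" by simp
    ultimately show "x \<in> unitization (max_ideal P)" unfolding unitization_def by blast
  qed
qed

lemma rational_dominating_place:
  assumes "rational P"
  obtains V where "place V" "dominates V P"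
  using place_extension[OF max_ideal_nonunital(1)[OF assms]] place_dominates[OF assms] by blast

lemma integral_in_place:
  assumes V: "place V" "P \<subseteq> V" and x: "x \<in> integral_closure P"
  shows "x \<in> V"
proof (rule ccontr)
  assume "x \<notin> V"
  note V' = local_subringD[OF place_local[OF V(1)]]
  have y: "inverse x \<in> max_ideal V" using \<open>x \<notin> V\<close> place_cases[OF V(1), of x] by (auto simp: max_ideal_def)
  have x0: "x \<noteq> 0" using \<open>x \<notin> V\<close> subring_closed(1)[OF V'(1)] by auto
  obtain p where p: "lead_coeff p = 1" "\<And>i. coeff p i \<in> P" "poly p x = 0"
    using x by (auto simp: integral_closure_def)
  define n where "n = degree p"
  have "0 = (\<Sum>i\<le>n. coeff p i * inverse x ^ (n - i))"
    using poly_reversed[of p n "inverse x"] x0 p(3) by (simp add: n_def)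
  also have "\<dots> = (\<Sum>i<n. coeff p i * inverse x ^ (n - i)) + 1"
    using p(1) by (simp add: lessThan_Suc_atMost[symmetric] n_def)
  finally have eq: "1 = - (\<Sum>i<n. coeff p i * inverse x ^ (n - i))" by (metis add_eq_0_iff)
  have "coeff p i * inverse x ^ (n - i) \<in> max_ideal V" if i: "i < n" for i
  proof -
    obtain m where m: "n - i = Suc m" using i by (metis Suc_diff_Suc)
    have "coeff p i * inverse x ^ m \<in> V"
      using p(2) V(2) y max_ideal_subset subring_closed(4)[OF V'(1)] subring_power[OF V'(1)] by blast
    then show ?thesis using V'(4)[OF _ y] unfolding m power_Suc2 mult.assoc[symmetric] by blast
  qed
  then have "(\<Sum>i<n. coeff p i * inverse x ^ (n - i)) \<in> max_ideal V"
    by (intro subspace_sum[OF V'(9)]) simp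
  then have "1 \<in> max_ideal V" using eq subspace_closed(5)[OF V'(9)] by metis
  then show False using V'(6) by simp
qed

text \<open>If \<open>x\<close> is not integral over \<open>P\<close>, then the maximal ideal of \<open>P\<close> and \<open>inverse x\<close> generate a proper ideal of
  \<open>P[inverse x]\<close>, and there is a place above \<open>P\<close> at which \<open>x\<close> is infinite.\<close>

lemma not_integral_place:
  assumes P: "rational P" and x: "x \<notin> integral_closure P"
  obtains V where "place V" "dominates V P" "x \<notin> V"
proof -
  note P' = local_subringD[OF rational_local[OF P]]
  note m = max_ideal_nonunital[OF P]
  have x0: "x \<noteq> 0"
  proof
    assume "x = 0"
    then have "x \<in> integral_closure P" unfolding integral_closure_def
      using subring_closed(1,2)[OF P'(1)]
      by (intro CollectI exI[of _ "[:0, 1:]"]) (auto simp: coeff_pCons split: nat.splits)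
    then show False using x by simp
  qed
  have proper: "1 \<notin> adjoin_at (max_ideal P) (inverse x) 0"
  proof
    assume "1 \<in> adjoin_at (max_ideal P) (inverse x) 0"
    then obtain q where q: "poly q (inverse x) = 1" "coeffs_in P q" "coeff q 0 \<in> max_ideal P"
      unfolding adjoin_at_def m(2) by (auto simp: poly_0_coeff_0)
    define n where "n = degree q"
    define v where "v = inverse (1 - coeff q 0)"
    have n: "n > 0"
    proof (rule ccontr)
      assume "\<not> n > 0"
      then obtain a where "q = [:a:]" using degree_eq_zeroE n_def by auto
      then show False using q(1,3) P'(6) by simp
    qed
    have v: "1 - coeff q 0 \<noteq> 0" "v \<in> P"
    proof -
      have "1 - coeff q 0 \<in> P" using subring_closed(2,3)[OF P'(1)] q(2) by (simp add: coeffs_in_def)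
      moreover have "1 - coeff q 0 \<notin> max_ideal P" using P'(3)[OF _ q(3), of "1 - coeff q 0"] P'(6) by auto
      ultimately show "1 - coeff q 0 \<noteq> 0" "v \<in> P" using unit_inverse unfolding v_def by blast+
    qed
    have xn: "x ^ n = (\<Sum>i=1..n. v * coeff q i * x ^ (n - i))"
      unfolding v_def using n_def by (intro power_from_inverse_relation x0 q(1) v(1)) simp
    define r where "r = (\<Sum>i=1..n. monom (v * coeff q i) (n - i))"
    have r: "degree r < n"
    proof -
      have "degree r \<le> n - 1" unfolding r_def
        by (intro degree_sum_le) (auto intro: order.trans[OF degree_monom_le])
      then show ?thesis using n by simp
    qed
    have rP: "coeffs_in P r" unfolding coeffs_in_def r_def coeff_sum
      using v(2) q(2) subring_closed[OF P'(1)]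
      by (auto intro!: subring_sum[OF P'(1)] simp: coeffs_in_def)
    have "degree (monom 1 n - r) = n" "lead_coeff (monom 1 n - r) = 1"
    proof -
      have "degree (monom 1 n + - r) = degree (monom (1::'a) n)"
        by (rule degree_add_eq_left) (use r in \<open>simp add: degree_monom_eq\<close>)
      then show 1: "degree (monom 1 n - r) = n" by (simp add: degree_monom_eq)
      show "lead_coeff (monom 1 n - r) = 1" unfolding 1 using r by (simp add: coeff_eq_0)
    qed
    moreover have "coeffs_in P (monom 1 n - r)"
      by (intro coeffs_in_closed(3,7)[OF P'(1)] rP subring_closed(2)[OF P'(1)])
    moreover have "poly (monom 1 n - r) x = 0"
      unfolding r_def using xn by (simp add: poly_sum poly_monom sum_distrib_left mult.assoc)
    ultimately have "x \<in> integral_closure P" unfolding integral_closure_def coeffs_in_def by blast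
    then show False using x by simp
  qed
  note * = adjoin_at[OF m(1), of "inverse x" 0]
  obtain V where V: "place V" "adjoin_at (max_ideal P) (inverse x) 0 \<subseteq> max_ideal V"
    using place_extension[OF *(3)[OF proper]] by blast
  have "dominates V P" using place_dominates[OF P V(1)] V(2) *(1) by blast
  moreover have "x \<notin> V"
  proof
    assume "x \<in> V"
    moreover have "inverse x \<in> max_ideal V" using V(2) *(2) by auto
    ultimately show False using x0 by (auto simp: max_ideal_def)
  qed
  ultimately show thesis using that V(1) by blast
qed

text \<open>In particular, sums and products of integral elements are integral.\<close>

lemma integral_closure_places:
  assumes "rational P"
  shows "integral_closure P = \<Inter>{V. place V \<and> dominates V P}"
proof (intro antisym subsetI)
  fix x assume "x \<in> integral_closure P"
  then show "x \<in> \<Inter>{V. place V \<and> dominates V P}"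
    using integral_in_place[of _ P x] by (auto simp: dominates_def)
next
  fix x assume x: "x \<in> \<Inter>{V. place V \<and> dominates V P}"
  show "x \<in> integral_closure P"
  proof (rule ccontr)
    assume "x \<notin> integral_closure P"
    then obtain V where "place V" "dominates V P" "x \<notin> V" using not_integral_place[OF assms] by blast
    then show False using x by blast
  qed
qed

lemma subset_integral_closure: "is_subring P \<Longrightarrow> P \<subseteq> integral_closure P"
  unfolding integral_closure_def
  by (intro subsetI CollectI exI[of _ "[:- _, 1:]"]) (auto simp: coeff_pCons subring_closed(1,2,5) split: nat.splits)

lemma integral_closure_subring:
  assumes "rational P"
  shows "is_subring (integral_closure P)"
  unfolding integral_closure_places[OF assms]
  using local_subringD(1)[OF place_local] by (auto simp: is_subring_def)

end

locale complete_curve =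
  fixes \<iota> :: "'k::alg_closed_field \<Rightarrow> 'a::field" and C :: "'a set set"
  assumes complete_integral_curve: "complete_integral_curve \<iota> C"

sublocale complete_curve \<subseteq> alg_closed_base
  using complete_integral_curve by unfold_locales (simp add: complete_integral_curve_def)

context complete_curve
begin

lemma affine_cover:
  obtains \<A> where "\<And>A. A \<in> \<A> \<Longrightarrow> affine_domain \<iota> A" "C = (\<Union>A\<in>\<A>. local_rings A)"
  using complete_integral_curve unfolding complete_integral_curve_def integral_scheme_def by blast

lemma affine_domainD:
  assumes "affine_domain \<iota> A"
  obtains S where "finite S" "A = is_subring hull (range \<iota> \<union> S)" "is_subring A" "range \<iota> \<subseteq> A"
proof -
  obtain S where S: "finite S" "A = is_subring hull (range \<iota> \<union> S)"
    using assms by (auto simp: affine_domain_def)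
  have "range \<iota> \<union> S \<subseteq> A" unfolding S(2) by (rule hull_subset)
  moreover have "is_subring A" unfolding S(2) by (rule hull_subring)
  ultimately show thesis using that[OF S] by blast
qed

lemma pointE:
  assumes "P \<in> C"
  obtains A p where "affine_domain \<iota> A" "local_rings A \<subseteq> C" "is_prime_ideal A p" "P = localization_at A p"
proof -
  obtain \<A> where \<A>: "\<And>A. A \<in> \<A> \<Longrightarrow> affine_domain \<iota> A" "C = (\<Union>A\<in>\<A>. local_rings A)"
    using affine_cover by blast
  then obtain A where "A \<in> \<A>" "P \<in> local_rings A" using assms by blast
  then show thesis using that[of A] \<A> unfolding local_rings_def by blast
qed

lemma point_local: "P \<in> C \<Longrightarrow> local_subring P"
  using pointE[of P] affine_domainD localization(2) by metis

lemma closed_pointD: "P \<in> closed_points C \<Longrightarrow> P \<in> C" "P \<in> closed_points C \<Longrightarrow> P \<noteq> UNIV"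
  by (auto simp: closed_points_def)

lemma closed_point_exists: obtains P where "P \<in> closed_points C"
  using complete_integral_curve unfolding complete_integral_curve_def one_dimensional_def closed_points_def
  by blast

lemma transcendental_exists: obtains x where "x \<notin> range \<iota>"
proof -
  obtain P where P: "P \<in> closed_points C" using closed_point_exists .
  have "range \<iota> \<subseteq> P" using point_local[OF closed_pointD(1)[OF P]] by (simp add: local_subring_def)
  then have "range \<iota> \<noteq> UNIV" using closed_pointD(2)[OF P] by blast
  then show thesis using that by blast
qed

lemma place_neq_UNIV: "place V \<Longrightarrow> V \<noteq> UNIV"
  using transcendental_exists rational_neq_UNIV unfolding place_def by blast

lemma specialization_closed:
  assumes "P \<in> C" "Q \<in> C" "P \<subset> Q" shows "Q = UNIV"
  using complete_integral_curve assms unfolding complete_integral_curve_def one_dimensional_def by blast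

text \<open>By Zariski's lemma: the prime ideal that defines them is maximal
  because there are no longer chains of specializations.\<close>

lemma closed_point_rational:
  assumes P: "P \<in> closed_points C" shows "rational P"
proof -
  obtain A p where A: "affine_domain \<iota> A" "local_rings A \<subseteq> C" and p: "is_prime_ideal A p" "P = localization_at A p"
    using pointE[OF closed_pointD(1)[OF P]] .
  obtain S where S: "finite S" "A = is_subring hull (range \<iota> \<union> S)" "is_subring A" "range \<iota> \<subseteq> A"
    using affine_domainD[OF A(1)] .
  note loc = localization[OF S(3,4) p(1), folded p(2)]
  obtain J where J: "maximal_ideal A J" "p \<subseteq> J"
    using maximal_ideal_exists[OF S(3) prime_idealD(1,2)[OF p(1)]] .
  have Jp: "is_prime_ideal A J" using maximal_is_prime[OF S(3) J(1)] .
  have "J = p"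
  proof (rule ccontr)
    assume "J \<noteq> p"
    then obtain a where a: "a \<in> J" "a \<notin> p" using J(2) by blast
    let ?M = "localization_at A J"
    note locJ = localization[OF S(3,4) Jp]
    have "?M \<in> C" using A(2) Jp unfolding local_rings_def by blast
    moreover have "?M \<subseteq> P" unfolding p(2) localization_at_def using J(2) by blast
    moreover have "?M \<noteq> P"
    proof
      assume "?M = P"
      then have "J = p" using locJ(4) loc(4) by simp
      then show False using \<open>J \<noteq> p\<close> by simp
    qed
    ultimately have "P = UNIV" using specialization_closed closed_pointD(1)[OF P] by blast
    then show False using closed_pointD(2)[OF P] by simp
  qed
  then have max: "maximal_ideal A p" using J(1) by simp
  note P' = local_subringD[OF loc(2)]
  have res: "\<exists>c. a - \<iota> c \<in> max_ideal P" if "a \<in> A" for a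
    using zariski_lemma[OF S(2,1) max that] loc(4) by blast
  have "\<exists>c. x - \<iota> c \<in> max_ideal P" if "x \<in> P" for x
  proof -
    obtain a s where as: "x = a / s" "a \<in> A" "s \<in> A - p"
      using \<open>x \<in> P\<close> unfolding p(2) localization_at_def by blast
    obtain c d where cd: "a - \<iota> c \<in> max_ideal P" "s - \<iota> d \<in> max_ideal P" using res as by blast
    have sP: "s \<in> P" "s \<notin> max_ideal P" using as loc(1,4) by auto
    then have sinv: "inverse s \<in> P" "s \<noteq> 0" using unit_inverse by auto
    have "d \<noteq> 0" using cd(2) sP(2) by auto
    then have d: "\<iota> d \<noteq> 0" by simp
    have "inverse s * ((a - \<iota> c) - \<iota> (c / d) * (s - \<iota> d)) \<in> max_ideal P"
      using P'(4)[OF sinv(1) P'(7)[OF cd(1) P'(4)[OF P'(2) cd(2)]]] .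
    also have "inverse s * ((a - \<iota> c) - \<iota> (c / d) * (s - \<iota> d)) = x - \<iota> (c / d)"
      using d sinv(2) unfolding as(1) iota_divide by (simp add: field_simps)
    finally show ?thesis by blast
  qed
  then show ?thesis using loc(2) by (simp add: rational_def)
qed

text \<open>By the valuative criterion of completeness, places of the function field give closed points.\<close>

lemma center_exists:
  assumes "place V" obtains P where "P \<in> closed_points C" "dominates V P"
proof -
  obtain P where P: "P \<in> C" "dominates V P"
    using complete_integral_curve assms unfolding complete_integral_curve_def complete_scheme_def place_def by blast
  then have "P \<noteq> UNIV" using place_neq_UNIV[OF assms] unfolding dominates_def by blast
  then show thesis using that P by (auto simp: closed_points_def)
qed

lemma center_unique:
  assumes "place V" "P \<in> C" "Q \<in> C" "dominates V P" "dominates V Q" shows "P = Q"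
  using complete_integral_curve assms unfolding complete_integral_curve_def integral_scheme_def place_def
  by metis

lemma fraction_at_point:
  assumes "P \<in> C" obtains a b where "a \<in> P" "b \<in> P" "b \<noteq> 0" "x = a / b"
proof -
  obtain A p where A: "affine_domain \<iota> A" "is_prime_ideal A p" "P = localization_at A p"
    using pointE[OF assms] by metis
  have "A \<subseteq> P" using affine_domainD[OF A(1)] localization(1) A(2,3) by metis
  then show thesis using A(1) that unfolding affine_domain_def by blast
qed

lemma max_ideal_nonzero:
  assumes "P \<in> closed_points C" obtains x where "x \<in> max_ideal P" "x \<noteq> 0"
proof (rule ccontr)
  assume none: "\<not> thesis"
  note found = that
  have "y \<in> P" for y
  proof -
    obtain a b where ab: "a \<in> P" "b \<in> P" "b \<noteq> 0" "y = a / b"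
      using fraction_at_point[OF closed_pointD(1)[OF assms]] .
    then have "inverse b \<in> P" using unit_inverse none found by blast
    then show ?thesis using ab subring_closed(4)[OF local_subringD(1)[OF point_local[OF closed_pointD(1)[OF assms]]]]
      by (simp add: divide_inverse)
  qed
  then show False using closed_pointD(2)[OF assms] by blast
qed

text \<open>Write \<open>h = a / b\<close> with \<open>a\<close> and \<open>b\<close> in an affine coordinate ring \<open>A\<close>, and let \<open>E\<close> be a nonzero element of \<open>A\<close>
  that vanishes at all those points of \<open>T\<close> that lie in \<open>Spec A\<close>. A maximal ideal of \<open>A[1 / (E * a * b)]\<close>
  gives the point. By Zariski's lemma it cannot be 0, so that the point is not the generic one.\<close>

lemma unit_at_some_point:
  assumes T: "finite T" "T \<subseteq> closed_points C" and h: "h \<noteq> 0"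
  obtains P where "P \<in> closed_points C" "P \<notin> T" "h \<in> P" "h \<notin> max_ideal P"
proof -
  obtain P0 where "P0 \<in> closed_points C" using closed_point_exists .
  then obtain A where A: "affine_domain \<iota> A" "local_rings A \<subseteq> C" using pointE closed_pointD(1) by metis
  obtain S where S: "finite S" "A = is_subring hull (range \<iota> \<union> S)" "is_subring A" "range \<iota> \<subseteq> A"
    using affine_domainD[OF A(1)] .
  note A' = subring_closed[OF S(3)]
  have frac: "\<exists>a\<in>A. \<exists>b\<in>A. b \<noteq> 0 \<and> x = a / b" for x using A(1) by (simp add: affine_domain_def)
  have "\<exists>e\<in>A. e \<noteq> 0 \<and> (A \<subseteq> P \<longrightarrow> e \<in> max_ideal P)" if "P \<in> T" for P
  proof (cases "A \<subseteq> P")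
    case True
    have P: "P \<in> closed_points C" using that T(2) by blast
    obtain x where x: "x \<in> max_ideal P" "x \<noteq> 0" using max_ideal_nonzero[OF P] .
    obtain a b where ab: "a \<in> A" "b \<in> A" "b \<noteq> 0" "x = a / b" using frac by blast
    have "b * x \<in> max_ideal P"
      using local_subringD(4)[OF point_local[OF closed_pointD(1)[OF P]]] True ab x by blast
    then show ?thesis using ab x by (intro bexI[of _ a]) auto
  next
    case False
    then show ?thesis using A'(2) by (intro bexI[of _ 1]) auto
  qed
  then obtain e where e: "\<And>P. P \<in> T \<Longrightarrow> e P \<in> A" "\<And>P. P \<in> T \<Longrightarrow> e P \<noteq> 0"
    "\<And>P. P \<in> T \<Longrightarrow> A \<subseteq> P \<Longrightarrow> e P \<in> max_ideal P" by metis
  define E where "E = prod e T"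
  have E: "E \<in> A" "E \<noteq> 0" unfolding E_def using e(1,2) T(1) subring_prod[OF S(3)] by auto
  obtain a b where ab: "a \<in> A" "b \<in> A" "b \<noteq> 0" "h = a / b" using frac by blast
  have a0: "a \<noteq> 0" using h ab by auto
  define d where "d = E * (a * b)"
  have d: "d \<in> A" "d \<noteq> 0" unfolding d_def using E ab a0 A'(4) by auto
  define B where "B = adjunction A (inverse d)"
  have B: "B = is_subring hull (range \<iota> \<union> insert (inverse d) S)"
    using hull_insert_subring[of "inverse d" "range \<iota> \<union> S"] unfolding B_def S(2) by simp
  have subB: "is_subring B" unfolding B_def by (rule adjunction_subring[OF S(3)])
  note B' = subring_closed[OF subB]
  have AB: "A \<subseteq> B" "inverse d \<in> B" unfolding B_def using subset_adjunction[OF S(3)] mem_adjunction[OF S(3)] by auto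
  have "is_ideal B {0}" using B'(1) by (simp add: is_ideal_def)
  then obtain N where N: "maximal_ideal B N" using maximal_ideal_exists[OF subB, of "{0}"] by auto
  have Np: "is_prime_ideal B N" using maximal_is_prime[OF subB N] .
  note N' = is_idealD[OF subB prime_idealD(1)[OF Np]]
  have res: "\<exists>c. z - \<iota> c \<in> N" if "z \<in> B" for z using zariski_lemma[OF B _ N that] S(1) by simp
  define p where "p = N \<inter> A"
  have p: "is_prime_ideal A p"
    unfolding is_prime_ideal_def p_def
    using N' prime_idealD(2,3)[OF Np] A' AB by (auto simp: subset_iff)
  have dN: "d \<notin> N"
  proof
    assume "d \<in> N"
    then have "inverse d * d \<in> N" using N'(4) AB(2) by blast
    then show False using prime_idealD(2)[OF Np] d(2) by simp
  qed
  have p': "is_ideal A p" using prime_idealD(1)[OF p] .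
  have notp: "E \<notin> p" "a \<notin> p" "b \<notin> p"
  proof -
    note I = is_idealD(4)[OF S(3) p']
    have dp: "d \<notin> p" using dN by (simp add: p_def)
    have "a * b * E = d" "(E * b) * a = d" "(E * a) * b = d" by (auto simp: d_def)
    then show "E \<notin> p" "a \<notin> p" "b \<notin> p" using I A'(4) E(1) ab dp by metis+
  qed
  define M where "M = localization_at A p"
  note M = localization[OF S(3,4) p, folded M_def]
  have MC: "M \<in> C" using A(2) p unfolding local_rings_def M_def by blast
  have hM: "h \<in> M" "inverse h \<in> M"
    unfolding M_def localization_at_def ab(4) using ab notp by (auto simp: inverse_divide)
  have "M \<noteq> UNIV"
  proof
    assume "M = UNIV"
    then have p0: "p = {0}" using M(4) A'(1) by (auto simp: max_ideal_def)
    have clear: "\<exists>k. d ^ k * z \<in> A" if "z \<in> B" for z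
    proof -
      obtain q where "z = poly q (inverse d)" "coeffs_in A q" using \<open>z \<in> B\<close> by (auto simp: B_def adjunction_def)
      moreover have "coeffs_in A q \<Longrightarrow> \<exists>k. d ^ k * poly q (inverse d) \<in> A"
      proof (induction q)
        case (pCons c q)
        then obtain k where k: "d ^ k * poly q (inverse d) \<in> A" by auto
        have "d ^ Suc k * poly (pCons c q) (inverse d) = d ^ Suc k * c + d ^ k * poly q (inverse d)"
          using d(2) by (simp add: algebra_simps)
        also have "\<dots> \<in> A"
          by (intro A'(6) A'(4) subring_power[OF S(3) d(1)] k) (use pCons.prems in simp)
        finally show ?case by blast
      qed (use A'(1) in auto)
      ultimately show ?thesis by simp
    qed
    have "N \<subseteq> {0}"
    proof
      fix z assume z: "z \<in> N"
      then obtain k where k: "d ^ k * z \<in> A" using clear N'(1) by blast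
      have "d ^ k \<in> B" using subring_power[OF subB] d(1) AB(1) by blast
      then have "d ^ k * z \<in> p" using N'(4) z k by (simp add: p_def)
      then show "z \<in> {0}" using p0 d(2) by simp
    qed
    have BK: "B \<subseteq> range \<iota>"
    proof
      fix z assume "z \<in> B"
      then obtain c where "z - \<iota> c \<in> N" using res by blast
      then have "z = \<iota> c" using \<open>N \<subseteq> {0}\<close> by auto
      then show "z \<in> range \<iota>" by blast
    qed
    obtain x where x: "x \<notin> range \<iota>" using transcendental_exists .
    obtain y z where "y \<in> A" "z \<in> A" "x = y / z" using frac[of x] by blast
    moreover have "A \<subseteq> range \<iota>" using AB(1) BK by (rule subset_trans)
    ultimately obtain c c' where "x = \<iota> c / \<iota> c'" by blast
    then have "x = \<iota> (c / c')" by (simp add: iota_divide)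
    then show False using x by blast
  qed
  moreover have "M \<notin> T"
  proof
    assume MT: "M \<in> T"
    have "prod e (T - {M}) \<in> A" by (rule subring_prod[OF S(3)]) (use e(1) in blast)
    then have "prod e (T - {M}) * e M \<in> max_ideal M"
      using local_subringD(4)[OF M(2) _ e(3)[OF MT M(1)]] M(1) by blast
    moreover have "E = prod e (T - {M}) * e M"
      unfolding E_def using prod.remove[OF T(1) MT, of e] by (simp only: mult.commute)
    ultimately have "E \<in> max_ideal M" by (simp only:)
    then show False using M(4) E(1) notp(1) by blast
  qed
  moreover have "h \<notin> max_ideal M" using hM h by (auto simp: max_ideal_def)
  ultimately show thesis using that[of M] MC hM by (auto simp: closed_points_def)
qed

subsection \<open>The normalization\<close>

lemma normalization_local:
  assumes "Q \<in> normalization C" shows "local_subring Q"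
proof -
  obtain P where P: "P \<in> C" "Q \<in> local_rings (integral_closure P)"
    using assms by (auto simp: normalization_def)
  have "is_subring (integral_closure P) \<and> range \<iota> \<subseteq> integral_closure P"
  proof (cases "P = UNIV")
    case True
    have "is_subring (UNIV :: 'a set)" by (simp add: is_subring_def)
    then show ?thesis using True subset_integral_closure[of P] by (metis UNIV_I subsetI subset_antisym)
  next
    case False
    then have "rational P" using P(1) closed_point_rational by (auto simp: closed_points_def)
    then show ?thesis using integral_closure_subring subset_integral_closure[of P]
        local_subringD(1)[OF rational_local] point_local[OF P(1)] by (auto simp: local_subring_def)
  qed
  then show ?thesis using P(2) localization(2) unfolding local_rings_def by blast
qed

text \<open>Choose a place \<open>V\<close> above \<open>P\<close>. It contains the integral closure \<open>B\<close> of \<open>P\<close>, and \<open>Q\<close> is the localization of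
  \<open>B\<close> at the center of \<open>V\<close>. Any point of \<open>C\<close> that \<open>Q\<close> dominates is the center of \<open>V\<close> on \<open>C\<close>, so it is \<open>P\<close>.\<close>

lemma point_of_normalization:
  assumes P: "P \<in> closed_points C"
  obtains Q where "Q \<in> closed_points (normalization C)" "rational Q" "dominates Q P" "normalization_map C Q = P"
proof -
  have rat: "rational P" using closed_point_rational[OF P] .
  obtain V where V: "place V" "dominates V P" using rational_dominating_place[OF rat] .
  note V' = local_subringD[OF place_local[OF V(1)]]
  define B where "B = integral_closure P"
  have subB: "is_subring B" unfolding B_def by (rule integral_closure_subring[OF rat])
  have PB: "P \<subseteq> B" unfolding B_def by (rule subset_integral_closure[OF local_subringD(1)[OF rational_local[OF rat]]])
  have BV: "B \<subseteq> V" unfolding B_def using integral_in_place[OF V(1)] V(2) by (auto simp: dominates_def)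
  have kB: "range \<iota> \<subseteq> B" using PB rat by (auto simp: rational_def local_subring_def)
  define q where "q = max_ideal V \<inter> B"
  have q: "is_prime_ideal B q"
    unfolding is_prime_ideal_def
  proof (intro conjI ballI impI)
    show "q \<subseteq> B" "0 \<in> q" "1 \<notin> q" using V'(5,6) subring_closed(1)[OF subB] by (auto simp: q_def)
    show "x + y \<in> q" if "x \<in> q" "y \<in> q" for x y
      using that V'(3) subring_closed(6)[OF subB] by (simp add: q_def)
    show "a * x \<in> q" if "a \<in> B" "x \<in> q" for a x
      using that V'(4) BV subring_closed(4)[OF subB] by (auto simp: q_def)
    show "x \<in> q \<or> y \<in> q" if xy: "x \<in> B" "y \<in> B" "x * y \<in> q" for x y
    proof (rule ccontr)
      assume "\<not> (x \<in> q \<or> y \<in> q)"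
      then have u: "x \<notin> max_ideal V" "y \<notin> max_ideal V" using xy by (auto simp: q_def)
      then have i: "inverse x \<in> V" "x \<noteq> 0" using unit_inverse BV xy by auto
      have "inverse x * (x * y) \<in> max_ideal V" using V'(4)[OF i(1)] xy by (auto simp: q_def)
      then show False using u i(2) by (simp add: mult.assoc[symmetric])
    qed
  qed
  define Q where "Q = localization_at B q"
  note loc = localization[OF subB kB q, folded Q_def]
  have inv: "inverse s \<in> V" if "s \<in> B - q" for s
    using that unit_inverse BV unfolding q_def by blast
  have QV: "Q \<subseteq> V"
  proof
    fix x assume "x \<in> Q"
    then obtain a s where "x = a / s" "a \<in> B" "s \<in> B - q" unfolding Q_def localization_at_def by blast
    then show "x \<in> V" using inv BV subring_closed(4)[OF V'(1)] by (auto simp: divide_inverse)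
  qed
  have domVQ: "dominates V Q"
    unfolding dominates_def
  proof (intro conjI QV antisym subsetI)
    fix x assume x: "x \<in> max_ideal V \<inter> Q"
    then show "x \<in> max_ideal Q" using QV by (auto simp: max_ideal_def)
  next
    fix x assume x: "x \<in> max_ideal Q"
    then obtain a s where as: "x = a / s" "a \<in> q" "s \<in> B - q" unfolding loc(3) by blast
    then have "inverse s * a \<in> max_ideal V" using V'(4)[OF inv] by (auto simp: q_def)
    then show "x \<in> max_ideal V \<inter> Q" using as x max_ideal_subset by (auto simp: divide_inverse mult.commute)
  qed
  have domQP: "dominates Q P"
    using V(2) domVQ PB loc(1) unfolding dominates_def by blast
  have ratQ: "rational Q"
    unfolding rational_def
  proof (intro conjI ballI loc(2))
    fix x assume x: "x \<in> Q"
    then obtain c where c: "x - \<iota> c \<in> max_ideal V" using QV V(1) unfolding place_def rational_def by blast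
    have "x - \<iota> c \<in> Q" using subring_closed(3)[OF local_subringD(1)[OF loc(2)] x local_subringD(2)[OF loc(2)]] .
    then show "\<exists>c. x - \<iota> c \<in> max_ideal Q" using c domVQ unfolding dominates_def by blast
  qed
  have "Q \<noteq> UNIV" using QV place_neq_UNIV[OF V(1)] by blast
  moreover have "Q \<in> normalization C"
    unfolding normalization_def local_rings_def Q_def B_def
    using closed_pointD(1)[OF P] q[unfolded B_def] by blast
  ultimately have "Q \<in> closed_points (normalization C)" by (simp add: closed_points_def)
  moreover have "normalization_map C Q = P"
    unfolding normalization_map_def
  proof (rule the_equality)
    show "P \<in> C \<and> dominates Q P" using closed_pointD(1)[OF P] domQP by blast
    fix P' assume "P' \<in> C \<and> dominates Q P'"
    then show "P' = P"
      using center_unique[OF V(1) _ closed_pointD(1)[OF P] _ V(2)] dominates_trans[OF domVQ] by blast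
  qed
  ultimately show thesis using that ratQ domQP by blast
qed

end

section \<open>Serre duality for fractional sheaves\<close>

lemma line_0 [simp]: "line x 0 = x" and line_Suc [simp]: "line x (Suc i) = 0"
  by (auto simp: line_def)

lemma line_eq_iff [simp]: "line x = line y \<longleftrightarrow> x = y"
  by (metis line_0)

lemma vecs_1_iff: "v \<in> vecs 1 \<longleftrightarrow> v = line (v 0)"
proof
  assume v: "v \<in> vecs 1"
  show "v = line (v 0)"
  proof
    fix i show "v i = line (v 0) i" using v by (cases i) (auto simp: vecs_def)
  qed
qed (auto simp: vecs_def line_def fun_eq_iff)

lemma line_in_vecs: "line x \<in> vecs 1" "line x \<in> vecs (Suc 0)"
  by (auto simp: vecs_def line_def)

lemma mem_rank1: "v \<in> vecs 1 \<Longrightarrow> v \<in> rank1 L P \<longleftrightarrow> v 0 \<in> L P"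
  unfolding vecs_1_iff rank1_def by (metis (no_types, lifting) image_iff line_0)

lemma rank1_subset_vecs: "rank1 L P \<subseteq> vecs 1"
  by (auto simp: rank1_def line_in_vecs)

definition module_span :: "'a::comm_ring_1 set \<Rightarrow> 'a set \<Rightarrow> 'a set" where
  "module_span R S = {\<Sum>s\<in>S. c s * s | c. \<forall>s\<in>S. c s \<in> R}"

context complete_curve
begin

text \<open>Fractional sheaves are handled with stalks and adeles in \<open>K\<close> instead of \<open>K\<^sup>1\<close>; this and the next
  definitions are the corresponding versions of \<open>torsion_free_coherent\<close>, \<open>adeles\<close>, \<open>H1_null\<close> and \<open>sheaf_hom\<close>.\<close>

definition coherent :: "('a set \<Rightarrow> 'a set) \<Rightarrow> bool" where
  "coherent L \<longleftrightarrow>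
     (\<forall>P\<in>closed_points C. (\<exists>S. finite S \<and> L P = module_span P S) \<and> (\<forall>x. \<exists>b\<in>P. b \<noteq> 0 \<and> b * x \<in> L P)) \<and>
     finite {P \<in> closed_points C. L P \<noteq> P}"

definition adele :: "('a set \<Rightarrow> 'a set) \<Rightarrow> ('a set \<Rightarrow> 'a) set" where
  "adele L = {\<xi>. finite {P \<in> closed_points C. \<xi> P \<notin> L P}}"

definition null :: "('a set \<Rightarrow> 'a set) \<Rightarrow> ('a set \<Rightarrow> 'a) set" where
  "null L = {\<xi>. \<exists>f. \<forall>P\<in>closed_points C. \<xi> P - f \<in> L P}"

definition hom :: "('a set \<Rightarrow> 'a set) \<Rightarrow> ('a set \<Rightarrow> 'a set) \<Rightarrow> 'a set" where
  "hom L M = {c. \<forall>P\<in>closed_points C. \<forall>x\<in>L P. c * x \<in> M P}"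

lemma closed_pointD':
  assumes "P \<in> closed_points C"
  shows "rational P" "local_subring P" "is_subring P"
  using closed_point_rational[OF assms] local_subringD(1) rational_local by blast+

lemma module_span_closed:
  assumes P: "is_subring P"
  shows "0 \<in> module_span P S"
    "x \<in> module_span P S \<Longrightarrow> y \<in> module_span P S \<Longrightarrow> x + y \<in> module_span P S"
    "a \<in> P \<Longrightarrow> x \<in> module_span P S \<Longrightarrow> a * x \<in> module_span P S"
    "finite S \<Longrightarrow> s \<in> S \<Longrightarrow> s \<in> module_span P S"
proof -
  note P' = subring_closed[OF P]
  show "0 \<in> module_span P S" unfolding module_span_def using P'(1) by (auto intro!: exI[of _ "\<lambda>_. 0"])
  show "x + y \<in> module_span P S" if xy: "x \<in> module_span P S" "y \<in> module_span P S"
  proof -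
    obtain c d where "x = (\<Sum>s\<in>S. c s * s)" "\<forall>s\<in>S. c s \<in> P" "y = (\<Sum>s\<in>S. d s * s)" "\<forall>s\<in>S. d s \<in> P"
      using xy by (auto simp: module_span_def)
    then have "x + y = (\<Sum>s\<in>S. (c s + d s) * s)" "\<forall>s\<in>S. c s + d s \<in> P"
      using P'(6) by (auto simp: distrib_right sum.distrib)
    then show ?thesis unfolding module_span_def by (intro CollectI exI[of _ "\<lambda>s. c s + d s"] conjI)
  qed
  show "a * x \<in> module_span P S" if ax: "a \<in> P" "x \<in> module_span P S"
  proof -
    obtain c where "x = (\<Sum>s\<in>S. c s * s)" "\<forall>s\<in>S. c s \<in> P" using ax by (auto simp: module_span_def)
    then have "a * x = (\<Sum>s\<in>S. (a * c s) * s)" "\<forall>s\<in>S. a * c s \<in> P"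
      using P'(4) ax(1) by (auto simp: sum_distrib_left mult.assoc)
    then show ?thesis unfolding module_span_def by (intro CollectI exI[of _ "\<lambda>s. a * c s"] conjI)
  qed
  show "s \<in> module_span P S" if s: "finite S" "s \<in> S"
  proof -
    have "(\<Sum>r\<in>S. (if r = s then 1 else 0) * r) = (\<Sum>r\<in>S. if r = s then r else 0)" by (rule sum.cong) auto
    also have "\<dots> = s" using s by simp
    finally have "s = (\<Sum>r\<in>S. (if r = s then 1 else 0) * r)" by simp
    then show ?thesis unfolding module_span_def using P'(1,2)
      by (intro CollectI exI[of _ "\<lambda>r. if r = s then 1 else 0"]) auto
  qed
qed

lemma coherent_subspace:
  assumes "coherent L" "P \<in> closed_points C" shows "subspace (L P)"
proof -
  obtain S where S: "L P = module_span P S" using assms by (auto simp: coherent_def)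
  note P = closed_pointD'[OF assms(2)]
  show ?thesis unfolding S
    using module_span_closed(1-3)[OF P(3)] local_subringD(2)[OF P(2)] by (intro subspaceI) auto
qed

lemma coherent_torsion_free:
  assumes "coherent L" shows "torsion_free_coherent C 1 (rank1 L)"
  unfolding torsion_free_coherent_def
proof (intro conjI ballI)
  fix P assume P: "P \<in> closed_points C"
  obtain S where S: "finite S" "L P = module_span P S" using assms P by (auto simp: coherent_def)
  have "rank1 L P = {(\<lambda>i. \<Sum>s\<in>line ` S. c s * s i) | c. \<forall>s\<in>line ` S. c s \<in> P}" (is "_ = ?R")
  proof -
    have inj: "inj_on line S" by (auto simp: inj_on_def)
    have eq: "(\<lambda>i. \<Sum>s\<in>line ` S. c s * s i) = line (\<Sum>s\<in>S. c (line s) * s)" for c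
    proof
      fix i show "(\<Sum>s\<in>line ` S. c s * s i) = line (\<Sum>s\<in>S. c (line s) * s) i"
        by (cases i) (simp_all add: sum.reindex[OF inj])
    qed
    have "?R = {line (\<Sum>s\<in>S. c (line s) * s) | c. \<forall>s\<in>S. c (line s) \<in> P}" unfolding eq by simp
    also have "\<dots> = line ` module_span P S"
    proof (intro antisym subsetI)
      fix v assume "v \<in> {line (\<Sum>s\<in>S. c (line s) * s) | c. \<forall>s\<in>S. c (line s) \<in> P}"
      then obtain c where "v = line (\<Sum>s\<in>S. c (line s) * s)" "\<forall>s\<in>S. c (line s) \<in> P" by blast
      then show "v \<in> line ` module_span P S" unfolding module_span_def by (intro image_eqI) auto
    next
      fix v assume "v \<in> line ` module_span P S"
      then obtain c where "v = line (\<Sum>s\<in>S. c s * s)" "\<forall>s\<in>S. c s \<in> P" unfolding module_span_def by blast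
      then show "v \<in> {line (\<Sum>s\<in>S. c (line s) * s) | c. \<forall>s\<in>S. c (line s) \<in> P}"
        by (intro CollectI exI[of _ "\<lambda>v. c (v 0)"]) simp
    qed
    finally show ?thesis unfolding rank1_def S(2) by simp
  qed
  moreover have "line ` S \<subseteq> vecs 1" using line_in_vecs by blast
  ultimately show "\<exists>S. finite S \<and> S \<subseteq> vecs 1 \<and> rank1 L P = {(\<lambda>i. \<Sum>s\<in>S. c s * s i) | c. \<forall>s\<in>S. c s \<in> P}"
    using S(1) by (intro exI[of _ "line ` S"]) simp
  fix v :: "nat \<Rightarrow> 'a" assume v: "v \<in> vecs 1"
  obtain b where b: "b \<in> P" "b \<noteq> 0" "b * v 0 \<in> L P" using assms P unfolding coherent_def by blast
  have "(\<lambda>i. b * v i) \<in> vecs 1" using v by (auto simp: vecs_def)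
  then have "(\<lambda>i. b * v i) \<in> rank1 L P" using b(3) mem_rank1 by blast
  then show "\<exists>b\<in>P. b \<noteq> 0 \<and> (\<lambda>i. b * v i) \<in> rank1 L P" using b by blast
next
  have "rank1 L P = {v \<in> vecs 1. \<forall>i. v i \<in> P}" if P: "P \<in> closed_points C" "L P = P" for P
  proof (intro antisym subsetI)
    fix v assume v: "v \<in> rank1 L P"
    then obtain x where "v = line x" "x \<in> P" using P(2) by (auto simp: rank1_def)
    then show "v \<in> {v \<in> vecs 1. \<forall>i. v i \<in> P}"
      using subring_closed(1)[OF closed_pointD'(3)[OF P(1)]] line_in_vecs by (auto simp: line_def)
  next
    fix v assume "v \<in> {v \<in> vecs 1. \<forall>i. v i \<in> P}"
    then show "v \<in> rank1 L P" using mem_rank1 P(2) by blast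
  qed
  then have "{P \<in> closed_points C. rank1 L P \<noteq> {v \<in> vecs 1. \<forall>i. v i \<in> P}} \<subseteq> {P \<in> closed_points C. L P \<noteq> P}"
    by blast
  then show "finite {P \<in> closed_points C. rank1 L P \<noteq> {v \<in> vecs 1. \<forall>i. v i \<in> P}}"
    using assms finite_subset unfolding coherent_def by blast
qed

lemma rank1_eq_structure:
  assumes "P \<in> closed_points C" "rank1 L P = {v \<in> vecs 1. \<forall>i. v i \<in> P}" shows "L P = P"
proof (intro antisym subsetI)
  fix x assume "x \<in> L P"
  then have "line x \<in> rank1 L P" by (simp add: rank1_def)
  then show "x \<in> P" unfolding assms(2) by (metis (mono_tags, lifting) line_0 mem_Collect_eq)
next
  fix x assume "x \<in> P"
  then have "line x \<in> {v \<in> vecs 1. \<forall>i. v i \<in> P}"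
    using subring_closed(1)[OF closed_pointD'(3)[OF assms(1)]] line_in_vecs by (auto simp: line_def)
  then show "x \<in> L P" unfolding assms(2)[symmetric] by (auto simp: rank1_def)
qed

sublocale funs: linear_space "\<lambda>c \<xi> P. \<iota> c * \<xi> P"
  by unfold_locales (auto simp: fun_eq_iff algebra_simps iota_add iota_mult)

lemma adele_subspace:
  assumes "\<And>P. P \<in> closed_points C \<Longrightarrow> subspace (L P)"
  shows "funs.subspace (adele L)"
proof (rule funs.subspaceI)
  have "{P \<in> closed_points C. 0 \<notin> L P} = {}" using subspace_0[OF assms] by blast
  then show "0 \<in> adele L" unfolding adele_def by (simp only: mem_Collect_eq zero_fun_apply finite.emptyI)
next
  fix \<xi> \<eta> assume "\<xi> \<in> adele L" "\<eta> \<in> adele L"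
  then have "finite ({P \<in> closed_points C. \<xi> P \<notin> L P} \<union> {P \<in> closed_points C. \<eta> P \<notin> L P})"
    by (simp add: adele_def)
  moreover have "{P \<in> closed_points C. (\<xi> + \<eta>) P \<notin> L P}
      \<subseteq> {P \<in> closed_points C. \<xi> P \<notin> L P} \<union> {P \<in> closed_points C. \<eta> P \<notin> L P}"
    using subspace_add[OF assms] by auto
  ultimately show "\<xi> + \<eta> \<in> adele L" unfolding adele_def using finite_subset by blast
next
  fix c \<xi> assume "\<xi> \<in> adele L"
  moreover have "{P \<in> closed_points C. \<iota> c * \<xi> P \<notin> L P} \<subseteq> {P \<in> closed_points C. \<xi> P \<notin> L P}"
    using subspace_scale[OF assms] by auto
  ultimately show "(\<lambda>P. \<iota> c * \<xi> P) \<in> adele L" unfolding adele_def using finite_subset by blast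
qed

lemma null_subspace:
  assumes "\<And>P. P \<in> closed_points C \<Longrightarrow> subspace (L P)"
  shows "funs.subspace (null L)"
proof (rule funs.subspaceI)
  show "0 \<in> null L" unfolding null_def using subspace_0[OF assms] by (intro CollectI exI[of _ 0]) simp
next
  fix \<xi> \<eta> assume "\<xi> \<in> null L" "\<eta> \<in> null L"
  then obtain f h where "\<And>P. P \<in> closed_points C \<Longrightarrow> \<xi> P - f \<in> L P" "\<And>P. P \<in> closed_points C \<Longrightarrow> \<eta> P - h \<in> L P"
    unfolding null_def by blast
  then have "\<And>P. P \<in> closed_points C \<Longrightarrow> (\<xi> + \<eta>) P - (f + h) \<in> L P"
    using subspace_add[OF assms] by (simp add: add_diff_add)
  then show "\<xi> + \<eta> \<in> null L" unfolding null_def by blast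
next
  fix c \<xi> assume "\<xi> \<in> null L"
  then obtain f where f: "\<And>P. P \<in> closed_points C \<Longrightarrow> \<xi> P - f \<in> L P" unfolding null_def by blast
  have "\<And>P. P \<in> closed_points C \<Longrightarrow> \<iota> c * \<xi> P - \<iota> c * f \<in> L P"
    using subspace_scale[OF assms f] by (simp add: right_diff_distrib)
  then show "(\<lambda>P. \<iota> c * \<xi> P) \<in> null L" unfolding null_def by blast
qed

lemma hom_adele: "c \<in> hom L M \<Longrightarrow> \<xi> \<in> adele L \<Longrightarrow> (\<lambda>P. c * \<xi> P) \<in> adele M"
  unfolding adele_def hom_def by (auto elim!: rev_finite_subset)

lemma hom_null: "c \<in> hom L M \<Longrightarrow> \<xi> \<in> null L \<Longrightarrow> (\<lambda>P. c * \<xi> P) \<in> null M"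
proof -
  assume c: "c \<in> hom L M" and "\<xi> \<in> null L"
  then obtain f where f: "\<And>P. P \<in> closed_points C \<Longrightarrow> \<xi> P - f \<in> L P" unfolding null_def by blast
  have "c * \<xi> P - c * f \<in> M P" if P: "P \<in> closed_points C" for P
    using c f[OF P] P unfolding hom_def right_diff_distrib[symmetric] by blast
  then show "(\<lambda>P. c * \<xi> P) \<in> null M" unfolding null_def by blast
qed

end

locale gorenstein_curve = complete_curve \<iota> C
  for \<iota> :: "'k::alg_closed_field \<Rightarrow> 'a::field" and C :: "'a set set" +
  fixes \<omega> :: "'a set \<Rightarrow> 'a set" and w :: "nat \<Rightarrow> 'a" and g :: nat
    and trace :: "('a set \<Rightarrow> nat \<Rightarrow> 'a) \<Rightarrow> 'k"
  assumes g_ge_2: "g \<ge> 2"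
    and basis: "is_basis \<iota> (H0 C \<omega>) g w"
    and gorenstein: "invertible_sheaf C \<omega>"
    and omega_coherent: "torsion_free_coherent C 1 (rank1 \<omega>)"
    and trace_form: "H1_form \<iota> C 1 (rank1 \<omega>) trace"
    and trace_dual: "\<And>r F l. torsion_free_coherent C r F \<Longrightarrow> H1_form \<iota> C r F l \<Longrightarrow>
      \<exists>!c. c \<in> sheaf_hom C r F \<omega> \<and> (\<forall>\<xi>\<in>adeles C r F. l \<xi> = trace (\<lambda>P. line (\<Sum>i<r. c i * \<xi> P i)))"
begin

definition tr :: "('a set \<Rightarrow> 'a) \<Rightarrow> 'k" where
  "tr \<xi> = trace (\<lambda>P. line (\<xi> P))"

lemma adele_line: "\<xi> \<in> adele L \<longleftrightarrow> (\<lambda>P. line (\<xi> P)) \<in> adeles C 1 (rank1 L)"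
  by (simp add: adele_def adeles_def line_in_vecs mem_rank1)

lemma adeles_component: "\<xi> \<in> adeles C 1 (rank1 L) \<Longrightarrow> (\<lambda>P. \<xi> P 0) \<in> adele L"
  unfolding adele_def adeles_def by (auto simp: mem_rank1 elim!: rev_finite_subset)

lemma line_plus: "line (x + y) = (\<lambda>i. line x i + line y i)" and line_times: "line (a * x) = (\<lambda>i. a * line x i)"
  for x y a :: 'a
  by (auto simp: line_def)

lemma tr_add: "\<xi> \<in> adele \<omega> \<Longrightarrow> \<eta> \<in> adele \<omega> \<Longrightarrow> tr (\<xi> + \<eta>) = tr \<xi> + tr \<eta>"
  using trace_form unfolding H1_form_def tr_def adele_line by (simp add: line_plus)

lemma tr_scale: "\<xi> \<in> adele \<omega> \<Longrightarrow> tr (\<lambda>P. \<iota> c * \<xi> P) = c * tr \<xi>"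
  using trace_form unfolding H1_form_def tr_def adele_line by (simp add: line_times)

lemma tr_null: "\<xi> \<in> null \<omega> \<Longrightarrow> tr \<xi> = 0"
proof -
  assume "\<xi> \<in> null \<omega>"
  then obtain f where f: "\<And>P. P \<in> closed_points C \<Longrightarrow> \<xi> P - f \<in> \<omega> P" unfolding null_def by blast
  have "(\<lambda>i. line (\<xi> P) i - line f i) = line (\<xi> P - f)" for P by (auto simp: line_def)
  then have "(\<lambda>P. line (\<xi> P)) \<in> H1_null C 1 (rank1 \<omega>)"
    unfolding H1_null_def using f line_in_vecs by (auto simp: rank1_def intro!: bexI[of _ "line f"])
  then show ?thesis using trace_form unfolding H1_form_def tr_def by blast
qed

lemma duality:
  assumes L: "coherent L"
    and add: "\<And>\<xi> \<eta>. \<xi> \<in> adele L \<Longrightarrow> \<eta> \<in> adele L \<Longrightarrow> l (\<xi> + \<eta>) = l \<xi> + l \<eta>"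
    and scale: "\<And>c \<xi>. \<xi> \<in> adele L \<Longrightarrow> l (\<lambda>P. \<iota> c * \<xi> P) = c * l \<xi>"
    and null: "\<And>\<xi>. \<xi> \<in> null L \<Longrightarrow> l \<xi> = 0"
  shows "\<exists>!c. c \<in> hom L \<omega> \<and> (\<forall>\<xi>\<in>adele L. l \<xi> = tr (\<lambda>P. c * \<xi> P))"
proof -
  define l' where "l' \<xi> = l (\<lambda>P. \<xi> P 0)" for \<xi> :: "'a set \<Rightarrow> nat \<Rightarrow> 'a"
  have "H1_form \<iota> C 1 (rank1 L) l'"
    unfolding H1_form_def l'_def
  proof (intro conjI ballI allI)
    fix \<xi> \<eta> assume *: "\<xi> \<in> adeles C 1 (rank1 L)" "\<eta> \<in> adeles C 1 (rank1 L)"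
    show "l (\<lambda>P. \<xi> P 0 + \<eta> P 0) = l (\<lambda>P. \<xi> P 0) + l (\<lambda>P. \<eta> P 0)"
      using add[OF *[THEN adeles_component]] by (simp add: plus_fun_def)
    show "l (\<lambda>P. \<iota> c * \<xi> P 0) = c * l (\<lambda>P. \<xi> P 0)" for c
      using scale[OF adeles_component[OF *(1)]] .
  next
    fix \<xi> assume "\<xi> \<in> H1_null C 1 (rank1 L)"
    then obtain v where v: "\<And>P. P \<in> closed_points C \<Longrightarrow> (\<lambda>i. \<xi> P i - v i) \<in> rank1 L P"
      unfolding H1_null_def by blast
    have "\<xi> P 0 - v 0 \<in> L P" if "P \<in> closed_points C" for P
      using v[OF that] mem_rank1 rank1_subset_vecs by blast
    then show "l (\<lambda>P. \<xi> P 0) = 0" by (intro null) (auto simp: null_def)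
  qed
  from trace_dual[OF coherent_torsion_free[OF L] this]
  obtain c where c: "c \<in> sheaf_hom C 1 (rank1 L) \<omega>"
      "\<And>\<xi>. \<xi> \<in> adeles C 1 (rank1 L) \<Longrightarrow> l' \<xi> = trace (\<lambda>P. line (\<Sum>i<1. c i * \<xi> P i))"
    and unique: "\<And>d. d \<in> sheaf_hom C 1 (rank1 L) \<omega> \<Longrightarrow>
      (\<forall>\<xi>\<in>adeles C 1 (rank1 L). l' \<xi> = trace (\<lambda>P. line (\<Sum>i<1. d i * \<xi> P i))) \<Longrightarrow> d = c"
    by (elim ex1E) blast
  show ?thesis
  proof (rule ex1I[of _ "c 0"])
    show "c 0 \<in> hom L \<omega> \<and> (\<forall>\<xi>\<in>adele L. l \<xi> = tr (\<lambda>P. c 0 * \<xi> P))"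
    proof (intro conjI ballI)
      show "c 0 \<in> hom L \<omega>" using c(1) by (auto simp: hom_def sheaf_hom_def rank1_def)
      fix \<xi> assume "\<xi> \<in> adele L"
      then show "l \<xi> = tr (\<lambda>P. c 0 * \<xi> P)" using c(2)[of "\<lambda>P. line (\<xi> P)"]
        by (simp add: adele_line l'_def tr_def)
    qed
    fix d assume d: "d \<in> hom L \<omega> \<and> (\<forall>\<xi>\<in>adele L. l \<xi> = tr (\<lambda>P. d * \<xi> P))"
    have "line d = c"
    proof (rule unique)
      show "line d \<in> sheaf_hom C 1 (rank1 L) \<omega>"
        using d line_in_vecs by (auto simp: hom_def sheaf_hom_def rank1_def)
      show "\<forall>\<xi>\<in>adeles C 1 (rank1 L). l' \<xi> = trace (\<lambda>P. line (\<Sum>i<1. line d i * \<xi> P i))"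
      proof
        fix \<xi> assume "\<xi> \<in> adeles C 1 (rank1 L)"
        then have "l (\<lambda>P. \<xi> P 0) = tr (\<lambda>P. d * \<xi> P 0)" using d adeles_component by blast
        then show "l' \<xi> = trace (\<lambda>P. line (\<Sum>i<1. line d i * \<xi> P i))" by (simp add: l'_def tr_def)
      qed
    qed
    then show "d = c 0" by (metis line_0)
  qed
qed

text \<open>A nonzero class in \<open>H\<^sup>1(L)\<close> is detected by some linear form, and linear forms on \<open>H\<^sup>1(L)\<close> come from
  \<open>Hom(L, \<omega>)\<close>.\<close>

lemma separated_by_trace:
  assumes L: "coherent L" and \<eta>: "\<eta> \<notin> null L" "\<eta> \<in> adele L"
  obtains c where "c \<in> hom L \<omega>" "tr (\<lambda>P. c * \<eta> P) \<noteq> 0"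
proof -
  obtain l where l: "Vector_Spaces.linear (\<lambda>c \<xi> P. \<iota> c * \<xi> P) (*) l"
      "\<And>\<xi>. \<xi> \<in> null L \<Longrightarrow> l \<xi> = 0" "l \<eta> = (1::'k)"
    using funs.separating_form[OF null_subspace[OF coherent_subspace[OF L]] \<eta>(1)] by blast
  interpret l: Vector_Spaces.linear "\<lambda>c \<xi> P. \<iota> c * \<xi> P" "(*)" l by fact
  obtain c where c: "c \<in> hom L \<omega>" "\<forall>\<xi>\<in>adele L. l \<xi> = tr (\<lambda>P. c * \<xi> P)"
    using duality[OF L, of l] l(2) l.add l.scale by blast
  then show thesis using that \<eta>(2) l(3) by force
qed

lemma hom_unique:
  assumes L: "coherent L" and c: "c \<in> hom L \<omega>" "d \<in> hom L \<omega>"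
    and eq: "\<And>\<xi>. \<xi> \<in> adele L \<Longrightarrow> tr (\<lambda>P. c * \<xi> P) = tr (\<lambda>P. d * \<xi> P)"
  shows "c = d"
proof -
  have "\<exists>!c'. c' \<in> hom L \<omega> \<and> (\<forall>\<xi>\<in>adele L. tr (\<lambda>P. c * \<xi> P) = tr (\<lambda>P. c' * \<xi> P))"
  proof (rule duality[OF L])
    fix \<xi> \<eta> assume "\<xi> \<in> adele L" "\<eta> \<in> adele L"
    then show "tr (\<lambda>P. c * (\<xi> + \<eta>) P) = tr (\<lambda>P. c * \<xi> P) + tr (\<lambda>P. c * \<eta> P)"
      using tr_add[OF hom_adele[OF c(1)] hom_adele[OF c(1)]] by (simp add: plus_fun_def distrib_left)
  next
    fix a \<xi> assume "\<xi> \<in> adele L"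
    then show "tr (\<lambda>P. c * (\<iota> a * \<xi> P)) = a * tr (\<lambda>P. c * \<xi> P)"
      using tr_scale[OF hom_adele[OF c(1)]] by (simp add: mult.left_commute)
  next
    fix \<xi> assume "\<xi> \<in> null L"
    then show "tr (\<lambda>P. c * \<xi> P) = 0" using tr_null hom_null[OF c(1)] by blast
  qed
  then show ?thesis using c eq by blast
qed

subsection \<open>The powers of the dualizing sheaf\<close>

text \<open>A generator of the stalk of \<open>\<omega>\<close>. It is 1 where possible, so that all powers of \<open>\<omega>\<close> coincide with the
  structure sheaf at almost all points.\<close>

definition gen :: "'a set \<Rightarrow> 'a" where
  "gen P = (if \<omega> P = P then 1 else SOME u. u \<noteq> 0 \<and> \<omega> P = {u * x | x. x \<in> P})"

lemma gen:
  assumes "P \<in> closed_points C"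
  shows "gen P \<noteq> 0" "x \<in> \<omega> P \<longleftrightarrow> x / gen P \<in> P"
proof -
  have *: "gen P \<noteq> 0 \<and> \<omega> P = {gen P * x | x. x \<in> P}"
  proof (cases "\<omega> P = P")
    case True
    then show ?thesis by (simp add: gen_def)
  next
    case False
    have "\<exists>u. u \<noteq> 0 \<and> \<omega> P = {u * x | x. x \<in> P}" using gorenstein assms by (auto simp: invertible_sheaf_def)
    from someI_ex[OF this] False show ?thesis by (simp add: gen_def)
  qed
  then show nz: "gen P \<noteq> 0" by blast
  show "x \<in> \<omega> P \<longleftrightarrow> x / gen P \<in> P"
  proof
    assume "x \<in> \<omega> P"
    then show "x / gen P \<in> P" using * by auto
  next
    assume "x / gen P \<in> P"
    moreover have "x = gen P * (x / gen P)" using nz by simp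
    ultimately show "x \<in> \<omega> P" using * by blast
  qed
qed

text \<open>The \<open>m\<close>-th power of \<open>\<omega>\<close>.\<close>

definition twist :: "int \<Rightarrow> 'a set \<Rightarrow> 'a set" where
  "twist m P = {x. x / gen P powi m \<in> P}"

lemma omega_finite: "finite {P \<in> closed_points C. \<omega> P \<noteq> P}"
proof -
  have "{P \<in> closed_points C. \<omega> P \<noteq> P}
      \<subseteq> {P \<in> closed_points C. rank1 \<omega> P \<noteq> {v \<in> vecs 1. \<forall>i. v i \<in> P}}"
    using rank1_eq_structure[of _ \<omega>] by (intro Collect_mono) (rule impI, erule conjE, rule conjI, assumption, erule contrapos_nn)
  then show ?thesis
    by (rule finite_subset) (rule omega_coherent[unfolded torsion_free_coherent_def, THEN conjunct2])
qed

lemma twist_1: "P \<in> closed_points C \<Longrightarrow> twist 1 P = \<omega> P"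
  by (auto simp: twist_def gen)

lemma twist_0: "twist 0 P = P"
  by (auto simp: twist_def)

lemma twist_mult:
  assumes P: "P \<in> closed_points C" and xy: "x \<in> twist m P" "y \<in> twist n P"
  shows "x * y \<in> twist (m + n) P"
proof -
  have eq: "x * y / gen P powi (m + n) = (x / gen P powi m) * (y / gen P powi n)"
    using gen(1)[OF P] by (simp add: power_int_add)
  show ?thesis using xy subring_closed(4)[OF closed_pointD'(3)[OF P]]
    unfolding twist_def mem_Collect_eq eq by blast
qed

lemma twist_closed:
  assumes P: "P \<in> closed_points C"
  shows "subspace (twist m P)" "x \<in> twist m P \<Longrightarrow> a \<in> P \<Longrightarrow> a * x \<in> twist m P"
proof -
  show "subspace (twist m P)" unfolding twist_def
    by (rule subspace_quotient[OF local_subringD(8)[OF closed_pointD'(2)[OF P]]])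
  show "x \<in> twist m P \<Longrightarrow> a \<in> P \<Longrightarrow> a * x \<in> twist m P"
    using twist_mult[OF P, of a 0 x m] by (simp add: twist_0)
qed

lemma twist_coherent: "coherent (twist m)"
  unfolding coherent_def
proof (intro conjI ballI)
  fix P assume P: "P \<in> closed_points C"
  let ?u = "gen P powi m"
  have u: "?u \<noteq> 0" using gen(1)[OF P] by simp
  have "twist m P = module_span P {?u}"
    unfolding module_span_def twist_def
  proof (intro antisym subsetI)
    fix x assume "x \<in> {x. x / ?u \<in> P}"
    then show "x \<in> {\<Sum>s\<in>{?u}. c s * s | c. \<forall>s\<in>{?u}. c s \<in> P}"
      using u by (intro CollectI exI[of _ "\<lambda>_. x / ?u"]) auto
  qed (use u in auto)
  then show "\<exists>S. finite S \<and> twist m P = module_span P S" by blast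
  show "\<forall>x. \<exists>b\<in>P. b \<noteq> 0 \<and> b * x \<in> twist m P"
  proof
    fix x
    obtain a b where ab: "a \<in> P" "b \<in> P" "b \<noteq> 0" "x / ?u = a / b"
      using fraction_at_point[OF closed_pointD(1)[OF P]] .
    have "b * x / ?u = b * (x / ?u)" by simp
    also have "\<dots> = a" unfolding ab(4) using ab(3) by simp
    finally have "b * x \<in> twist m P" using ab(1) by (simp add: twist_def)
    then show "\<exists>b\<in>P. b \<noteq> 0 \<and> b * x \<in> twist m P" using ab(2,3) by blast
  qed
next
  have "{P \<in> closed_points C. twist m P \<noteq> P} \<subseteq> {P \<in> closed_points C. \<omega> P \<noteq> P}"
    by (auto simp: twist_def gen_def)
  then show "finite {P \<in> closed_points C. twist m P \<noteq> P}" using omega_finite finite_subset by blast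
qed

lemma H0_subspace: "subspace (H0 C (twist m))"
proof (rule subspaceI)
  show "0 \<in> H0 C (twist m)" using subspace_closed(1)[OF twist_closed(1)] by (simp add: H0_def)
  show "x + y \<in> H0 C (twist m)" if "x \<in> H0 C (twist m)" "y \<in> H0 C (twist m)" for x y
    using that subspace_closed(2)[OF twist_closed(1)] by (simp add: H0_def)
  show "\<iota> c * x \<in> H0 C (twist m)" if "x \<in> H0 C (twist m)" for c x
    using that subspace_closed(3)[OF twist_closed(1)] by (simp add: H0_def)
qed

lemma H0_mult: "x \<in> H0 C (twist m) \<Longrightarrow> y \<in> H0 C (twist n) \<Longrightarrow> x * y \<in> H0 C (twist (m + n))"
  using twist_mult by (simp add: H0_def)

lemma hom_twist: "hom (twist m) (twist n) = H0 C (twist (n - m))"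
proof (intro antisym subsetI)
  fix c assume c: "c \<in> hom (twist m) (twist n)"
  have "c \<in> twist (n - m) P" if P: "P \<in> closed_points C" for P
  proof -
    have "gen P powi m \<in> twist m P"
      using gen(1)[OF P] subring_closed(2)[OF closed_pointD'(3)[OF P]] by (simp add: twist_def)
    then have "c * gen P powi m \<in> twist n P" using c P by (auto simp: hom_def)
    then show ?thesis using gen(1)[OF P] by (simp add: twist_def power_int_diff)
  qed
  then show "c \<in> H0 C (twist (n - m))" by (simp add: H0_def)
next
  fix c assume "c \<in> H0 C (twist (n - m))"
  then show "c \<in> hom (twist m) (twist n)"
    using twist_mult[of _ c "n - m" _ m] by (auto simp: H0_def hom_def)
qed

lemma hom_omega: "hom (twist m) \<omega> = H0 C (twist (1 - m))"
  using hom_twist[of m 1] by (auto simp: hom_def twist_1)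

lemma H0_omega: "H0 C \<omega> = H0 C (twist 1)"
  by (auto simp: H0_def twist_1)

lemma omega_basis:
  "\<And>i. i < g \<Longrightarrow> w i \<in> H0 C \<omega>" "\<not> dependent (w ` {..<g})" "inj_on w {..<g}" "span (w ` {..<g}) = H0 C \<omega>"
proof -
  show wV: "\<And>i. i < g \<Longrightarrow> w i \<in> H0 C \<omega>" using basis by (simp add: is_basis_def)
  have rep: "\<exists>!c. c \<in> vecs g \<and> x = (\<Sum>i<g. \<iota> (c i) * w i)" if "x \<in> H0 C \<omega>" for x
    using basis that by (auto simp: is_basis_def)
  have zero: "c i = 0" if c: "(\<Sum>i<g. \<iota> (c i) * w i) = 0" and i: "i < g" for c i
  proof -
    define d where "d i = (if i < g then c i else 0)" for i
    have "0 \<in> H0 C \<omega>" unfolding H0_omega using subspace_closed(1)[OF H0_subspace] .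
    moreover have "d \<in> vecs g" "0 = (\<Sum>i<g. \<iota> (d i) * w i)" using c by (auto simp: d_def vecs_def)
    moreover have "(\<lambda>_. 0) \<in> vecs g" "0 = (\<Sum>i<g. \<iota> ((\<lambda>_. 0) i) * w i)" by (auto simp: vecs_def)
    ultimately have "d = (\<lambda>_. 0)" using rep by blast
    then show ?thesis using i by (metis d_def)
  qed
  show inj: "inj_on w {..<g}"
  proof (rule inj_onI, rule ccontr)
    fix i j assume ij: "i \<in> {..<g}" "j \<in> {..<g}" "w i = w j" "i \<noteq> j"
    define c where "c l = (if l = i then 1 else if l = j then -1 else (0::'k))" for l
    have "(\<Sum>l<g. \<iota> (c l) * w l) = (\<Sum>l\<in>{i, j}. \<iota> (c l) * w l)"
      using ij by (intro sum.mono_neutral_right) (auto simp: c_def)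
    also have "\<dots> = 0" using ij by (simp add: c_def iota_minus)
    finally have "c i = 0" using zero ij(1) by blast
    then show False by (simp add: c_def)
  qed
  show "\<not> dependent (w ` {..<g})"
  proof (rule independent_if_scalars_zero)
    fix f x assume f: "(\<Sum>x\<in>w ` {..<g}. \<iota> (f x) * x) = 0" and x: "x \<in> w ` {..<g}"
    have "(\<Sum>i<g. \<iota> (f (w i)) * w i) = 0" using f by (simp add: sum.reindex[OF inj])
    then show "f x = 0" using zero[of "\<lambda>i. f (w i)"] x by auto
  qed simp
  show "span (w ` {..<g}) = H0 C \<omega>"
  proof (rule span_subspace)
    show "w ` {..<g} \<subseteq> H0 C \<omega>" using wV by auto
    show "subspace (H0 C \<omega>)" unfolding H0_omega by (rule H0_subspace)
    show "H0 C \<omega> \<subseteq> span (w ` {..<g})"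
    proof
      fix x assume "x \<in> H0 C \<omega>"
      then obtain c where x: "x = (\<Sum>i<g. \<iota> (c i) * w i)" using rep by blast
      show "x \<in> span (w ` {..<g})" unfolding x by (intro span_sum span_scale) (simp add: span_base)
    qed
  qed
qed

lemma has_dim_omega: "has_dim (H0 C \<omega>) g"
  unfolding has_dim_def using omega_basis card_image[OF omega_basis(3)]
  by (intro exI[of _ "w ` {..<g}"]) auto

text \<open>If \<open>f\<close> is not constant, then \<open>v, v * f, v * f ^ 2, \<dots>\<close> are linearly independent for \<open>v \<noteq> 0\<close>.\<close>

lemma stable_imp_constant:
  assumes "\<And>v. v \<in> H0 C \<omega> \<Longrightarrow> f * v \<in> H0 C \<omega>" shows "f \<in> range \<iota>"
proof (rule ccontr)
  assume f: "f \<notin> range \<iota>"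
  obtain v where v: "v \<in> H0 C \<omega>" "v \<noteq> 0" using has_dim_nonzero[OF has_dim_omega] g_ge_2 by auto
  have "v * f ^ j \<in> H0 C \<omega>" for j
  proof (induction j)
    case (Suc j)
    then show ?case using assms[of "v * f ^ j"] by (simp add: mult.left_commute)
  qed (simp add: v)
  then have "progression v f (Suc g) \<subseteq> H0 C \<omega>"
    by (intro progression_least has_dim_subspace[OF has_dim_omega])
  then show False using has_dim_mono[OF has_dim_omega has_dim_progression[OF v(2) f]] by fastforce
qed

lemma H0_structure_sheaf: "H0 C (twist 0) = range \<iota>"
proof (intro antisym subsetI)
  fix f assume f: "f \<in> H0 C (twist 0)"
  show "f \<in> range \<iota>"
  proof (rule stable_imp_constant)
    fix v assume "v \<in> H0 C \<omega>"
    then show "f * v \<in> H0 C \<omega>" using H0_mult[OF f, of v 1] by (simp add: H0_omega)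
  qed
next
  fix f assume "f \<in> range \<iota>"
  then show "f \<in> H0 C (twist 0)"
    using local_subringD(2)[OF closed_pointD'(2)] by (auto simp: H0_def twist_0)
qed

text \<open>Multiplying a nonzero section of \<open>\<omega>\<^sup>m\<close> by powers of some \<open>v\<close> in \<open>H0 C \<omega>\<close>, one may assume \<open>m = - 1\<close>. Then
  multiplication by this section embeds \<open>H0 C \<omega>\<close>, of dimension at least 2, into the constants.\<close>

lemma H0_negative:
  assumes "m < 0" shows "H0 C (twist m) = {0}"
proof -
  have "y = 0" if y: "y \<in> H0 C (twist m)" for y
  proof (rule ccontr)
    assume "y \<noteq> 0"
    obtain v where v: "v \<in> H0 C \<omega>" "v \<noteq> 0" using has_dim_nonzero[OF has_dim_omega] g_ge_2 by auto
    have pow: "y * v ^ j \<in> H0 C (twist (m + int j))" for j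
    proof (induction j)
      case (Suc j)
      then show ?case using H0_mult[OF Suc, of v 1] v(1) by (simp add: H0_omega ac_simps)
    qed (simp add: y)
    define z where "z = y * v ^ nat (- m - 1)"
    have "z \<in> H0 C (twist (- 1))" using pow[of "nat (- m - 1)"] assms by (simp add: z_def)
    then have "(\<lambda>x. z * x) ` H0 C \<omega> \<subseteq> range \<iota>"
      using H0_mult[of z "- 1" _ 1] by (auto simp: H0_omega H0_structure_sheaf)
    moreover have "range \<iota> = span {1}" by (simp add: span_singleton)
    moreover have "z \<noteq> 0" using v \<open>y \<noteq> 0\<close> by (simp add: z_def)
    ultimately have "g \<le> 1"
      using has_dim_mono[OF has_dim_1[of "1::'a"] has_dim_scale[OF has_dim_omega]] by simp
    then show False using g_ge_2 by simp
  qed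
  then show ?thesis using subspace_closed(1)[OF H0_subspace] by auto
qed

end

context gorenstein_curve
begin

section \<open>Base points\<close>

lemma omega_subspace: "subspace (H0 C \<omega>)"
  by (rule has_dim_subspace[OF has_dim_omega])

lemma omega_stalk: "v \<in> H0 C \<omega> \<Longrightarrow> P \<in> closed_points C \<Longrightarrow> v / gen P \<in> P"
  using gen(2) by (auto simp: H0_def)

lemma skyscraper_adele:
  assumes "\<And>Q. Q \<in> closed_points C \<Longrightarrow> 0 \<in> L Q"
  shows "(\<lambda>Q. if Q = P then y else 0) \<in> adele L"
proof -
  have "{Q \<in> closed_points C. (if Q = P then y else 0) \<notin> L Q} \<subseteq> {P}" using assms by auto
  then show ?thesis unfolding adele_def using finite_subset by blast
qed

text \<open>Principal parts that the section \<open>c\<close> annihilates pair to 0 with \<open>c\<close>.\<close>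

lemma skyscraper_null:
  assumes "c * y \<in> \<omega> P"
  shows "(\<lambda>Q. c * (if Q = P then y else 0)) \<in> null \<omega>"
proof -
  have "0 \<in> \<omega> Q" if "Q \<in> closed_points C" for Q
    using subspace_closed(1)[OF twist_closed(1)[OF that, of 1]] twist_1[OF that] by simp
  then show ?thesis unfolding null_def using assms by (intro CollectI exI[of _ 0]) auto
qed

text \<open>Suppose that all sections vanish at \<open>P\<close>, and let \<open>I\<close> be the ideal of \<open>P\<close> that they generate after division
  by \<open>gen P\<close>. If \<open>y * I\<close> is contained in \<open>P\<close>, then the principal part \<open>y\<close> at \<open>P\<close> is orthogonal to all of
  \<open>H0 C \<omega>\<close>. So it vanishes in \<open>H\<^sup>1(\<O>)\<close>, that is, some rational function \<open>f\<close> has this principal part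
  and no others. Such an \<open>f\<close> preserves \<open>H0 C \<omega>\<close>, hence is constant, and \<open>y\<close> lies in \<open>P\<close>.

  Now let \<open>L\<close> be the ideal sheaf with stalk \<open>I\<^sup>2\<close> at \<open>P\<close>, and let \<open>z\<close> be in \<open>P\<close>. By what was just shown,
  \<open>Hom(L, \<omega>)\<close> is equal to \<open>H0 C \<omega>\<close>, so the family that is \<open>z\<close> at \<open>P\<close> and 0 elsewhere is orthogonal to it
  and vanishes in \<open>H\<^sup>1(L)\<close>. This means that \<open>z\<close> is congruent to a constant modulo \<open>I\<^sup>2\<close>. It follows that
  \<open>I = I\<^sup>2\<close>, which is impossible for a proper nonzero finitely generated ideal of a local domain.\<close>

theorem base_point_free:
  assumes P: "P \<in> closed_points C"
  obtains v where "v \<in> H0 C \<omega>" "v / gen P \<in> P" "v / gen P \<notin> max_ideal P"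
proof (rule ccontr)
  assume none: "\<not> thesis"
  note found = that
  let ?u = "gen P"
  have bad: "v / ?u \<in> max_ideal P" if "v \<in> H0 C \<omega>" for v
    using none found[OF that] omega_stalk[OF that P] by blast
  note u = gen(1)[OF P]
  note P' = closed_pointD'[OF P]
  note R = subring_closed[OF P'(3)] and M = local_subringD[OF P'(2)]
  define S where "S = (\<lambda>i. w i / ?u) ` {..<g}"
  have S_max: "s \<in> max_ideal P" if "s \<in> S" for s using that bad omega_basis(1) by (auto simp: S_def)
  have SP: "S \<subseteq> P" using S_max max_ideal_subset by blast
  have reflexive: "y \<in> P" if y: "\<And>s. s \<in> S \<Longrightarrow> y * s \<in> P" for y
  proof -
    have yv: "y * (v / ?u) \<in> P" if v: "v \<in> H0 C \<omega>" for v
    proof -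
      have "subspace {v. y * (v / ?u) \<in> P}"
      proof (rule subspaceI)
        show "0 \<in> {v. y * (v / ?u) \<in> P}" using R(1) by simp
        show "v + v' \<in> {v. y * (v / ?u) \<in> P}" if "v \<in> {v. y * (v / ?u) \<in> P}" "v' \<in> {v. y * (v / ?u) \<in> P}" for v v'
          using that R(6)[of "y * (v / ?u)" "y * (v' / ?u)"] by (simp add: add_divide_distrib distrib_left)
        show "\<iota> c * v \<in> {v. y * (v / ?u) \<in> P}" if "v \<in> {v. y * (v / ?u) \<in> P}" for c v
          using that R(4)[OF M(2), of "y * (v / ?u)" c] by (simp add: mult.left_commute)
      qed
      moreover have "y * (w i / ?u) \<in> P" if "i < g" for i by (rule y) (use that in \<open>auto simp: S_def\<close>)
      then have "w ` {..<g} \<subseteq> {v. y * (v / ?u) \<in> P}" by blast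
      ultimately have "H0 C \<omega> \<subseteq> {v. y * (v / ?u) \<in> P}" using omega_basis(4) span_minimal by blast
      then show ?thesis using v by blast
    qed
    let ?\<eta> = "\<lambda>Q. if Q = P then y else 0"
    have ad: "?\<eta> \<in> adele (twist 0)"
      using subspace_closed(1)[OF twist_closed(1)] by (intro skyscraper_adele) blast
    have "?\<eta> \<in> null (twist 0)"
    proof (rule ccontr)
      assume "?\<eta> \<notin> null (twist 0)"
      then obtain c where c: "c \<in> hom (twist 0) \<omega>" "tr (\<lambda>Q. c * ?\<eta> Q) \<noteq> 0"
        using separated_by_trace[OF twist_coherent _ ad] by blast
      have "c \<in> H0 C \<omega>" using c(1) unfolding hom_omega H0_omega by simp
      then have "c * y \<in> \<omega> P" using yv gen(2)[OF P] by (simp add: mult.commute)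
      then show False using tr_null[OF skyscraper_null] c(2) by blast
    qed
    then obtain f where f: "\<And>Q. Q \<in> closed_points C \<Longrightarrow> ?\<eta> Q - f \<in> Q" unfolding null_def twist_0 by blast
    have "f \<in> range \<iota>"
    proof (rule stable_imp_constant)
      fix v assume v: "v \<in> H0 C \<omega>"
      have "f * v \<in> \<omega> Q" if Q: "Q \<in> closed_points C" for Q
      proof -
        note RQ = subring_closed[OF closed_pointD'(3)[OF Q]]
        have vQ: "v / gen Q \<in> Q" using omega_stalk[OF v Q] .
        have "f * (v / gen Q) \<in> Q"
        proof (cases "Q = P")
          case True
          have yf: "y - f \<in> P" using f[OF P] by simp
          have "y * (v / ?u) - (y - f) * (v / ?u) \<in> P"
            using R(3)[OF yv[OF v] R(4)[OF yf vQ[unfolded True]]] .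
          also have "y * (v / ?u) - (y - f) * (v / ?u) = f * (v / ?u)"
            unfolding left_diff_distrib[symmetric] by simp
          finally show ?thesis unfolding True .
        next
          case False
          then have "f \<in> Q" using f[OF Q] RQ(5)[of "- f"] by simp
          then show ?thesis using RQ(4) vQ by blast
        qed
        then show ?thesis using gen(2)[OF Q] by simp
      qed
      then show "f * v \<in> H0 C \<omega>" by (simp add: H0_def)
    qed
    then have "f \<in> P" using M(2) by blast
    then have "(y - f) + f \<in> P" using f[OF P] R(6)[of "y - f" f] by simp
    then show "y \<in> P" by simp
  qed
  define S2 where "S2 = (\<lambda>(a, b). a * b) ` (S \<times> S)"
  have S2: "finite S2" "S2 \<subseteq> P"
  proof -
    show "finite S2" by (simp add: S2_def S_def)
    show "S2 \<subseteq> P" unfolding S2_def using R(4) subsetD[OF SP] by auto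
  qed
  have span_le: "module_span P S2 \<subseteq> U"
    if sub: "subspace U" and mem: "\<And>a s. a \<in> P \<Longrightarrow> s \<in> S2 \<Longrightarrow> a * s \<in> U" for U
  proof
    fix x assume "x \<in> module_span P S2"
    then obtain c where c: "x = (\<Sum>s\<in>S2. c s * s)" "\<forall>s\<in>S2. c s \<in> P" unfolding module_span_def by blast
    show "x \<in> U" unfolding c(1) by (intro subspace_sum[OF sub] mem) (use c(2) in auto)
  qed
  define L where "L = (\<lambda>Q. if Q = P then module_span P S2 else Q)"
  have coh: "coherent L"
    unfolding coherent_def
  proof (intro conjI ballI)
    fix Q assume Q: "Q \<in> closed_points C"
    show "\<exists>S. finite S \<and> L Q = module_span Q S"
    proof (cases "Q = P")
      case True
      then show ?thesis using S2(1) by (auto simp: L_def)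
    next
      case False
      have "Q = module_span Q {1}"
      proof (intro antisym subsetI)
        fix x assume "x \<in> Q"
        then show "x \<in> module_span Q {1}" by (auto simp: module_span_def intro!: exI[of _ "\<lambda>_. x"])
      qed (auto simp: module_span_def)
      then show ?thesis using False by (auto simp: L_def intro!: exI[of _ "{1}"])
    qed
    show "\<forall>x. \<exists>b\<in>Q. b \<noteq> 0 \<and> b * x \<in> L Q"
    proof
      fix x
      obtain a b where ab: "a \<in> Q" "b \<in> Q" "b \<noteq> 0" "x = a / b"
        using fraction_at_point[OF closed_pointD(1)[OF Q]] .
      show "\<exists>b\<in>Q. b \<noteq> 0 \<and> b * x \<in> L Q"
      proof (cases "Q = P")
        case True
        have "w 0 \<noteq> 0" using omega_basis(2) g_ge_2 dependent_zero by force
        then obtain s where s: "s \<in> S" "s \<noteq> 0" using u g_ge_2 by (force simp: S_def)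
        then have s2: "s * s \<in> S2" "s * s \<noteq> 0" by (auto simp: S2_def)
        have "a * (s * s) \<in> module_span P S2"
          using module_span_closed(3,4)[OF P'(3)] S2(1) s2(1) ab(1) True by blast
        then have "(s * s * b) * x \<in> L Q" using True ab by (simp add: L_def mult.commute)
        moreover have "s * s * b \<in> Q" using True ab S2(2) s2(1) R(4) by blast
        ultimately show ?thesis using s2(2) ab(3) by (intro bexI[of _ "s * s * b"]) auto
      next
        case False
        then show ?thesis using ab by (intro bexI[of _ b]) (auto simp: L_def)
      qed
    qed
  next
    show "finite {Q \<in> closed_points C. L Q \<noteq> Q}"
      by (rule finite_subset[of _ "{P}"]) (auto simp: L_def)
  qed
  have scalars: "\<exists>c. z - \<iota> c \<in> module_span P S2" if z: "z \<in> P" for z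
  proof -
    let ?\<eta> = "\<lambda>Q. if Q = P then z else 0"
    have ad: "?\<eta> \<in> adele L"
      using subspace_closed(1)[OF coherent_subspace[OF coh]] by (intro skyscraper_adele) blast
    have "?\<eta> \<in> null L"
    proof (rule ccontr)
      assume "?\<eta> \<notin> null L"
      then obtain c where c: "c \<in> hom L \<omega>" "tr (\<lambda>Q. c * ?\<eta> Q) \<noteq> 0"
        using separated_by_trace[OF coh _ ad] by blast
      have "c / ?u * s \<in> P" if "s \<in> S2" for s
      proof -
        have "s \<in> L P" using module_span_closed(4)[OF P'(3) S2(1) that] by (simp add: L_def)
        then have "c * s \<in> \<omega> P" using c(1) P by (auto simp: hom_def)
        then show ?thesis using gen(2)[OF P] by simp
      qed
      then have "c / ?u * a * b \<in> P" if "a \<in> S" "b \<in> S" for a b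
        using that by (force simp: S2_def mult.assoc)
      then have "c / ?u \<in> P" using reflexive by blast
      then have "c * z / ?u \<in> P" using R(4)[OF _ z, of "c / ?u"] by simp
      then have "c * z \<in> \<omega> P" using gen(2)[OF P] by simp
      then show False using tr_null[OF skyscraper_null] c(2) by blast
    qed
    then obtain f where f: "\<And>Q. Q \<in> closed_points C \<Longrightarrow> ?\<eta> Q - f \<in> L Q" unfolding null_def by blast
    have zf: "z - f \<in> module_span P S2" using f[OF P] by (simp add: L_def)
    have "module_span P S2 \<subseteq> P" using S2(2) R(4) M(8) by (intro span_le) auto
    then have "z - (z - f) \<in> P" using zf R(3)[OF z] by blast
    then have fP: "f \<in> P" by simp
    have "f \<in> Q" if Q: "Q \<in> closed_points C" for Q
    proof (cases "Q = P")
      case False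
      then show ?thesis using f[OF Q] subring_closed(5)[OF closed_pointD'(3)[OF Q], of "- f"] by (simp add: L_def)
    qed (use fP in simp)
    then have "f \<in> H0 C (twist 0)" by (simp add: H0_def twist_0)
    then show ?thesis using zf unfolding H0_structure_sheaf by blast
  qed
  \<comment> \<open>At a place above \<open>P\<close>, the elements of \<open>I\<^sup>2\<close> have larger value than the element \<open>v / gen P\<close> of \<open>I\<close>.\<close>
  obtain V where V: "place V" "dominates V P" using rational_dominating_place[OF P'(1)] .
  note V' = local_subringD[OF place_local[OF V(1)]]
  obtain v where v: "v \<in> H0 C \<omega>" "v \<noteq> 0" "\<And>y. y \<in> H0 C \<omega> \<Longrightarrow> y / v \<in> V"
    using leading_element[OF V(1) has_dim_omega] g_ge_2 by auto
  obtain c where c: "v / ?u - \<iota> c \<in> module_span P S2" using scalars[OF omega_stalk[OF v(1) P]] by blast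
  have S2_max: "a * s \<in> max_ideal P" if a: "a \<in> P" and "s \<in> S2" for a s
  proof -
    obtain b b' where "s = b * b'" "b \<in> S" "b' \<in> S" using \<open>s \<in> S2\<close> by (auto simp: S2_def)
    then show ?thesis using M(4)[OF a M(4)[OF subsetD[OF SP] S_max]] by blast
  qed
  have "module_span P S2 \<subseteq> max_ideal P" using S2_max M(9) by (intro span_le)
  then have "v / ?u - (v / ?u - \<iota> c) \<in> max_ideal P" using M(7)[OF bad[OF v(1)]] c by blast
  then have "c = 0" using iota_notin_max_ideal[OF P'(2), of c] by auto
  then have vS2: "v / ?u \<in> module_span P S2" using c by simp
  have "module_span P S2 \<subseteq> {z. z / (v / ?u) \<in> max_ideal V}"
  proof (rule span_le[OF subspace_quotient[OF V'(9)]])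
    fix a s assume a: "a \<in> P" and "s \<in> S2"
    then obtain i j where ij: "i < g" "j < g" "s = (w i / ?u) * (w j / ?u)" by (auto simp: S2_def S_def)
    have "w i / ?u \<in> max_ideal V" using bad[OF omega_basis(1)[OF ij(1)]] V(2) unfolding dominates_def by blast
    moreover have "a \<in> V" using a V(2) unfolding dominates_def by blast
    then have "a * (w j / v) \<in> V" using subring_closed(4)[OF V'(1)] v(3)[OF omega_basis(1)[OF ij(2)]] by blast
    ultimately have "(a * (w j / v)) * (w i / ?u) \<in> max_ideal V" using V'(4) by blast
    moreover have "(a * (w j / v)) * (w i / ?u) = a * s / (v / ?u)"
      using u v(2) ij(3) by (simp add: ac_simps)
    ultimately show "a * s \<in> {z. z / (v / ?u) \<in> max_ideal V}" by (simp only: mem_Collect_eq)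
  qed
  then have "(v / ?u) / (v / ?u) \<in> max_ideal V" using vS2 by blast
  then show False using V'(6) v(2) u by simp
qed

section \<open>Noether's theorem\<close>

text \<open>Divide by a section that generates the stalk of \<open>\<omega>\<close> at \<open>P\<close>.\<close>

lemma null_from_products:
  assumes "\<And>v P. v \<in> H0 C \<omega> \<Longrightarrow> P \<in> closed_points C \<Longrightarrow> v * (\<xi> P - \<phi>) \<in> twist m P"
  shows "\<xi> \<in> null (twist (m - 1))"
proof -
  have "\<xi> P - \<phi> \<in> twist (m - 1) P" if P: "P \<in> closed_points C" for P
  proof -
    obtain v where v: "v \<in> H0 C \<omega>" "v / gen P \<in> P" "v / gen P \<notin> max_ideal P" using base_point_free[OF P] .
    have e: "inverse (v / gen P) \<in> P" "v / gen P \<noteq> 0" using unit_inverse[OF v(2,3)] by auto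
    have "inverse (v / gen P) * (v * (\<xi> P - \<phi>) / gen P powi m) \<in> P"
      using subring_closed(4)[OF closed_pointD'(3)[OF P] e(1)] assms[OF v(1) P] unfolding twist_def by blast
    also have "inverse (v / gen P) * (v * (\<xi> P - \<phi>) / gen P powi m) = (\<xi> P - \<phi>) / gen P powi (m - 1)"
      using e(2) gen(1)[OF P] by (simp add: power_int_diff field_simps)
    finally show ?thesis by (simp add: twist_def)
  qed
  then show ?thesis unfolding null_def by blast
qed

text \<open>The rational functions with the principal parts \<open>v * \<xi>\<close> are chosen for the basis and extended linearly.\<close>

lemma linear_lift:
  assumes "\<And>v. v \<in> H0 C \<omega> \<Longrightarrow> (\<lambda>P. v * \<xi> P) \<in> null (twist m)"
  obtains F where "klinear F"
    "\<And>v P. v \<in> H0 C \<omega> \<Longrightarrow> P \<in> closed_points C \<Longrightarrow> v * \<xi> P - F v \<in> twist m P"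
proof -
  interpret vp: vector_space_pair "\<lambda>c x. \<iota> c * x" "\<lambda>c x. \<iota> c * x" by unfold_locales
  have "\<exists>f. \<forall>P\<in>closed_points C. v * \<xi> P - f \<in> twist m P" if "v \<in> H0 C \<omega>" for v
    using assms[OF that] by (simp add: null_def)
  then obtain h where h: "\<And>v P. v \<in> H0 C \<omega> \<Longrightarrow> P \<in> closed_points C \<Longrightarrow> v * \<xi> P - h v \<in> twist m P" by metis
  obtain F where F: "klinear F" "\<forall>x\<in>w ` {..<g}. F x = h x"
    using vp.linear_independent_extend[OF omega_basis(2)] by blast
  interpret F: Vector_Spaces.linear "\<lambda>c x. \<iota> c * x" "\<lambda>c x. \<iota> c * x" F by fact
  have "v * \<xi> P - F v \<in> twist m P" if v: "v \<in> H0 C \<omega>" and P: "P \<in> closed_points C" for v P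
  proof -
    note cl = subspace_closed[OF twist_closed(1)[OF P]]
    have "subspace {v. v * \<xi> P - F v \<in> twist m P}"
    proof (rule subspaceI)
      show "0 \<in> {v. v * \<xi> P - F v \<in> twist m P}" using cl(1) by (simp add: F.zero)
      show "x + y \<in> {v. v * \<xi> P - F v \<in> twist m P}"
        if "x \<in> {v. v * \<xi> P - F v \<in> twist m P}" "y \<in> {v. v * \<xi> P - F v \<in> twist m P}" for x y
        using that cl(2)[of "x * \<xi> P - F x" m "y * \<xi> P - F y"] by (simp add: F.add algebra_simps)
      show "\<iota> c * x \<in> {v. v * \<xi> P - F v \<in> twist m P}" if "x \<in> {v. v * \<xi> P - F v \<in> twist m P}" for c x
        using that cl(3)[of "x * \<xi> P - F x" m c] by (simp add: F.scale right_diff_distrib mult.assoc)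
    qed
    moreover have "w ` {..<g} \<subseteq> {v. v * \<xi> P - F v \<in> twist m P}"
      using F(2) h[OF omega_basis(1) P] by auto
    ultimately have "H0 C \<omega> \<subseteq> {v. v * \<xi> P - F v \<in> twist m P}" using omega_basis(4) span_minimal by blast
    then show ?thesis using v by blast
  qed
  then show thesis using that F(1) by blast
qed

lemma linear_minus_mult:
  assumes "klinear F"
  shows "klinear (\<lambda>v. F v - \<phi> * v)"
proof -
  interpret F: Vector_Spaces.linear "\<lambda>c x. \<iota> c * x" "\<lambda>c x. \<iota> c * x" F by fact
  show ?thesis by (rule linearI) (simp_all add: F.add F.scale right_diff_distrib distrib_left mult.left_commute)
qed

text \<open>With \<open>\<phi> = F v0 / v0\<close>, the map \<open>\<Psi>\<close> has \<open>v0\<close> in its kernel \<open>A\<close>, and it suffices that its image \<open>B\<close> is zero. The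
  products of elements of \<open>A\<close> and \<open>B\<close> are sections of the power \<open>m + 1\<close>. If \<open>m < - 1\<close>, then there are no
  such sections except 0. If \<open>m = - 1\<close>, then they are constant, and Hopf's inequality would give
  \<open>g = dim A + dim B \<le> 2\<close>.\<close>

lemma null_of_products_negative:
  assumes prod: "\<And>v. v \<in> H0 C \<omega> \<Longrightarrow> (\<lambda>P. v * \<xi> P) \<in> null (twist m)" and m: "m < 0" and g: "g \<ge> 3"
  shows "\<xi> \<in> null (twist (m - 1))"
proof -
  obtain F where F: "klinear F"
    "\<And>v P. v \<in> H0 C \<omega> \<Longrightarrow> P \<in> closed_points C \<Longrightarrow> v * \<xi> P - F v \<in> twist m P"
    using linear_lift[of \<xi> m] prod by blast
  obtain v0 where v0: "v0 \<in> H0 C \<omega>" "v0 \<noteq> 0" using has_dim_nonzero[OF has_dim_omega] g_ge_2 by auto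
  define \<phi> where "\<phi> = F v0 / v0"
  define \<Psi> where "\<Psi> v = F v - \<phi> * v" for v
  have lin: "klinear \<Psi>"
    unfolding \<Psi>_def by (rule linear_minus_mult[OF F(1)])
  obtain a b where ab: "has_dim {v \<in> H0 C \<omega>. \<Psi> v = 0} a" "has_dim (\<Psi> ` H0 C \<omega>) b" "a + b = g"
    using rank_nullity[OF has_dim_omega lin] .
  have v0A: "v0 \<in> {v \<in> H0 C \<omega>. \<Psi> v = 0}" using v0 by (simp add: \<Psi>_def \<phi>_def)
  have "a \<noteq> 0"
  proof
    assume "a = 0"
    then have "{v \<in> H0 C \<omega>. \<Psi> v = 0} = {0}" using ab(1) has_dim_zeroD by simp
    then show False using v0A v0(2) by blast
  qed
  have prod: "v * \<Psi> v' \<in> H0 C (twist (m + 1))" if v: "v \<in> {v \<in> H0 C \<omega>. \<Psi> v = 0}" and v': "v' \<in> H0 C \<omega>" for v v'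
  proof -
    have vV: "v \<in> H0 C \<omega>" "F v = \<phi> * v" using v by (auto simp: \<Psi>_def)
    have "v * \<Psi> v' \<in> twist (m + 1) P" if P: "P \<in> closed_points C" for P
    proof -
      have 1: "v' \<in> twist 1 P" "v \<in> twist 1 P" using v' vV(1) P twist_1[OF P] by (auto simp: H0_def)
      have "(v * \<xi> P - F v) * v' - (v' * \<xi> P - F v') * v \<in> twist (m + 1) P"
        using subspace_closed(4)[OF twist_closed(1)[OF P] twist_mult[OF P F(2)[OF vV(1) P] 1(1)]
          twist_mult[OF P F(2)[OF v' P] 1(2)]] .
      also have "(v * \<xi> P - F v) * v' - (v' * \<xi> P - F v') * v = v * \<Psi> v'"
        unfolding \<Psi>_def vV(2) by (simp add: algebra_simps)
      finally show ?thesis .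
    qed
    then show ?thesis by (simp add: H0_def)
  qed
  have "b = 0"
  proof (rule ccontr)
    assume "b \<noteq> 0"
    show False
    proof (cases "m = - 1")
      case True
      have "a + b \<le> 1 + 1"
      proof (rule dim_product[OF ab(1) _ ab(2) _ has_dim_1[of 1]])
        show "x * y \<in> span {1}" if "x \<in> {v \<in> H0 C \<omega>. \<Psi> v = 0}" "y \<in> \<Psi> ` H0 C \<omega>" for x y
        proof -
          obtain v' where "v' \<in> H0 C \<omega>" "y = \<Psi> v'" using \<open>y \<in> \<Psi> ` H0 C \<omega>\<close> by blast
          then have "x * y \<in> range \<iota>" using prod[OF that(1)] True H0_structure_sheaf by fastforce
          then show ?thesis by (simp add: span_singleton)
        qed
      qed (use \<open>a \<noteq> 0\<close> \<open>b \<noteq> 0\<close> in auto)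
      then show False using ab(3) g by simp
    next
      case False
      obtain y where y: "y \<in> \<Psi> ` H0 C \<omega>" "y \<noteq> 0" using has_dim_nonzero[OF ab(2)] \<open>b \<noteq> 0\<close> by auto
      then have "v0 * y \<in> H0 C (twist (m + 1))" using prod[OF v0A] by blast
      then show False using H0_negative[of "m + 1"] m False y(2) v0(2) by simp
    qed
  qed
  then have \<Psi>0: "\<Psi> v = 0" if "v \<in> H0 C \<omega>" for v using ab(2) that has_dim_zeroD by blast
  show ?thesis
  proof (rule null_from_products[of \<xi> \<phi>])
    fix v P assume v: "v \<in> H0 C \<omega>" and P: "P \<in> closed_points C"
    have "v * (\<xi> P - \<phi>) = v * \<xi> P - F v" using \<Psi>0[OF v] by (simp add: \<Psi>_def algebra_simps)
    then show "v * (\<xi> P - \<phi>) \<in> twist m P" using F(2)[OF v P] by simp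
  qed
qed

lemma range_iota_subspace: "subspace (range \<iota>)"
  using H0_subspace[of 0] H0_structure_sheaf by simp

text \<open>Here the lifts \<open>F v\<close> are determined only up to constants. This freedom is used to let the lift of some
  section \<open>v0\<close> that vanishes at a point \<open>P\<close> vanish at \<open>P\<close>, too. The products of \<open>A = {v. \<Psi> v constant}\<close> and
  \<open>B = \<Psi>(V) + k\<close> lie in \<open>V = H0 C \<omega>\<close>, and \<open>dim A + dim B = g + 1\<close>. If \<open>A\<close> were spanned by \<open>v0\<close>, then \<open>V = v0 * B\<close>,
  and all sections would vanish at \<open>P\<close>. If \<open>B\<close> consists of constants, then \<open>\<xi>\<close> is null. In the remaining case
  \<open>V\<close> is a progression by \<open>product_equality\<close>.\<close>

lemma null_of_products_zero:
  assumes prod: "\<And>v. v \<in> H0 C \<omega> \<Longrightarrow> (\<lambda>P. v * \<xi> P) \<in> null (twist 0)"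
    and not_progression: "\<And>u x. u \<noteq> 0 \<Longrightarrow> x \<notin> range \<iota> \<Longrightarrow> H0 C \<omega> \<noteq> progression u x g"
  shows "\<xi> \<in> null (twist (- 1))"
proof -
  obtain F where F: "klinear F"
    "\<And>v P. v \<in> H0 C \<omega> \<Longrightarrow> P \<in> closed_points C \<Longrightarrow> v * \<xi> P - F v \<in> P"
    using linear_lift[of \<xi> 0] prod unfolding twist_0 by blast
  obtain P where P: "P \<in> closed_points C" using closed_point_exists .
  note P' = closed_pointD'[OF P]
  note R = subring_closed[OF P'(3)] and M = local_subringD[OF P'(2)]
  have res: "\<exists>c. x - \<iota> c \<in> max_ideal P" if "x \<in> P" for x using P'(1) that by (simp add: rational_def)
  obtain v0 where v0: "v0 \<in> H0 C \<omega>" "v0 \<noteq> 0" "v0 / gen P \<in> max_ideal P"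
  proof -
    obtain v where v: "v \<in> H0 C \<omega>" "v \<noteq> 0" using has_dim_nonzero[OF has_dim_omega] g_ge_2 by auto
    obtain v' where v': "v' \<in> H0 C \<omega>" "v' \<notin> span {v}"
      using has_dim_not_multiple[OF has_dim_omega g_ge_2 v(1)] .
    obtain c c' where c: "v / gen P - \<iota> c \<in> max_ideal P" "v' / gen P - \<iota> c' \<in> max_ideal P"
      using res omega_stalk[OF v(1) P] omega_stalk[OF v'(1) P] by blast
    show thesis
    proof (cases "c = 0")
      case True
      then show thesis using that v c(1) by simp
    next
      case False
      let ?z = "v' - \<iota> (c' / c) * v"
      have "?z \<in> H0 C \<omega>" using subspace_closed[OF omega_subspace] v(1) v'(1) by blast
      moreover have "?z \<noteq> 0" using v'(2) by (auto simp: span_singleton)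
      moreover have "?z / gen P \<in> max_ideal P"
      proof -
        have "(v' / gen P - \<iota> c') - \<iota> (c' / c) * (v / gen P - \<iota> c) \<in> max_ideal P"
          using M(7)[OF c(2) M(4)[OF M(2) c(1)]] .
        also have "(v' / gen P - \<iota> c') - \<iota> (c' / c) * (v / gen P - \<iota> c) = ?z / gen P"
          using False by (simp add: right_diff_distrib diff_divide_distrib flip: iota_mult)
        finally show ?thesis .
      qed
      ultimately show thesis using that by blast
    qed
  qed
  obtain c0 where c0: "v0 * \<xi> P - F v0 - \<iota> c0 \<in> max_ideal P" using res[OF F(2)[OF v0(1) P]] by blast
  define \<phi> where "\<phi> = (F v0 + \<iota> c0) / v0"
  define \<Psi> where "\<Psi> v = F v - \<phi> * v" for v
  have lin: "klinear \<Psi>"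
    unfolding \<Psi>_def by (rule linear_minus_mult[OF F(1)])
  interpret \<Psi>: Vector_Spaces.linear "\<lambda>c x. \<iota> c * x" "\<lambda>c x. \<iota> c * x" \<Psi> by fact
  have \<Psi>v0: "\<Psi> v0 = - \<iota> c0" using v0(2) by (simp add: \<Psi>_def \<phi>_def)
  have one_const: "1 \<in> range \<iota>" and zero_const: "0 \<in> range \<iota>" by (metis iota_1 rangeI, metis iota_0 rangeI)
  define A where "A = {v \<in> H0 C \<omega>. \<Psi> v \<in> range \<iota>}"
  define B where "B = span (insert 1 (\<Psi> ` H0 C \<omega>))"
  obtain k l where kl: "has_dim {v \<in> H0 C \<omega>. \<Psi> v = 0} k" "has_dim (\<Psi> ` H0 C \<omega>) l" "k + l = g"
    using rank_nullity[OF has_dim_omega lin] .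
  have subA: "subspace A"
    unfolding A_def using subspace_inter[OF omega_subspace \<Psi>.subspace_linear_preimage[OF range_iota_subspace]]
    by (simp add: Int_def)
  \<comment> \<open>Passing from the kernel of \<open>\<Psi>\<close> to \<open>A\<close>, or from its image to \<open>B\<close>, raises the dimension by one, depending on
    whether the image contains the constants.\<close>
  obtain a b where ab: "has_dim A a" "has_dim B b" "a + b = g + 1"
  proof (cases "1 \<in> \<Psi> ` H0 C \<omega>")
    case True
    then obtain v1 where v1: "v1 \<in> H0 C \<omega>" "\<Psi> v1 = 1" by auto
    have Bimg: "B = \<Psi> ` H0 C \<omega>"
      unfolding B_def insert_absorb[OF True] using has_dim_subspace[OF kl(2)] by simp
    have Aspan: "A = span (insert v1 {v \<in> H0 C \<omega>. \<Psi> v = 0})"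
    proof (rule span_subspace[OF _ _ subA, symmetric])
      show "insert v1 {v \<in> H0 C \<omega>. \<Psi> v = 0} \<subseteq> A" using v1 one_const zero_const unfolding A_def by auto
      show "A \<subseteq> span (insert v1 {v \<in> H0 C \<omega>. \<Psi> v = 0})"
      proof
        fix v assume "v \<in> A"
        then obtain c where c: "v \<in> H0 C \<omega>" "\<Psi> v = \<iota> c" by (auto simp: A_def)
        have "v - \<iota> c * v1 \<in> H0 C \<omega>"
          using subspace_closed(4)[OF omega_subspace c(1) subspace_closed(3)[OF omega_subspace v1(1)]] .
        moreover have "\<Psi> (v - \<iota> c * v1) = 0" by (simp only: \<Psi>.diff \<Psi>.scale c(2) v1(2)) simp
        ultimately have "v - \<iota> c * v1 \<in> span {v \<in> H0 C \<omega>. \<Psi> v = 0}" by (intro span_base CollectI conjI)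
        then show "v \<in> span (insert v1 {v \<in> H0 C \<omega>. \<Psi> v = 0})"
          unfolding span_insert by (intro CollectI exI[of _ c])
      qed
    qed
    have "v1 \<notin> {v \<in> H0 C \<omega>. \<Psi> v = 0}" using v1(2) by simp
    then have "has_dim A (Suc k)" unfolding Aspan by (rule has_dim_insert[OF kl(1)])
    moreover have "has_dim B l" unfolding Bimg by (rule kl(2))
    ultimately show thesis by (rule that) (use kl(3) in simp)
  next
    case False
    have "A = {v \<in> H0 C \<omega>. \<Psi> v = 0}"
    proof (intro antisym subsetI)
      fix v assume "v \<in> A"
      then obtain c where c: "v \<in> H0 C \<omega>" "\<Psi> v = \<iota> c" by (auto simp: A_def)
      have "c = 0"
      proof (rule ccontr)
        assume "c \<noteq> 0"
        then have "\<Psi> (\<iota> (inverse c) * v) = 1" using c(2) by (simp add: \<Psi>.scale flip: iota_mult)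
        moreover have "\<iota> (inverse c) * v \<in> H0 C \<omega>" using c(1) subspace_closed(3)[OF omega_subspace] by blast
        ultimately show False using False by (metis image_eqI)
      qed
      then show "v \<in> {v \<in> H0 C \<omega>. \<Psi> v = 0}" using c by simp
    next
      fix v assume "v \<in> {v \<in> H0 C \<omega>. \<Psi> v = 0}"
      then show "v \<in> A" unfolding A_def using iota_0 by (metis (mono_tags, lifting) mem_Collect_eq rangeI)
    qed
    then have "has_dim A k" using kl(1) by simp
    moreover have "has_dim B (Suc l)" unfolding B_def by (rule has_dim_insert[OF kl(2) False])
    ultimately show thesis by (rule that) (use kl(3) in simp)
  qed
  have BE: "\<exists>v c. v \<in> H0 C \<omega> \<and> y = \<Psi> v + \<iota> c" if yB: "y \<in> B" for y
  proof -
    obtain c where "y - \<iota> c * 1 \<in> span (\<Psi> ` H0 C \<omega>)" using yB unfolding B_def span_insert by blast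
    then have "y - \<iota> c \<in> \<Psi> ` H0 C \<omega>"
      using span_eq_iff[THEN iffD2, OF has_dim_subspace[OF kl(2)]] by simp
    then obtain v where v: "v \<in> H0 C \<omega>" "y - \<iota> c = \<Psi> v" by blast
    have "y = \<Psi> v + \<iota> c" using v(2)[symmetric] by simp
    then show ?thesis using v(1) by blast
  qed
  \<comment> \<open>Multiplication by \<open>v \<in> A\<close> turns \<open>\<xi> - \<phi>\<close> into a regular function.\<close>
  have A_regular: "v * (\<xi> Q - \<phi>) \<in> Q" if v: "v \<in> H0 C \<omega>" "\<Psi> v \<in> range \<iota>" and Q: "Q \<in> closed_points C" for v Q
  proof -
    obtain c where c: "\<Psi> v = \<iota> c" using v(2) by blast
    have "(v * \<xi> Q - F v) + \<Psi> v \<in> Q"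
      unfolding c by (rule subring_closed(6)[OF closed_pointD'(3)[OF Q] F(2)[OF v(1) Q] local_subringD(2)[OF closed_pointD'(2)[OF Q]]])
    then show ?thesis by (simp add: \<Psi>_def algebra_simps)
  qed
  have AB: "v * y \<in> H0 C \<omega>" if v: "v \<in> A" and y: "y \<in> B" for v y
  proof -
    obtain v' c where v': "v' \<in> H0 C \<omega>" "y = \<Psi> v' + \<iota> c" using BE[OF y] by blast
    have vV: "v \<in> H0 C \<omega>" "\<Psi> v \<in> range \<iota>" using v by (auto simp: A_def)
    have "v * y \<in> twist 1 Q" if Q: "Q \<in> closed_points C" for Q
    proof -
      note cl = subspace_closed[OF twist_closed(1)[OF Q]]
      have 1: "v' \<in> twist 1 Q" "v \<in> twist 1 Q" using v'(1) vV(1) Q twist_1[OF Q] by (auto simp: H0_def)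
      have "(v * (\<xi> Q - \<phi>)) * v' - (v' * \<xi> Q - F v') * v + \<iota> c * v \<in> twist 1 Q"
        using cl(2)[OF cl(4)[OF twist_closed(2)[OF Q 1(1) A_regular[OF vV Q]] twist_closed(2)[OF Q 1(2) F(2)[OF v'(1) Q]]]
          cl(3)[OF 1(2)]] .
      also have "(v * (\<xi> Q - \<phi>)) * v' - (v' * \<xi> Q - F v') * v + \<iota> c * v = v * y"
        unfolding v'(2) \<Psi>_def by (simp add: algebra_simps)
      finally show ?thesis .
    qed
    then show ?thesis unfolding H0_omega by (simp add: H0_def)
  qed
  have v0A: "v0 \<in> A" unfolding A_def using v0(1) \<Psi>v0 by (auto simp flip: iota_minus)
  have oneB: "1 \<in> B" unfolding B_def by (simp add: span_base)
  have "a \<noteq> 0"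
  proof
    assume "a = 0"
    then have "A = {0}" using ab(1) has_dim_zeroD by simp
    then show False using v0A v0(2) by blast
  qed
  have "b \<noteq> 0"
  proof
    assume "b = 0"
    then have "B = {0}" using ab(2) has_dim_zeroD by simp
    then show False using oneB by simp
  qed
  consider "a = 1" | "b = 1" | "a \<ge> 2" "b \<ge> 2" using \<open>a \<noteq> 0\<close> \<open>b \<noteq> 0\<close> by linarith
  then show ?thesis
  proof cases
    case 1
    then have b: "has_dim B g" using ab by simp
    \<comment> \<open>Now \<open>v0 * B\<close> is the whole space, although its elements vanish at \<open>P\<close>.\<close>
    have "(\<lambda>y. v0 * y) ` B \<subseteq> H0 C \<omega>" using AB[OF v0A] by blast
    then have eq: "(\<lambda>y. v0 * y) ` B = H0 C \<omega>"
      using has_dim_subset[OF has_dim_omega has_dim_subspace] has_dim_scale[OF b v0(2)] has_dim_unique by metis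
    obtain v where v: "v \<in> H0 C \<omega>" "v / gen P \<notin> max_ideal P" using base_point_free[OF P] by blast
    then obtain y where y: "y \<in> B" "v = v0 * y" using eq by blast
    then obtain v' c where v': "v' \<in> H0 C \<omega>" "y = \<Psi> v' + \<iota> c" using BE by blast
    have "v0 * (\<xi> P - \<phi>) = v0 * \<xi> P - F v0 - \<iota> c0" using v0(2) by (simp add: \<phi>_def field_simps)
    then have 0: "v0 * (\<xi> P - \<phi>) \<in> max_ideal P" using c0 by simp
    have "(v' / gen P) * (v0 * (\<xi> P - \<phi>)) - (v' * \<xi> P - F v') * (v0 / gen P) + \<iota> c * (v0 / gen P) \<in> max_ideal P"
      using M(3)[OF M(7)[OF M(4)[OF omega_stalk[OF v'(1) P] 0] M(4)[OF F(2)[OF v'(1) P] v0(3)]] M(4)[OF M(2) v0(3)]] .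
    also have "(v' / gen P) * (v0 * (\<xi> P - \<phi>)) - (v' * \<xi> P - F v') * (v0 / gen P) + \<iota> c * (v0 / gen P) = v / gen P"
      unfolding y(2) v'(2) \<Psi>_def using gen(1)[OF P] by (simp add: field_simps)
    finally show ?thesis using v(2) by blast
  next
    case 2
    have "B = range \<iota>"
    proof -
      have "has_dim B 1" using ab(2) 2 by simp
      then obtain x where x: "x \<noteq> 0" "\<And>y. y \<in> B \<Longrightarrow> \<exists>c. y = \<iota> c * x" using has_dim_oneD by metis
      obtain c where c: "1 = \<iota> c * x" using x(2)[OF oneB] by blast
      then have "c \<noteq> 0" by auto
      then have "x = \<iota> (inverse c)" unfolding iota_inverse using c by (metis inverse_unique)
      then have "B \<subseteq> range \<iota>" using x(2) by (metis iota_mult rangeI subsetI)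
      moreover have "\<iota> d \<in> B" for d using span_scale[OF oneB[unfolded B_def], of d] unfolding B_def by simp
      ultimately show ?thesis by blast
    qed
    then have const: "\<Psi> v \<in> range \<iota>" if "v \<in> H0 C \<omega>" for v
    proof -
      have "\<Psi> v \<in> B" unfolding B_def using that by (intro span_base insertI2 imageI)
      then show ?thesis using \<open>B = range \<iota>\<close> by simp
    qed
    have "\<xi> \<in> null (twist (0 - 1))"
      by (rule null_from_products[of \<xi> \<phi>]) (use A_regular[OF _ const] in \<open>simp add: twist_0\<close>)
    then show ?thesis by simp
  next
    case 3
    obtain u x where "u \<noteq> 0" "x \<notin> range \<iota>" "H0 C \<omega> = progression u x g"
      using product_equality[OF ab(1) 3(1) ab(2) 3(2) has_dim_omega _ AB] ab(3) by auto
    then show ?thesis using not_progression by blast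
  qed
qed

definition monomial_value :: "(nat \<Rightarrow> nat) \<Rightarrow> 'a" where
  "monomial_value m = (\<Prod>i<g. w i ^ m i)"

text \<open>The image of \<open>Sym\<^sup>n H\<^sup>0(\<omega>)\<close>.\<close>

definition products :: "nat \<Rightarrow> 'a set" where
  "products n = span (monomial_value ` monomials g n)"

lemma products_mult:
  assumes v: "v \<in> H0 C \<omega>" and x: "x \<in> products n" shows "v * x \<in> products (Suc n)"
proof -
  have 1: "w i * monomial_value m \<in> products (Suc n)" if i: "i < g" and m: "m \<in> monomials g n" for i m
  proof -
    let ?m = "m(i := Suc (m i))"
    have "(\<Sum>j<g. ?m j) = ?m i + (\<Sum>j\<in>{..<g} - {i}. ?m j)" using i by (simp add: sum.remove[of _ i])
    also have "(\<Sum>j\<in>{..<g} - {i}. ?m j) = (\<Sum>j\<in>{..<g} - {i}. m j)" by (intro sum.cong) auto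
    also have "?m i + \<dots> = Suc (\<Sum>j<g. m j)" using i by (simp add: sum.remove[of _ i])
    finally have "?m \<in> monomials g (Suc n)" using m i by (auto simp: monomials_def vecs_def)
    moreover have "monomial_value ?m = w i * monomial_value m"
    proof -
      have "monomial_value ?m = w i ^ Suc (m i) * (\<Prod>j\<in>{..<g} - {i}. w j ^ ?m j)"
        unfolding monomial_value_def using i by (simp add: prod.remove[of _ i])
      also have "(\<Prod>j\<in>{..<g} - {i}. w j ^ ?m j) = (\<Prod>j\<in>{..<g} - {i}. w j ^ m j)" by (intro prod.cong) auto
      finally show ?thesis unfolding monomial_value_def using i by (simp add: prod.remove[of _ i])
    qed
    ultimately show ?thesis unfolding products_def by (metis imageI span_base)
  qed
  have sub: "subspace {x. y * x \<in> products (Suc n)}" for y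
  proof -
    have "subspace (products (Suc n))" by (simp add: products_def)
    note cl = subspace_closed[OF this]
    show ?thesis
      by (rule subspaceI) (simp_all add: cl(1,2) distrib_left mult.left_commute[of y] cl(3))
  qed
  have sub': "subspace {v. v * x \<in> products (Suc n)}"
    using sub[of x] by (simp add: mult.commute)
  have "w i * x \<in> products (Suc n)" if "i < g" for i
  proof -
    have "products n \<subseteq> {x. w i * x \<in> products (Suc n)}"
      unfolding products_def[of n] using 1[OF that] by (intro span_minimal sub) auto
    then show ?thesis using x by blast
  qed
  then have "H0 C \<omega> \<subseteq> {v. v * x \<in> products (Suc n)}"
    unfolding omega_basis(4)[symmetric] by (intro span_minimal sub') auto
  then show ?thesis using v by blast
qed

lemma one_in_products: "1 \<in> products 0"
  unfolding products_def monomial_value_def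
  by (rule span_base, rule image_eqI[of _ _ "\<lambda>_. 0"]) (auto simp: monomials_def vecs_def)

lemma products_1: "H0 C \<omega> \<subseteq> products 1"
  using products_mult[OF _ one_in_products] by auto

lemma productsE:
  assumes "x \<in> products n"
  obtains c where "x = (\<Sum>m\<in>monomials g n. \<iota> (c m) * monomial_value m)"
proof -
  have "products n \<subseteq> {\<Sum>m\<in>monomials g n. \<iota> (c m) * monomial_value m | c. True}" (is "_ \<subseteq> ?U")
    unfolding products_def
  proof (rule span_minimal)
    show "monomial_value ` monomials g n \<subseteq> ?U"
    proof
      fix y assume "y \<in> monomial_value ` monomials g n"
      then obtain m where m: "m \<in> monomials g n" "y = monomial_value m" by blast
      have "(\<Sum>m'\<in>monomials g n. \<iota> (if m' = m then 1 else 0) * monomial_value m')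
          = (\<Sum>m'\<in>monomials g n. if m' = m then monomial_value m' else 0)" by (intro sum.cong) auto
      also have "\<dots> = y" using m finite_monomials by simp
      finally have "y = (\<Sum>m'\<in>monomials g n. \<iota> (if m' = m then 1 else 0) * monomial_value m')" by simp
      then show "y \<in> ?U" by (intro CollectI exI[of _ "\<lambda>m'. if m' = m then 1 else 0"] conjI TrueI)
    qed
    show "subspace ?U"
    proof (rule subspaceI)
      show "0 \<in> ?U" by (intro CollectI exI[of _ "\<lambda>_. 0"]) simp
    next
      fix x y assume "x \<in> ?U" "y \<in> ?U"
      then obtain c d where cd: "x = (\<Sum>m\<in>monomials g n. \<iota> (c m) * monomial_value m)"
        "y = (\<Sum>m\<in>monomials g n. \<iota> (d m) * monomial_value m)" by blast
      have "x + y = (\<Sum>m\<in>monomials g n. \<iota> (c m + d m) * monomial_value m)"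
        unfolding cd iota_add distrib_right sum.distrib ..
      then show "x + y \<in> ?U" by (intro CollectI exI[of _ "\<lambda>m. c m + d m"] conjI TrueI)
    next
      fix a x assume "x \<in> ?U"
      then obtain c where c: "x = (\<Sum>m\<in>monomials g n. \<iota> (c m) * monomial_value m)" by blast
      have "\<iota> a * x = (\<Sum>m\<in>monomials g n. \<iota> (a * c m) * monomial_value m)"
        unfolding c iota_mult sum_distrib_left mult.assoc ..
      then show "\<iota> a * x \<in> ?U" by (intro CollectI exI[of _ "\<lambda>m. a * c m"] conjI TrueI)
    qed
  qed
  from subsetD[OF this assms]
  obtain c where "x = (\<Sum>m\<in>monomials g n. \<iota> (c m) * monomial_value m)" by (elim CollectE exE conjE)
  then show thesis by (rule that)
qed

lemma products_subset: "products n \<subseteq> H0 C (twist (int n))"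
  unfolding products_def
proof (rule span_minimal[OF _ H0_subspace], rule image_subsetI)
  fix m assume m: "m \<in> monomials g n"
  have "(\<Prod>i\<in>I. w i ^ m i) \<in> H0 C (twist (int (\<Sum>i\<in>I. m i)))" if "finite I" "I \<subseteq> {..<g}" for I
    using that
  proof (induction I rule: finite_induct)
    case empty
    have "1 \<in> range \<iota>" using iota_1 by (metis rangeI)
    then show ?case by (simp add: H0_structure_sheaf)
  next
    case (insert i I)
    have "w i ^ k \<in> H0 C (twist (int k))" for k
    proof (induction k)
      case 0
      have "1 \<in> range \<iota>" using iota_1 by (metis rangeI)
      then show ?case by (simp add: H0_structure_sheaf)
    next
      case (Suc k)
      have "w i \<in> H0 C (twist 1)" using omega_basis(1)[of i] insert.prems by (simp add: H0_omega)
      then show ?case using H0_mult[OF _ Suc] by simp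
    qed
    then show ?case using insert H0_mult[of "w i ^ m i" "int (m i)" "\<Prod>i\<in>I. w i ^ m i"] by simp
  qed
  from this[of "{..<g}"] have "monomial_value m \<in> H0 C (twist (int (\<Sum>i<g. m i)))"
    by (simp add: monomial_value_def)
  then show "monomial_value m \<in> H0 C (twist (int n))"
    using m unfolding monomials_def by blast
qed

lemma pairing_sum:
  assumes "\<xi> \<in> adele (twist (- int n))" "finite I" "\<And>i. i \<in> I \<Longrightarrow> x i \<in> H0 C (twist (int (Suc n)))"
  shows "tr (\<lambda>P. (\<Sum>i\<in>I. \<iota> (c i) * x i) * \<xi> P) = (\<Sum>i\<in>I. c i * tr (\<lambda>P. x i * \<xi> P))"
  using assms(2,3)
proof (induction I rule: finite_induct)
  case empty
  have "(\<lambda>P. 0 * \<xi> P) \<in> null \<omega>"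
    using subspace_closed(1)[OF twist_closed(1), of _ 1] twist_1
    unfolding null_def by (intro CollectI exI[of _ 0]) auto
  then show ?case using tr_null by simp
next
  case (insert j I)
  let ?s = "\<Sum>i\<in>I. \<iota> (c i) * x i"
  have ad: "(\<lambda>P. y * \<xi> P) \<in> adele \<omega>" if "y \<in> H0 C (twist (int (Suc n)))" for y
    using hom_adele[OF _ assms(1)] hom_omega[of "- int n"] that by simp
  have mem: "\<iota> (c i) * x i \<in> H0 C (twist (int (Suc n)))" if "i \<in> insert j I" for i
    using subspace_closed(3)[OF H0_subspace insert.prems[OF that]] .
  have "?s \<in> H0 C (twist (int (Suc n)))" using mem by (intro subspace_sum[OF H0_subspace]) blast
  then have "tr ((\<lambda>P. \<iota> (c j) * x j * \<xi> P) + (\<lambda>P. ?s * \<xi> P))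
      = tr (\<lambda>P. \<iota> (c j) * x j * \<xi> P) + tr (\<lambda>P. ?s * \<xi> P)"
    by (intro tr_add ad mem) simp_all
  also have "\<dots> = c j * tr (\<lambda>P. x j * \<xi> P) + (\<Sum>i\<in>I. c i * tr (\<lambda>P. x i * \<xi> P))"
    using tr_scale[OF ad[OF insert.prems]] insert.IH insert.prems by (simp add: mult.assoc)
  finally show ?case using insert.hyps by (simp add: plus_fun_def distrib_right)
qed

text \<open>A space of dimension 2 is a progression with ratio the quotient of two basis elements.\<close>

lemma genus_at_least_3:
  assumes "\<And>u x. u \<noteq> 0 \<Longrightarrow> x \<notin> range \<iota> \<Longrightarrow> H0 C \<omega> \<noteq> progression u x g"
  shows "g \<ge> 3"
proof (rule ccontr)
  assume "\<not> g \<ge> 3"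
  then have g: "g = 2" using g_ge_2 by simp
  obtain u where u: "u \<in> H0 C \<omega>" "u \<noteq> 0" using has_dim_nonzero[OF has_dim_omega] g_ge_2 by auto
  obtain v where v: "v \<in> H0 C \<omega>" "v \<notin> span {u}" using has_dim_not_multiple[OF has_dim_omega g_ge_2 u(1)] .
  have x: "v / u \<notin> range \<iota>" by (rule quotient_notin_range[OF v(2) u(2)])
  have sub: "progression u (v / u) g \<subseteq> H0 C \<omega>"
  proof (rule progression_least[OF omega_subspace])
    fix j assume "j < g"
    then have "j = 0 \<or> j = 1" using g by auto
    then show "u * (v / u) ^ j \<in> H0 C \<omega>" using u v by auto
  qed
  have "progression u (v / u) g = H0 C \<omega>"
    using has_dim_subset[OF has_dim_omega progression_subspace sub] has_dim_unique[OF has_dim_progression[OF u(2) x]]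
    by metis
  then show False using assms u(2) x by metis
qed

text \<open>For \<open>\<xi>\<close> in \<open>H\<^sup>1(\<omega>\<^bsup>-n\<^esup>)\<close> orthogonal to all products of \<open>n + 1\<close> differentials and for \<open>v\<close> in \<open>H0 C \<omega>\<close>, the class
  \<open>v * \<xi>\<close> is orthogonal to the products of \<open>n\<close> differentials. By induction these are all sections of
  \<open>\<omega>\<^sup>n\<close>, so \<open>v * \<xi>\<close> vanishes for all \<open>v\<close>, and then \<open>\<xi>\<close> does. So no class is orthogonal to the products, and by
  duality these span the space of sections of the power \<open>n + 1\<close>.\<close>

theorem sections_are_products:
  assumes not_progression: "\<And>u x. u \<noteq> 0 \<Longrightarrow> x \<notin> range \<iota> \<Longrightarrow> H0 C \<omega> \<noteq> progression u x g"
    and "n \<ge> 1"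
  shows "H0 C (twist (int n)) \<subseteq> products n"
  using assms(2)
proof (induction n rule: nat_induct_at_least)
  case base
  then show ?case using products_1 by (simp add: H0_omega)
next
  case (Suc n)
  let ?L = "twist (- int n)"
  have hom: "hom ?L \<omega> = H0 C (twist (int (Suc n)))" using hom_omega[of "- int n"] by simp
  have mono: "monomial_value m \<in> H0 C (twist (int (Suc n)))" if "m \<in> monomials g (Suc n)" for m
    using products_subset[of "Suc n"] that by (auto simp: products_def span_base)
  note mono_hom = mono[folded hom]
  have null: "\<xi> \<in> null ?L"
    if \<xi>: "\<xi> \<in> adele ?L" and zero: "\<And>m. m \<in> monomials g (Suc n) \<Longrightarrow> tr (\<lambda>P. monomial_value m * \<xi> P) = 0" for \<xi>
  proof -
    have zero': "tr (\<lambda>P. x * \<xi> P) = 0" if x: "x \<in> products (Suc n)" for x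
    proof -
      obtain c where c: "x = (\<Sum>m\<in>monomials g (Suc n). \<iota> (c m) * monomial_value m)"
        using productsE[OF x] .
      have "tr (\<lambda>P. x * \<xi> P) = (\<Sum>m\<in>monomials g (Suc n). c m * tr (\<lambda>P. monomial_value m * \<xi> P))"
        unfolding c by (rule pairing_sum[OF \<xi> finite_monomials]) (rule mono)
      then show ?thesis by (simp add: zero)
    qed
    have prod: "(\<lambda>P. v * \<xi> P) \<in> null (twist (1 - int n))" if v: "v \<in> H0 C \<omega>" for v
    proof (rule ccontr)
      assume nonnull: "(\<lambda>P. v * \<xi> P) \<notin> null (twist (1 - int n))"
      have "v \<in> hom ?L (twist (1 - int n))" using v unfolding hom_twist H0_omega by simp
      then have "(\<lambda>P. v * \<xi> P) \<in> adele (twist (1 - int n))" using hom_adele \<xi> by blast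
      then obtain c where c: "c \<in> hom (twist (1 - int n)) \<omega>" "tr (\<lambda>P. c * (v * \<xi> P)) \<noteq> 0"
        using separated_by_trace[OF twist_coherent nonnull] by blast
      have "c \<in> products n" using c(1) Suc.IH unfolding hom_omega by auto
      then have "v * c \<in> products (Suc n)" using products_mult[OF v] by blast
      then have "tr (\<lambda>P. v * c * \<xi> P) = 0" using zero' by blast
      then show False using c(2) by (simp add: ac_simps)
    qed
    show ?thesis
    proof (cases "n = 1")
      case True
      then show ?thesis using null_of_products_zero[OF _ not_progression, of \<xi>] prod by simp
    next
      case False
      then show ?thesis using null_of_products_negative[of \<xi> "1 - int n"] prod Suc.hyps
          genus_at_least_3[OF not_progression] by simp
    qed
  qed
  show ?case
  proof
    fix h assume h: "h \<in> H0 C (twist (int (Suc n)))"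
    then have h': "h \<in> hom ?L \<omega>" using hom by simp
    note add = tr_add[OF hom_adele hom_adele] and scale = tr_scale[OF hom_adele]
    have "\<exists>c. \<forall>\<xi>\<in>adele ?L. tr (\<lambda>P. h * \<xi> P) = (\<Sum>m\<in>monomials g (Suc n). c m * tr (\<lambda>P. monomial_value m * \<xi> P))"
    proof (rule funs.linear_form_in_span[OF finite_monomials adele_subspace[OF twist_closed(1)]])
      fix \<xi> \<eta> assume "\<xi> \<in> adele ?L" "\<eta> \<in> adele ?L"
      then show "tr (\<lambda>P. h * (\<xi> + \<eta>) P) = tr (\<lambda>P. h * \<xi> P) + tr (\<lambda>P. h * \<eta> P)"
        and "\<And>m. m \<in> monomials g (Suc n) \<Longrightarrow> tr (\<lambda>P. monomial_value m * (\<xi> + \<eta>) P)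
            = tr (\<lambda>P. monomial_value m * \<xi> P) + tr (\<lambda>P. monomial_value m * \<eta> P)"
        using add[OF h' _ h'] add[OF mono_hom _ mono_hom] by (simp_all add: plus_fun_def distrib_left)
    next
      fix c \<xi> assume "\<xi> \<in> adele ?L"
      then show "tr (\<lambda>P. h * (\<iota> c * \<xi> P)) = c * tr (\<lambda>P. h * \<xi> P)"
        and "\<And>m. m \<in> monomials g (Suc n) \<Longrightarrow> tr (\<lambda>P. monomial_value m * (\<iota> c * \<xi> P))
            = c * tr (\<lambda>P. monomial_value m * \<xi> P)"
        using scale[OF h'] scale[OF mono_hom] by (simp_all add: mult.left_commute)
    next
      fix \<xi> assume "\<xi> \<in> adele ?L" "\<And>m. m \<in> monomials g (Suc n) \<Longrightarrow> tr (\<lambda>P. monomial_value m * \<xi> P) = 0"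
      then have "\<xi> \<in> null ?L" by (rule null)
      then show "tr (\<lambda>P. h * \<xi> P) = 0" using tr_null hom_null[OF h'] by blast
    qed
    then obtain c where c: "\<And>\<xi>. \<xi> \<in> adele ?L \<Longrightarrow>
        tr (\<lambda>P. h * \<xi> P) = (\<Sum>m\<in>monomials g (Suc n). c m * tr (\<lambda>P. monomial_value m * \<xi> P))" by blast
    define x where "x = (\<Sum>m\<in>monomials g (Suc n). \<iota> (c m) * monomial_value m)"
    have xp: "x \<in> products (Suc n)" unfolding x_def products_def
      by (intro span_sum span_scale span_base imageI)
    have "h = x"
    proof (rule hom_unique[OF twist_coherent h'])
      show "x \<in> hom ?L \<omega>" unfolding hom using xp products_subset by blast
      fix \<xi> assume \<xi>: "\<xi> \<in> adele ?L"
      show "tr (\<lambda>P. h * \<xi> P) = tr (\<lambda>P. x * \<xi> P)"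
        unfolding c[OF \<xi>] x_def by (rule pairing_sum[OF \<xi> finite_monomials, symmetric]) (rule mono)
    qed
    then show "h \<in> products (Suc n)" using xp by simp
  qed
qed

end

section \<open>Forms on the canonical model\<close>

context alg_closed_base
begin

text \<open>The relation \<open>x - \<iota> c \<in> max_ideal Q\<close> says that \<open>x\<close> is regular at \<open>Q\<close> with value \<open>c\<close>. Evaluation is compatible
  with all operations used in forms and polynomials.\<close>

lemma residue_mult:
  assumes Q: "local_subring Q" and xy: "x - \<iota> c \<in> max_ideal Q" "y - \<iota> d \<in> max_ideal Q"
  shows "x * y - \<iota> (c * d) \<in> max_ideal Q"
proof -
  note Q' = local_subringD[OF Q]
  have "(x - \<iota> c) + \<iota> c \<in> Q"
    using subring_closed(6)[OF Q'(1) _ Q'(2)] xy(1) max_ideal_subset by blast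
  then have "x \<in> Q" by simp
  then have "x * (y - \<iota> d) + \<iota> d * (x - \<iota> c) \<in> max_ideal Q"
    using Q'(3)[OF Q'(4)[OF _ xy(2)] Q'(4)[OF Q'(2) xy(1)]] by blast
  also have "x * (y - \<iota> d) + \<iota> d * (x - \<iota> c) = x * y - \<iota> (c * d)"
    by (simp add: iota_mult algebra_simps)
  finally show ?thesis .
qed

lemma residue_add:
  assumes Q: "local_subring Q" and xy: "x - \<iota> c \<in> max_ideal Q" "y - \<iota> d \<in> max_ideal Q"
  shows "x + y - \<iota> (c + d) \<in> max_ideal Q"
  using local_subringD(3)[OF Q xy] by (simp add: iota_add algebra_simps)

lemma residue_const: "local_subring Q \<Longrightarrow> \<iota> c - \<iota> c \<in> max_ideal Q"
  using local_subringD(5) by simp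

lemma residue_power:
  assumes "local_subring Q" "x - \<iota> c \<in> max_ideal Q"
  shows "x ^ n - \<iota> (c ^ n) \<in> max_ideal Q"
  using residue_const[OF assms(1), of 1] by (induction n) (auto intro: residue_mult[OF assms])

lemma residue_prod:
  assumes "local_subring Q" "finite I" "\<And>i. i \<in> I \<Longrightarrow> x i - \<iota> (c i) \<in> max_ideal Q"
  shows "prod x I - \<iota> (prod c I) \<in> max_ideal Q"
  using assms(2,3)
proof (induction I rule: finite_induct)
  case empty
  then show ?case using residue_const[OF assms(1), of 1] by simp
next
  case (insert i I)
  then show ?case using residue_mult[OF assms(1), of "x i" "c i" "prod x I" "prod c I"] by simp
qed

lemma residue_sum:
  assumes "local_subring Q" "finite I" "\<And>i. i \<in> I \<Longrightarrow> x i - \<iota> (c i) \<in> max_ideal Q"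
  shows "sum x I - \<iota> (sum c I) \<in> max_ideal Q"
  using assms(2,3)
proof (induction I rule: finite_induct)
  case empty
  then show ?case using residue_const[OF assms(1), of 0] by simp
next
  case (insert i I)
  then show ?case using residue_add[OF assms(1), of "x i" "c i" "sum x I" "sum c I"] by simp
qed

lemma residue_ev:
  assumes Q: "local_subring Q" and x: "x - \<iota> c \<in> max_ideal Q"
  shows "ev h x - \<iota> (poly h c) \<in> max_ideal Q"
proof (induction h)
  case 0
  then show ?case using local_subringD(5)[OF Q] by simp
next
  case (pCons a h)
  then show ?case
    using residue_add[OF Q residue_const[OF Q] residue_mult[OF Q x pCons.IH], of a] by simp
qed

lemma residue_unique: "local_subring Q \<Longrightarrow> x \<in> max_ideal Q \<Longrightarrow> x - \<iota> c \<in> max_ideal Q \<Longrightarrow> c = 0"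
  using local_subringD(7)[of Q x "x - \<iota> c"] iota_notin_max_ideal[of Q c] by auto

text \<open>The expansion at \<open>x = \<infinity>\<close>.\<close>

lemma ev_reversed:
  assumes "degree h \<le> e" "x \<noteq> 0"
  shows "ev h x / x ^ e = (\<Sum>i\<le>e. \<iota> (coeff h i) * inverse x ^ (e - i))"
proof -
  have "degree (map_poly \<iota> h) \<le> e" using assms(1) by (simp add: degree_map_poly)
  from poly_reversed[OF this, of "inverse x"] show ?thesis
    using assms(2) by (simp add: coeff_map_poly power_inverse divide_inverse mult.commute)
qed

end

lemma dominates_max_ideal: "dominates V P \<Longrightarrow> x \<in> P \<Longrightarrow> x \<in> max_ideal V \<longleftrightarrow> x \<in> max_ideal P"
  unfolding dominates_def by blast

context gorenstein_curve
begin

abbreviation model :: "(nat \<Rightarrow> 'k) set" where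
  "model \<equiv> canonical_model \<iota> C \<omega> g w"

definition monomial_form :: "(nat \<Rightarrow> nat) \<Rightarrow> (nat \<Rightarrow> 'k) \<Rightarrow> 'k" where
  "monomial_form m a = (\<Prod>i<g. a i ^ m i)"

text \<open>A form is given as a function on \<open>k\<^sup>g\<close> only. This relation connects it with its value at the vector \<open>w\<close> of
  basis differentials, computed from some choice of coefficients.\<close>

definition form_value :: "nat \<Rightarrow> ((nat \<Rightarrow> 'k) \<Rightarrow> 'k) \<Rightarrow> 'a \<Rightarrow> bool" where
  "form_value d F x \<longleftrightarrow> (\<exists>c. F = (\<lambda>a. \<Sum>m\<in>monomials g d. c m * monomial_form m a) \<and>
     x = (\<Sum>m\<in>monomials g d. \<iota> (c m) * monomial_value m))"

lemma form_value_forms: "F \<in> forms g d \<longleftrightarrow> (\<exists>x. form_value d F x)"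
  unfolding forms_def form_value_def monomial_form_def by blast

lemma form_value_monomial:
  assumes "m \<in> monomials g d" shows "form_value d (monomial_form m) (monomial_value m)"
  unfolding form_value_def
proof (intro exI[of _ "\<lambda>m'. if m' = m then 1 else 0"] conjI ext)
  have "(\<Sum>m'\<in>monomials g d. (if m' = m then 1 else 0) * monomial_form m' a)
      = (\<Sum>m'\<in>monomials g d. if m' = m then monomial_form m' a else 0)" for a by (intro sum.cong) auto
  also have "\<dots> a = monomial_form m a" for a using assms finite_monomials by simp
  finally show "monomial_form m a = (\<Sum>m'\<in>monomials g d. (if m' = m then 1 else 0) * monomial_form m' a)" for a
    by simp
  have "(\<Sum>m'\<in>monomials g d. \<iota> (if m' = m then 1 else 0) * monomial_value m')
      = (\<Sum>m'\<in>monomials g d. if m' = m then monomial_value m' else 0)" by (intro sum.cong) auto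
  also have "\<dots> = monomial_value m" using assms finite_monomials by simp
  finally show "monomial_value m = (\<Sum>m'\<in>monomials g d. \<iota> (if m' = m then 1 else 0) * monomial_value m')" by simp
qed

lemma form_value_add:
  assumes "form_value d F x" "form_value d G y"
  shows "form_value d (\<lambda>a. F a + G a) (x + y)"
proof -
  obtain c e where ce: "F = (\<lambda>a. \<Sum>m\<in>monomials g d. c m * monomial_form m a)" "x = (\<Sum>m\<in>monomials g d. \<iota> (c m) * monomial_value m)"
    "G = (\<lambda>a. \<Sum>m\<in>monomials g d. e m * monomial_form m a)" "y = (\<Sum>m\<in>monomials g d. \<iota> (e m) * monomial_value m)"
    using assms unfolding form_value_def by blast
  show ?thesis unfolding form_value_def ce
    by (intro exI[of _ "\<lambda>m. c m + e m"] conjI) (simp_all only: iota_add distrib_right sum.distrib)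
qed

lemma form_value_scale:
  assumes "form_value d F x"
  shows "form_value d (\<lambda>a. b * F a) (\<iota> b * x)"
proof -
  obtain c where c: "F = (\<lambda>a. \<Sum>m\<in>monomials g d. c m * monomial_form m a)" "x = (\<Sum>m\<in>monomials g d. \<iota> (c m) * monomial_value m)"
    using assms unfolding form_value_def by blast
  show ?thesis unfolding form_value_def c
    by (intro exI[of _ "\<lambda>m. b * c m"] conjI) (simp_all only: iota_mult sum_distrib_left mult.assoc)
qed

lemma form_value_diff:
  assumes "form_value d F x" "form_value d G y"
  shows "form_value d (\<lambda>a. F a - G a) (x - y)"
  using form_value_add[OF assms(1) form_value_scale[OF assms(2), of "- 1"]] by (simp add: iota_minus)

lemma form_value_zero: "form_value d (\<lambda>_. 0) 0"
  unfolding form_value_def by (intro exI[of _ "\<lambda>_. 0"]) simp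

lemma form_value_sum:
  assumes "finite I" "\<And>i. i \<in> I \<Longrightarrow> form_value d (F i) (x i)"
  shows "form_value d (\<lambda>a. \<Sum>i\<in>I. F i a) (\<Sum>i\<in>I. x i)"
  using assms
proof (induction I rule: finite_induct)
  case empty
  then show ?case using form_value_zero by simp
next
  case (insert i I)
  then show ?case using form_value_add[of d "F i" "x i" "\<lambda>a. \<Sum>i\<in>I. F i a"] by simp
qed

lemma form_value_mult:
  assumes "form_value d F x" "form_value e G y"
  shows "form_value (d + e) (\<lambda>a. F a * G a) (x * y)"
proof -
  obtain b c where b: "F = (\<lambda>a. \<Sum>m\<in>monomials g d. b m * monomial_form m a)" "x = (\<Sum>m\<in>monomials g d. \<iota> (b m) * monomial_value m)"
    and c: "G = (\<lambda>a. \<Sum>m\<in>monomials g e. c m * monomial_form m a)" "y = (\<Sum>m\<in>monomials g e. \<iota> (c m) * monomial_value m)"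
    using assms unfolding form_value_def by blast
  have mono: "form_value (d + e) (\<lambda>a. monomial_form m a * monomial_form m' a) (monomial_value m * monomial_value m')"
    if "m \<in> monomials g d" "m' \<in> monomials g e" for m m'
  proof -
    have "(\<lambda>i. m i + m' i) \<in> monomials g (d + e)" using that by (auto simp: monomials_def vecs_def sum.distrib)
    from form_value_monomial[OF this] show ?thesis
      unfolding monomial_form_def monomial_value_def power_add prod.distrib by (simp add: monomial_form_def[abs_def])
  qed
  have "form_value (d + e) (\<lambda>a. \<Sum>m\<in>monomials g d. b m * (\<Sum>m'\<in>monomials g e. c m' * (monomial_form m a * monomial_form m' a)))
    (\<Sum>m\<in>monomials g d. \<iota> (b m) * (\<Sum>m'\<in>monomials g e. \<iota> (c m') * (monomial_value m * monomial_value m')))"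
    by (intro form_value_sum form_value_scale mono finite_monomials)
  moreover have "(\<Sum>m\<in>monomials g d. b m * (\<Sum>m'\<in>monomials g e. c m' * (monomial_form m a * monomial_form m' a))) = F a * G a" for a
    unfolding b c sum_product by (intro sum.cong refl) (simp add: sum_distrib_left ac_simps)
  moreover have "(\<Sum>m\<in>monomials g d. \<iota> (b m) * (\<Sum>m'\<in>monomials g e. \<iota> (c m') * (monomial_value m * monomial_value m'))) = x * y"
    unfolding b c sum_product by (intro sum.cong refl) (simp add: sum_distrib_left ac_simps)
  ultimately show ?thesis by simp
qed

lemma form_value_products: "form_value d F x \<Longrightarrow> x \<in> products d"
  unfolding form_value_def products_def by (elim exE conjE, hypsubst, intro span_sum span_scale span_base imageI)

lemma products_form_value: "x \<in> products d \<Longrightarrow> \<exists>F. form_value d F x"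
  using productsE unfolding form_value_def by metis

lemma form_residue:
  assumes F: "form_value d F x" and Q: "local_subring Q"
    and a: "\<And>i. i < g \<Longrightarrow> w i / u - \<iota> (a i) \<in> max_ideal Q"
  shows "x / u ^ d - \<iota> (F a) \<in> max_ideal Q"
proof -
  obtain c where c: "F = (\<lambda>a. \<Sum>m\<in>monomials g d. c m * monomial_form m a)" "x = (\<Sum>m\<in>monomials g d. \<iota> (c m) * monomial_value m)"
    using F unfolding form_value_def by blast
  have "\<iota> (c m) * (\<Prod>i<g. (w i / u) ^ m i) - \<iota> (c m * monomial_form m a) \<in> max_ideal Q" for m
    unfolding monomial_form_def using a
    by (intro residue_mult[OF Q residue_const[OF Q]] residue_prod[OF Q] residue_power[OF Q]) auto
  then have "(\<Sum>m\<in>monomials g d. \<iota> (c m) * (\<Prod>i<g. (w i / u) ^ m i)) - \<iota> (F a) \<in> max_ideal Q"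
    unfolding c(1) by (intro residue_sum[OF Q finite_monomials])
  moreover have "(\<Sum>m\<in>monomials g d. \<iota> (c m) * (\<Prod>i<g. (w i / u) ^ m i)) = x / u ^ d"
    unfolding c(2) sum_divide_distrib
  proof (intro sum.cong refl)
    fix m assume "m \<in> monomials g d"
    then have "(\<Prod>i<g. u ^ m i) = u ^ d" unfolding power_sum[symmetric] by (simp add: monomials_def)
    then show "\<iota> (c m) * (\<Prod>i<g. (w i / u) ^ m i) = \<iota> (c m) * monomial_value m / u ^ d"
      by (simp add: power_divide prod_dividef monomial_value_def)
  qed
  ultimately show ?thesis by simp
qed

lemma modelE:
  assumes "a \<in> model"
  obtains Q u where "local_subring Q" "u \<noteq> 0" "\<And>i. i < g \<Longrightarrow> w i / u - \<iota> (a i) \<in> max_ideal Q"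
proof -
  obtain Q where Q: "Q \<in> closed_points (normalization C)" "a \<in> canonical_map \<iota> C \<omega> g w Q"
    using assms unfolding canonical_model_def by blast
  then have "local_subring Q" using normalization_local by (simp add: closed_points_def)
  then show thesis using that Q(2) unfolding canonical_map_def by blast
qed

text \<open>The residues of the coordinates \<open>w i / gen P\<close> do not all vanish, because \<open>\<omega>\<close> is generated by its sections.\<close>

lemma model_point:
  assumes P: "P \<in> closed_points C"
  obtains Q a where "local_subring Q" "dominates Q P" "a \<in> model"
    "\<And>i. i < g \<Longrightarrow> w i / gen P - \<iota> (a i) \<in> max_ideal Q"
proof -
  obtain Q where Q: "Q \<in> closed_points (normalization C)" "rational Q" "dominates Q P" "normalization_map C Q = P"
    using point_of_normalization[OF P] .
  note Q' = local_subringD[OF rational_local[OF Q(2)]]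
  let ?u = "gen P"
  have PQ: "P \<subseteq> Q" using Q(3) by (simp add: dominates_def)
  have wQ: "w i / ?u \<in> Q" if "i < g" for i using omega_stalk[OF omega_basis(1)[OF that] P] PQ by blast
  then have "\<exists>c. w i / ?u - \<iota> c \<in> max_ideal Q" if "i < g" for i using Q(2) that by (simp add: rational_def)
  then obtain c where c: "\<And>i. i < g \<Longrightarrow> w i / ?u - \<iota> (c i) \<in> max_ideal Q" by metis
  define a where "a i = (if i < g then c i else 0)" for i
  have a: "\<And>i. i < g \<Longrightarrow> w i / ?u - \<iota> (a i) \<in> max_ideal Q" using c by (simp add: a_def)
  have "\<exists>i<g. a i \<noteq> 0"
  proof (rule ccontr)
    assume none: "\<not> (\<exists>i<g. a i \<noteq> 0)"
    have "w i / ?u \<in> max_ideal Q" if "i < g" for i using a[OF that] none that by simp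
    then have "H0 C \<omega> \<subseteq> {v. v / ?u \<in> max_ideal Q}"
      unfolding omega_basis(4)[symmetric] by (intro span_minimal subspace_quotient Q'(9)) auto
    then have "v / ?u \<in> max_ideal P" if "v \<in> H0 C \<omega>" for v
      using that dominates_max_ideal[OF Q(3) omega_stalk[OF that P]] by blast
    then show False using base_point_free[OF P] by blast
  qed
  moreover have "pullback_mod_torsion C \<omega> Q = {?u * x | x. x \<in> Q}"
    unfolding pullback_mod_torsion_def Q(4)
  proof (intro antisym subsetI)
    fix z assume "z \<in> {\<Sum>s\<in>S. c s * s | S c. finite S \<and> S \<subseteq> \<omega> P \<and> (\<forall>s\<in>S. c s \<in> Q)}"
    then obtain S c where S: "z = (\<Sum>s\<in>S. c s * s)" "finite S" "S \<subseteq> \<omega> P" "\<forall>s\<in>S. c s \<in> Q" by blast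
    have "(\<Sum>s\<in>S. c s * (s / ?u)) \<in> Q"
    proof (rule subring_sum[OF Q'(1)])
      fix s assume s: "s \<in> S"
      then have "s / ?u \<in> Q" using S(3) gen(2)[OF P] PQ by blast
      then show "c s * (s / ?u) \<in> Q" using subring_closed(4)[OF Q'(1)] S(4) s by blast
    qed
    moreover have "z = ?u * (\<Sum>s\<in>S. c s * (s / ?u))"
      unfolding S(1) sum_distrib_left using gen(1)[OF P] by (intro sum.cong) auto
    ultimately show "z \<in> {?u * x | x. x \<in> Q}" by blast
  next
    fix z assume "z \<in> {?u * x | x. x \<in> Q}"
    then obtain x where x: "z = ?u * x" "x \<in> Q" by blast
    have "?u \<in> \<omega> P" using gen[OF P] subring_closed(2)[OF closed_pointD'(3)[OF P]] by simp
    then show "z \<in> {\<Sum>s\<in>S. c s * s | S c. finite S \<and> S \<subseteq> \<omega> P \<and> (\<forall>s\<in>S. c s \<in> Q)}"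
      using x by (intro CollectI exI[of _ "{?u}"] exI[of _ "\<lambda>_. x"]) (simp add: mult.commute)
  qed
  moreover have "a \<in> vecs g" by (simp add: vecs_def a_def)
  ultimately have "a \<in> canonical_map \<iota> C \<omega> g w Q"
    unfolding canonical_map_def using gen(1)[OF P] a by blast
  then have "a \<in> model" unfolding canonical_model_def using Q(1) by blast
  then show thesis using that rational_local[OF Q(2)] Q(3) a by blast
qed

text \<open>Hence the homogeneous coordinate ring of the model is the ring generated by the basis differentials in \<open>K\<close>.\<close>

lemma form_vanishes_iff:
  assumes F: "form_value d F x"
  shows "(\<forall>a\<in>model. F a = 0) \<longleftrightarrow> x = 0"
proof
  assume x: "x = 0"
  show "\<forall>a\<in>model. F a = 0"
  proof
    fix a assume "a \<in> model"
    then obtain Q u where Q: "local_subring Q" "u \<noteq> 0" "\<And>i. i < g \<Longrightarrow> w i / u - \<iota> (a i) \<in> max_ideal Q"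
      using modelE by blast
    show "F a = 0"
      using residue_unique[OF Q(1) local_subringD(5)[OF Q(1)]] form_residue[OF F Q(1,3)] x by simp
  qed
next
  assume zero: "\<forall>a\<in>model. F a = 0"
  show "x = 0"
  proof (rule ccontr)
    assume "x \<noteq> 0"
    \<comment> \<open>A point at which \<open>x\<close> is a unit and the dualizing sheaf needs no twist.\<close>
    then obtain P where P: "P \<in> closed_points C" "P \<notin> {P \<in> closed_points C. \<omega> P \<noteq> P}" "x \<in> P" "x \<notin> max_ideal P"
      using unit_at_some_point[OF omega_finite] by blast
    have "gen P = 1" using P(1,2) by (simp add: gen_def)
    moreover obtain Q a where Q: "local_subring Q" "dominates Q P" "a \<in> model"
      "\<And>i. i < g \<Longrightarrow> w i / gen P - \<iota> (a i) \<in> max_ideal Q" using model_point[OF P(1)] by blast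
    ultimately have "x \<in> max_ideal Q" using form_residue[OF F Q(1,4)] zero Q(3) by simp
    then show False using dominates_max_ideal[OF Q(2) P(3)] P(4) by blast
  qed
qed

lemma form_determined:
  assumes "form_value d F x" "form_value d G x" "a \<in> model" shows "F a = G a"
  using form_vanishes_iff[OF form_value_diff[OF assms(1,2)]] assms(3) by simp

lemma products_stalk:
  assumes "x \<in> products d" "P \<in> closed_points C" shows "x / gen P ^ d \<in> P"
  using assms products_subset[of d] by (auto simp: H0_def twist_def)

text \<open>Two local expressions \<open>F / G\<close> of \<open>s\<close> satisfy \<open>(F * G0 - F0 * G) * G * G0 = 0\<close> on the whole model. By
  \<open>form_vanishes_iff\<close> the corresponding elements \<open>X / Y\<close> of \<open>K\<close> coincide. They are regular at each closed point
  \<open>P\<close> because some expression has a denominator that does not vanish at a point of the model above \<open>P\<close>.\<close>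

lemma section_of_model:
  assumes s: "s \<in> twisted_sections g model n"
  obtains y where "y \<in> H0 C (twist (int n))"
    "\<And>a. a \<in> model \<Longrightarrow> \<exists>d F G X Y. form_value (n + d) F X \<and> form_value d G Y \<and> Y \<noteq> 0 \<and> y = X / Y \<and>
       G a \<noteq> 0 \<and> s a = F a / G a"
proof -
  have loc: "\<exists>d F G X Y. form_value (n + d) F X \<and> form_value d G Y \<and> Y \<noteq> 0 \<and> G a \<noteq> 0 \<and>
      (\<forall>b\<in>model. G b \<noteq> 0 \<longrightarrow> s b = F b / G b)" if a: "a \<in> model" for a
  proof -
    obtain d F G where *: "F \<in> forms g (n + d)" "G \<in> forms g d" "G a \<noteq> 0" "\<forall>b\<in>model. G b \<noteq> 0 \<longrightarrow> s b = F b / G b"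
      using s a unfolding twisted_sections_def by blast
    then obtain X Y where XY: "form_value (n + d) F X" "form_value d G Y" unfolding form_value_forms by blast
    have "Y \<noteq> 0" using form_vanishes_iff[OF XY(2)] *(3) a by blast
    then show ?thesis using * XY by blast
  qed
  obtain P0 where "P0 \<in> closed_points C" using closed_point_exists .
  then obtain a0 where "a0 \<in> model" using model_point by blast
  then obtain d0 F0 G0 X0 Y0 where 0: "form_value (n + d0) F0 X0" "form_value d0 G0 Y0" "Y0 \<noteq> 0"
    "\<forall>b\<in>model. G0 b \<noteq> 0 \<longrightarrow> s b = F0 b / G0 b" using loc by blast
  define y where "y = X0 / Y0"
  have y: "\<exists>d F G X Y. form_value (n + d) F X \<and> form_value d G Y \<and> Y \<noteq> 0 \<and> y = X / Y \<and>
       G a \<noteq> 0 \<and> s a = F a / G a" if a: "a \<in> model" for a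
  proof -
    obtain d F G X Y where 1: "form_value (n + d) F X" "form_value d G Y" "Y \<noteq> 0" "G a \<noteq> 0"
      "\<forall>b\<in>model. G b \<noteq> 0 \<longrightarrow> s b = F b / G b" using loc[OF a] by blast
    have "form_value (n + d + d0) (\<lambda>b. F b * G0 b) (X * Y0)" by (rule form_value_mult[OF 1(1) 0(2)])
    moreover have "form_value (n + d0 + d) (\<lambda>b. F0 b * G b) (X0 * Y)" by (rule form_value_mult[OF 0(1) 1(2)])
    then have "form_value (n + d + d0) (\<lambda>b. F0 b * G b) (X0 * Y)" by (simp add: add.assoc add.commute add.left_commute)
    ultimately have "form_value (n + d + d0) (\<lambda>b. F b * G0 b - F0 b * G b) (X * Y0 - X0 * Y)"
      by (rule form_value_diff)
    from form_value_mult[OF this form_value_mult[OF 1(2) 0(2)]]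
    have H: "form_value (n + d + d0 + (d + d0)) (\<lambda>b. (F b * G0 b - F0 b * G b) * (G b * G0 b))
      ((X * Y0 - X0 * Y) * (Y * Y0))" .
    have "(F b * G0 b - F0 b * G b) * (G b * G0 b) = 0" if b: "b \<in> model" for b
    proof (cases "G b = 0 \<or> G0 b = 0")
      case False
      then have "F b / G b = F0 b / G0 b" using 0(4) 1(5) b by auto
      then show ?thesis using False by (simp add: frac_eq_eq)
    qed auto
    then have "(X * Y0 - X0 * Y) * (Y * Y0) = 0" using form_vanishes_iff[OF H] by blast
    then have "y = X / Y" using 0(3) 1(3) by (simp add: y_def frac_eq_eq mult.commute)
    then show ?thesis using 1 a by blast
  qed
  have "y \<in> twist (int n) P" if P: "P \<in> closed_points C" for P
  proof -
    obtain Q a where Q: "local_subring Q" "dominates Q P" "a \<in> model"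
      "\<And>i. i < g \<Longrightarrow> w i / gen P - \<iota> (a i) \<in> max_ideal Q" using model_point[OF P] by blast
    obtain d F G X Y where 1: "form_value (n + d) F X" "form_value d G Y" "Y \<noteq> 0" "y = X / Y" "G a \<noteq> 0"
      using y[OF Q(3)] by blast
    have YP: "Y / gen P ^ d \<in> P" using products_stalk[OF form_value_products[OF 1(2)] P] .
    have XP: "X / gen P ^ (n + d) \<in> P" using products_stalk[OF form_value_products[OF 1(1)] P] .
    have "Y / gen P ^ d \<notin> max_ideal Q"
      using residue_unique[OF Q(1) _ form_residue[OF 1(2) Q(1,4)]] 1(5) by blast
    then have "Y / gen P ^ d \<notin> max_ideal P" using dominates_max_ideal[OF Q(2) YP] by blast
    then have "inverse (Y / gen P ^ d) \<in> P" using unit_inverse[OF YP] by blast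
    then have "X / gen P ^ (n + d) * inverse (Y / gen P ^ d) \<in> P"
      using subring_closed(4)[OF closed_pointD'(3)[OF P] XP] by blast
    also have "X / gen P ^ (n + d) * inverse (Y / gen P ^ d) = y / gen P powi int n"
      using gen(1)[OF P] unfolding 1(4) by (simp add: power_add)
    finally show ?thesis by (simp add: twist_def)
  qed
  then have "y \<in> H0 C (twist (int n))" by (simp add: H0_def)
  then show thesis by (rule that[OF _ y])
qed

section \<open>Sections spanned by a geometric progression\<close>

text \<open>If the differentials form a geometric progression with ratio \<open>x\<close>, then the model is a rational
  normal curve with coordinate \<open>x\<close>.\<close>

context
  fixes u x :: 'a
  assumes u: "u \<noteq> 0" and x: "x \<notin> range \<iota>" and V: "H0 C \<omega> = progression u x g"
begin

private lemma x0: "x \<noteq> 0"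
  using x by (metis iota_0 rangeI)

private lemma inverse_x: "inverse x \<notin> range \<iota>"
  using x by (rule inverse_notin_range)

private lemma form_value_ratio:
  assumes "form_value d F X" obtains h where "X = u ^ d * ev h x"
proof -
  let ?U = "\<lambda>d. {u ^ d * ev h x | h. True}"
  have mult: "y * z \<in> ?U (d + e)" if yz: "y \<in> ?U d" "z \<in> ?U e" for y z d e
  proof -
    obtain h k where "y = u ^ d * ev h x" "z = u ^ e * ev k x" using yz by blast
    then have "y * z = u ^ (d + e) * ev (h * k) x" by (simp add: ev_mult power_add)
    then show ?thesis by blast
  qed
  have one: "1 \<in> ?U 0" by (intro CollectI exI[of _ 1]) simp
  have wi: "w i \<in> ?U 1" if "i < g" for i
    using omega_basis(1)[OF that] unfolding V progression_def by auto
  have pow: "w i ^ k \<in> ?U k" if "i < g" for i k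
    using one mult[OF wi[OF that], of _ _] by (induction k) auto
  have "(\<Prod>i\<in>I. w i ^ m i) \<in> ?U (\<Sum>i\<in>I. m i)" if "finite I" "I \<subseteq> {..<g}" for I m
    using that
  proof (induction I rule: finite_induct)
    case empty
    then show ?case using one by simp
  next
    case (insert i I)
    then show ?case using mult[OF pow[of i "m i"]] by simp
  qed
  from this[of "{..<g}"] have mono: "monomial_value m \<in> ?U d" if "m \<in> monomials g d" for m
    using that by (fastforce simp: monomial_value_def monomials_def)
  have "subspace (?U d)"
  proof (rule subspaceI)
    show "0 \<in> ?U d" by (intro CollectI exI[of _ 0]) simp
    show "y + z \<in> ?U d" if yz: "y \<in> ?U d" "z \<in> ?U d" for y z
    proof -
      obtain h k where "y = u ^ d * ev h x" "z = u ^ d * ev k x" using yz by blast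
      then have "y + z = u ^ d * ev (h + k) x" by (simp add: ev_add distrib_left)
      then show ?thesis by blast
    qed
    show "\<iota> c * z \<in> ?U d" if z: "z \<in> ?U d" for c z
    proof -
      obtain h where "z = u ^ d * ev h x" using z by blast
      then have "\<iota> c * z = u ^ d * ev ([:c:] * h) x" by (simp only: ev_mult) simp
      then show ?thesis by blast
    qed
  qed
  then have "products d \<subseteq> ?U d" unfolding products_def using mono by (intro span_minimal) auto
  then show thesis using form_value_products[OF assms] that by blast
qed

text \<open>At the center of a place with \<open>x\<close> finite, \<open>u\<close> generates; at infinity, \<open>u * x ^ (g - 1)\<close> does.\<close>

private lemma generator_at:
  assumes V': "place V'" "dominates V' P" and P: "P \<in> closed_points C"
    and j: "j < g" and coord: "\<And>q. q = 0 \<or> degree q < g \<Longrightarrow> ev q x / x ^ j \<in> V'"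
  shows "gen P / (u * x ^ j) \<in> P"
proof -
  note L = local_subringD[OF place_local[OF V'(1)]]
  have sP: "u * x ^ j / gen P \<in> P" using omega_stalk[OF _ P] mem_progression[OF j] V by blast
  obtain v where v: "v \<in> H0 C \<omega>" "v / gen P \<in> P" "v / gen P \<notin> max_ideal P" using base_point_free[OF P] .
  obtain q where q: "v = u * ev q x" "q = 0 \<or> degree q < g" using v(1) unfolding V progression_def by blast
  have "u * x ^ j / gen P \<notin> max_ideal P"
  proof
    assume "u * x ^ j / gen P \<in> max_ideal P"
    then have "u * x ^ j / gen P \<in> max_ideal V'" using dominates_max_ideal[OF V'(2) sP] by blast
    then have "(ev q x / x ^ j) * (u * x ^ j / gen P) \<in> max_ideal V'" using L(4) coord[OF q(2)] by blast
    also have "(ev q x / x ^ j) * (u * x ^ j / gen P) = v / gen P" using x0 by (simp add: q(1) mult.commute)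
    finally show False using dominates_max_ideal[OF V'(2) v(2)] v(3) by blast
  qed
  then show ?thesis using unit_inverse[OF sP] by (simp add: inverse_divide)
qed

text \<open>Sections of \<open>\<omega>\<^sup>n\<close> are multiples of \<open>(u * x ^ j) ^ n\<close> where \<open>u * x ^ j\<close> generates \<open>\<omega>\<close>.\<close>

private lemma regular_quotient:
  assumes V': "place V'" "dominates V' P" and P: "P \<in> closed_points C"
    and j: "j < g" and coord: "\<And>q. q = 0 \<or> degree q < g \<Longrightarrow> ev q x / x ^ j \<in> V'"
    and y: "y \<in> H0 C (twist (int n))"
  shows "y / (u * x ^ j) ^ n \<in> V'"
proof -
  note R = closed_pointD'(3)[OF P]
  have "y / gen P ^ n \<in> P" using y P by (auto simp: H0_def twist_def)
  then have "y / gen P ^ n * (gen P / (u * x ^ j)) ^ n \<in> P"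
    using subring_closed(4)[OF R] subring_power[OF R generator_at[OF V' P j coord]] by blast
  also have "y / gen P ^ n * (gen P / (u * x ^ j)) ^ n = y / (u * x ^ j) ^ n"
    using gen(1)[OF P] by (simp add: power_divide)
  finally show ?thesis using V'(2) unfolding dominates_def by blast
qed

text \<open>The quotient \<open>y / u ^ n\<close> is a rational function \<open>h / k\<close> in \<open>x\<close>, and \<open>k\<close> may be taken of least degree. At a root of
  \<open>k\<close> it would have a pole, although \<open>y\<close> is regular at the center of the place there. So it is a polynomial,
  whose degree is bounded by regularity at infinity.\<close>

lemma sections_of_progression:
  assumes y: "y \<in> H0 C (twist (int n))" and fraction: "form_value (n + d) F X" "form_value d G Y" "Y \<noteq> 0" "y = X / Y"
  shows "y \<in> products n"
proof -
  obtain h0 k0 where hk0: "X = u ^ (n + d) * ev h0 x" "Y = u ^ d * ev k0 x"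
    using form_value_ratio[OF fraction(1)] form_value_ratio[OF fraction(2)] by metis
  let ?P = "\<lambda>(h, k). ev k x \<noteq> 0 \<and> y * ev k x = u ^ n * ev h x"
  have "?P (h0, k0)" using fraction(3,4) hk0 u by (auto simp: power_add field_simps)
  then obtain hk where "?P hk" and least: "\<And>hk'. ?P hk' \<Longrightarrow> degree (snd hk) \<le> degree (snd hk')"
    using ex_has_least_nat[of ?P _ "\<lambda>hk. degree (snd hk)"] by blast
  then obtain h k where hk: "ev k x \<noteq> 0" "y * ev k x = u ^ n * ev h x"
    and least': "\<And>h' k'. ev k' x \<noteq> 0 \<Longrightarrow> y * ev k' x = u ^ n * ev h' x \<Longrightarrow> degree k \<le> degree k'"
    by (cases hk) fastforce
  have k0: "k \<noteq> 0" using hk(1) by auto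
  have "degree k = 0"
  proof (rule ccontr)
    assume "degree k \<noteq> 0"
    then obtain c where c: "poly k c = 0" using alg_closed_imp_poly_has_root[of k] by blast
    then obtain k' where k': "k = [:- c, 1:] * k'" by (meson dvdE poly_eq_0_iff_dvd)
    have xc: "ev [:- c, 1:] x = x - \<iota> c" by (simp add: iota_minus)
    have "poly h c \<noteq> 0"
    proof
      assume "poly h c = 0"
      then obtain h' where h': "h = [:- c, 1:] * h'" by (meson dvdE poly_eq_0_iff_dvd)
      have nz: "x - \<iota> c \<noteq> 0" "ev k' x \<noteq> 0" using hk(1) unfolding k' ev_mult xc by auto
      have "(x - \<iota> c) * (y * ev k' x) = (x - \<iota> c) * (u ^ n * ev h' x)"
        using hk(2) unfolding k' h' ev_mult xc by (simp add: mult.left_commute)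
      then have "y * ev k' x = u ^ n * ev h' x" using nz(1) by simp
      then have "degree k \<le> degree k'" using least' nz(2) by blast
      moreover have "k' \<noteq> 0" using k0 k' by auto
      then have "degree k = Suc (degree k')" unfolding k' by (subst degree_mult_eq) auto
      ultimately show False by simp
    qed
    obtain W where W: "place W" "x - \<iota> c \<in> max_ideal W" using place_at[OF x] by blast
    note L = local_subringD[OF place_local[OF W(1)]]
    obtain P where P: "P \<in> closed_points C" "dominates W P" using center_exists[OF W(1)] .
    have evW: "ev q x \<in> W" for q
    proof -
      have "(ev q x - \<iota> (poly q c)) + \<iota> (poly q c) \<in> W"
        using subring_closed(6)[OF L(1) _ L(2)] residue_ev[OF place_local[OF W(1)] W(2)] max_ideal_subset by blast
      then show ?thesis by simp
    qed
    have "y / (u * x ^ 0) ^ n \<in> W"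
      using g_ge_2 evW by (intro regular_quotient[OF W(1) P(2,1) _ _ y]) auto
    then have yW: "y / u ^ n \<in> W" by simp
    have "ev k x \<in> max_ideal W" using residue_ev[OF place_local[OF W(1)] W(2), of k] c by simp
    then have "y / u ^ n * ev k x \<in> max_ideal W" using L(4)[OF yW] by blast
    also have "y / u ^ n * ev k x = ev h x" using hk(2) u by (simp add: field_simps)
    finally show False
      using residue_unique[OF place_local[OF W(1)] _ residue_ev[OF place_local[OF W(1)] W(2), of h]] \<open>poly h c \<noteq> 0\<close> by blast
  qed
  then obtain b where b: "k = [:b:]" using degree_eq_zeroE by blast
  have b0: "b \<noteq> 0" using k0 b by auto
  define f where "f = smult (inverse b) h"
  have yf: "y = u ^ n * ev f x"
  proof -
    have "ev f x = ev [:inverse b:] x * ev h x" unfolding f_def using ev_mult[of "[:inverse b:]" h x] by simp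
    then have "ev h x = \<iota> b * ev f x" using b0 by (simp add: iota_inverse)
    then have "y * \<iota> b = (u ^ n * ev f x) * \<iota> b" using hk(2) b by simp
    then show ?thesis using b0 by simp
  qed
  have deg: "degree f \<le> n * (g - 1)"
  proof (rule ccontr)
    assume big: "\<not> degree f \<le> n * (g - 1)"
    define e where "e = degree f"
    obtain W where W: "place W" "inverse x \<in> max_ideal W" using place_at[OF inverse_x, of 0] by auto
    note L = local_subringD[OF place_local[OF W(1)]]
    obtain P where P: "P \<in> closed_points C" "dominates W P" using center_exists[OF W(1)] .
    have inv: "inverse x ^ i \<in> W" for i
      using subring_power[OF L(1)] W(2) max_ideal_subset by blast
    have coord: "ev q x / x ^ (g - 1) \<in> W" if "q = 0 \<or> degree q < g" for q
    proof -
      have dq: "degree q \<le> g - 1" using that g_ge_2 by auto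
      show ?thesis unfolding ev_reversed[OF dq x0]
        by (intro subring_sum[OF L(1)] subring_closed(4)[OF L(1)] inv L(2))
    qed
    have "y / (u * x ^ (g - 1)) ^ n \<in> W"
      using g_ge_2 by (intro regular_quotient[OF W(1) P(2,1) _ coord y]) auto
    then have N: "ev f x / x ^ (n * (g - 1)) \<in> W"
      using u by (simp add: yf power_mult_distrib mult.commute flip: power_mult)
    obtain i where i: "e = n * (g - 1) + Suc i" using big less_imp_Suc_add unfolding e_def by (metis add_Suc_right not_le)
    have "ev f x / x ^ (n * (g - 1)) * inverse x ^ i * inverse x \<in> max_ideal W"
      using L(4)[OF subring_closed(4)[OF L(1) N inv] W(2)] .
    also have "ev f x / x ^ (n * (g - 1)) * inverse x ^ i * inverse x = ev f x / x ^ e"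
      using x0 unfolding i by (simp add: power_add field_simps)
    also have "\<dots> = (\<Sum>i\<le>e. \<iota> (coeff f i) * inverse x ^ (e - i))"
      using ev_reversed[OF _ x0] e_def by simp
    also have "\<dots> = (\<Sum>i<e. \<iota> (coeff f i) * inverse x ^ (e - i)) + \<iota> (coeff f e)"
      by (simp add: lessThan_Suc_atMost[symmetric])
    finally have 1: "(\<Sum>i<e. \<iota> (coeff f i) * inverse x ^ (e - i)) + \<iota> (coeff f e) \<in> max_ideal W" .
    have "\<iota> (coeff f i) * inverse x ^ (e - i) \<in> max_ideal W" if i: "i < e" for i
    proof -
      obtain m where m: "e - i = Suc m" using i by (metis Suc_diff_Suc)
      have "(\<iota> (coeff f i) * inverse x ^ m) * inverse x \<in> max_ideal W"
        using L(4)[OF subring_closed(4)[OF L(1) L(2) inv] W(2)] .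
      then show ?thesis unfolding m by (simp add: ac_simps)
    qed
    then have "(\<Sum>i<e. \<iota> (coeff f i) * inverse x ^ (e - i)) \<in> max_ideal W"
      by (intro subspace_sum[OF L(9)]) simp
    then have "\<iota> (coeff f e) \<in> max_ideal W" using L(7)[OF 1] by fastforce
    then have "coeff f e = 0" using iota_notin_max_ideal[OF place_local[OF W(1)]] by blast
    then show False using big by (simp add: e_def)
  qed
  have mem: "u ^ n * x ^ j \<in> products n" if "j \<le> n * (g - 1)" for j n
    using that
  proof (induction n arbitrary: j)
    case 0
    show ?case using 0 one_in_products by simp
  next
    case (Suc n)
    define i where "i = min j (g - 1)"
    have i: "i < g" "j - i \<le> n * (g - 1)" "i + (j - i) = j" using Suc.prems g_ge_2 by (auto simp: i_def)
    have "u * x ^ i \<in> H0 C \<omega>" unfolding V by (rule mem_progression[OF i(1)])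
    from products_mult[OF this Suc.IH[OF i(2)]]
    have "(u * x ^ i) * (u ^ n * x ^ (j - i)) \<in> products (Suc n)" .
    also have "(u * x ^ i) * (u ^ n * x ^ (j - i)) = u ^ Suc n * x ^ j"
      using i(3) by (metis (no_types, lifting) mult.assoc mult.left_commute power_Suc power_add)
    finally show ?case .
  qed
  have "y \<in> progression (u ^ n) x (Suc (n * (g - 1)))"
    unfolding progression_def by (intro CollectI exI[of _ f] conjI yf disjI2) (use deg in simp)
  moreover have "progression (u ^ n) x (Suc (n * (g - 1))) \<subseteq> products n"
  proof (rule progression_least)
    show "subspace (products n)" by (simp add: products_def)
  qed (use mem in simp)
  ultimately show ?thesis by (rule rev_subsetD)
qed

end

theorem projectively_normal_model: "projectively_normal g model"
  unfolding projectively_normal_def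
proof (intro allI impI ballI)
  fix n s assume n: "n \<ge> (1::nat)" and s: "s \<in> twisted_sections g model n"
  obtain y where y: "y \<in> H0 C (twist (int n))"
    "\<And>a. a \<in> model \<Longrightarrow> \<exists>d F G X Y. form_value (n + d) F X \<and> form_value d G Y \<and> Y \<noteq> 0 \<and> y = X / Y \<and>
       G a \<noteq> 0 \<and> s a = F a / G a"
    by (rule section_of_model[OF s]) blast
  obtain P0 where "P0 \<in> closed_points C" using closed_point_exists .
  then obtain a0 where "a0 \<in> model" using model_point by blast
  then obtain d F G X Y where fraction: "form_value (n + d) F X" "form_value d G Y" "Y \<noteq> 0" "y = X / Y"
    using y(2) by blast
  have "y \<in> products n"
  proof (cases "\<exists>u x. u \<noteq> 0 \<and> x \<notin> range \<iota> \<and> H0 C \<omega> = progression u x g")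
    case True
    then obtain u x where "u \<noteq> 0" "x \<notin> range \<iota>" "H0 C \<omega> = progression u x g" by blast
    then show ?thesis by (rule sections_of_progression[OF _ _ _ y(1) fraction])
  next
    case False
    then have "H0 C (twist (int n)) \<subseteq> products n" by (intro sections_are_products n) blast
    then show ?thesis using y(1) by (rule subsetD)
  qed
  then obtain H where H: "form_value n H y" using products_form_value by blast
  have "s a = H a" if a: "a \<in> model" for a
  proof -
    obtain d F G X Y where 1: "form_value (n + d) F X" "form_value d G Y" "Y \<noteq> 0" "y = X / Y" "G a \<noteq> 0" "s a = F a / G a"
      using y(2)[OF a] by blast
    have "form_value (n + d) (\<lambda>a. H a * G a) X" using form_value_mult[OF H 1(2)] 1(3,4) by simp
    then have "F a = H a * G a" using form_determined[OF 1(1) _ a] by blast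
    then show ?thesis using 1(5,6) by simp
  qed
  then show "\<exists>F\<in>forms g n. \<forall>a\<in>model. s a = F a" using H form_value_forms by blast
qed

end

theorem proposition5p5:
  fixes \<iota> :: "'k::alg_closed_field \<Rightarrow> 'a::field"
    and C :: "'a set set"
    and \<omega> :: "'a set \<Rightarrow> 'a set"
    and w :: "nat \<Rightarrow> 'a"
    and g :: nat
  assumes curve: "complete_integral_curve \<iota> C"
    and genus: "arithmetic_genus \<iota> C g"
    and g_ge_2: "g \<ge> 2"
    and dualizing: "dualizing_sheaf \<iota> C \<omega>"
    and basis: "is_basis \<iota> (H0 C \<omega>) g w"
    and gorenstein: "invertible_sheaf C \<omega>"
  shows "projectively_normal g (canonical_model \<iota> C \<omega> g w)"
proof -
  obtain t where t: "H1_form \<iota> C 1 (rank1 \<omega>) t"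
    "\<And>r F l. torsion_free_coherent C r F \<Longrightarrow> H1_form \<iota> C r F l \<Longrightarrow>
      \<exists>!c. c \<in> sheaf_hom C r F \<omega> \<and> (\<forall>\<xi>\<in>adeles C r F. l \<xi> = t (\<lambda>P. line (\<Sum>i<r. c i * \<xi> P i)))"
    using dualizing unfolding dualizing_sheaf_def by blast
  have coherent: "torsion_free_coherent C 1 (rank1 \<omega>)"
    using dualizing unfolding dualizing_sheaf_def by (rule conjunct1)
  interpret gorenstein_curve \<iota> C \<omega> w g t
    by unfold_locales (fact curve g_ge_2 basis gorenstein coherent t)+
  show ?thesis by (rule projectively_normal_model)
qed

end
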